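(* Let $\alpha: I\to\mathbb{C}^*$ be a regular curve parametrized by arclength $s$ on an interval $I\subset\mathbb{R}$, and let $\psi: N\to\mathbb{S}^{2n-1}\subset\mathbb{C}^n$ be a Legendrian immersion of an orientable manifold $N$ (of dimension $n-1$), with induced metric $g$ and Legendrian angle map $\beta_\psi$. Then the map $$\Phi: I\times N\to\mathbb{C}^n,\qquad \Phi(s,x)=\alpha(s)\,\psi(x),$$ is a Lagrangian immersion with induced metric $$\bar g = ds^2+|\alpha|^2 g,$$ and its Lagrangian angle map is $$\beta_\Phi(s,x)=G_\alpha(s)+\beta_\psi(x),\qquad G_\alpha:=\arg\alpha'+(n-1)\arg\alpha .$$ In addition, the gradient of $\beta_\Phi$ is $$\nabla_{\bar g}\beta_\Phi=\Big(G_\alpha'\,\partial_s,\ \tfrac{1}{|\alpha|^2}\nabla_g\beta_\psi\Big).$$ Moreover, denoting by $\bar D$ and $D$ the Levi-Civita connections of $\bar g$ and $g$ respectively, $$\bar D_{(\partial_s,0)}\nabla_{\bar g}\beta_\Phi=\Big(G_\alpha''\,\partial_s,\ -\frac{\langle\alpha',\alpha\rangle}{|\alpha|^4}\nabla_g\beta_\psi\Big)$$ and, for every vector field $X$ on $N$, $$\bar D_{(0,X)}\nabla_{\bar g}\beta_\Phi=\Big(-\frac{\langle\alpha',\alpha\rangle}{|\alpha|^2}\,d\beta_\psi(X)\,\partial_s,\ \frac{1}{|\alpha|^2}D_X\nabla_g\beta_\psi+G_\alpha'\frac{\langle\alpha',\alpha\rangle}{|\alpha|^2}X\Big).$$ Finally,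 the Laplacian of $\beta_\Phi$ is $$\Delta_{\bar g}\beta_\Phi=\frac{1}{|\alpha|^{n-1}}\frac{d}{ds}\Big(|\alpha|^{n-1}G_\alpha'\Big)+\frac{1}{|\alpha|^2}\Delta_g\beta_\psi .$$
   Context: On $\mathbb{C}^n$ put $(z,w)=\sum_j z_j\bar w_j$, $\langle\cdot,\cdot\rangle=\mathrm{Re}(\cdot,\cdot)$ (Euclidean metric), $\omega=-\mathrm{Im}(\cdot,\cdot)$ (symplectic form), and let $J$ be multiplication by $i$. An immersion of an $n$-manifold into $\mathbb{C}^n$ is Lagrangian if it pulls back $\omega$ to $0$. The Lagrangian angle of an oriented Lagrangian immersion $\Phi$ is the $\mathbb{R}/2\pi\mathbb{Z}$-valued map $\beta_\Phi=\arg\, (dz_1\wedge\dots\wedge dz_n)(d\Phi(e_1),\dots,d\Phi(e_n))$, where $(e_1,\dots,e_n)$ is any oriented tangent frame. The Liouville form $\Lambda$ is given by $2\Lambda_z(v)=\langle v,Jz\rangle$. An immersion $\psi$ of an $(n-1)$-manifold $N$ into the unit sphere $\mathbb{S}^{2n-1}\subset\mathbb{C}^n$ is Legendrian if $\psi^*\Lambda=0$. If $N$ is oriented, its Legendrian angle is the $\mathbb{R}/2\pi\mathbb{Z}$-valued map $\beta_\psi$ defined by $e^{i\beta_\psi(x)}=\det_{\mathbb{C}}\{\psi(x),d\psi(e_1),\dots,d\psi(e_{n-1})\}$ for any oriented orthonormal frame $(e_1,\dots,e_{n-1})$ of $T_xN$. An orientation of $N$ is fixed and $I\times N$ carries the product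 orientation (with $\partial_s$ first). For a non-vanishing complex function $f$, $\arg f\in\mathbb{R}/2\pi\mathbb{Z}$ is defined by $f=|f|e^{i\arg f}$. Gradients, derivatives and Laplacians of $\mathbb{R}/2\pi\mathbb{Z}$-valued maps are computed via local real-valued lifts, and $\Delta=\mathrm{div}\,\nabla$. Tangent vectors of $I\times N$ are written as pairs. *)

theory Defs
  imports "HOL-Analysis.Analysis" "HOL-Library.Real_Mod"
begin

section \<open>Angles: the group of reals modulo \<open>2\<pi>\<close>\<close>

quotient_type angle = real / "\<lambda>x y. [x = y] (rmod (2 * pi))"
  morphisms rep_angle angle_of
  by (auto intro!: equivpI reflpI sympI transpI intro: rcong_sym rcong_trans)

instantiation angle :: ab_group_add
begin

lift_definition zero_angle :: angle is 0 .
lift_definition plus_angle :: "angle \<Rightarrow> angle \<Rightarrow> angle" is "(+)" by (rule rcong_add)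
lift_definition uminus_angle :: "angle \<Rightarrow> angle" is uminus by (rule rcong_uminus)
lift_definition minus_angle :: "angle \<Rightarrow> angle \<Rightarrow> angle" is "(-)" by (rule rcong_diff)

instance
  by standard (transfer; simp add: algebra_simps)+

end

lift_definition cis_angle :: "angle \<Rightarrow> complex" is cis
proof -
  fix x y :: real assume "[x = y] (rmod 2 * pi)"
  then obtain n :: int where "y = x + 2 * pi * of_int n"
    by (auto simp: rcong_altdef mult.commute)
  then show "cis x = cis y"
    by (simp add: cis_mult[symmetric] cis_multiple_2pi)
qed

definition carg :: "complex \<Rightarrow> angle" where
  "carg z = angle_of (Arg z)"

lemma carg_eq: "z = of_real (norm z) * cis_angle (carg z)"
  unfolding carg_def cis_angle.abs_eq
  by (metis rcis_cmod_Arg rcis_def)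

definition local_lift :: "('a::topological_space \<Rightarrow> angle) \<Rightarrow> 'a \<Rightarrow> ('a \<Rightarrow> real) \<Rightarrow> bool" where
  "local_lift f p \<theta> \<longleftrightarrow>
     (\<exists>U. open U \<and> p \<in> U \<and> continuous_on U \<theta> \<and> (\<forall>q\<in>U. angle_of (\<theta> q) = f q))"

definition angle_deriv :: "(real \<Rightarrow> angle) \<Rightarrow> real \<Rightarrow> real" where
  "angle_deriv f s = deriv (SOME \<theta>. local_lift f s \<theta>) s"


section \<open>Smooth manifolds\<close>

text \<open>Used for open \<open>S\<close> and finite-dimensional domains, where it is the usual notion
  of being \<open>k\<close> times continuously differentiable.\<close>

primrec Ck_on :: "nat \<Rightarrow> 'a::real_normed_vector set \<Rightarrow> ('a \<Rightarrow> 'b::real_normed_vector) \<Rightarrow> bool"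
where
  "Ck_on 0 S f \<longleftrightarrow> continuous_on S f"
| "Ck_on (Suc k) S f \<longleftrightarrow>
     (\<forall>x\<in>S. f differentiable (at x)) \<and> (\<forall>v. Ck_on k S (\<lambda>x. frechet_derivative f (at x) v))"

definition smooth_on :: "'a::real_normed_vector set \<Rightarrow> ('a \<Rightarrow> 'b::real_normed_vector) \<Rightarrow> bool" where
  "smooth_on S f \<longleftrightarrow> (\<forall>k. Ck_on k S f)"

text \<open>An atlas of dimension \<open>CARD('m)\<close> is a family of charts indexed by a type \<open>'i\<close>; the manifold
  itself is the union of the chart domains, with the subspace topology of \<open>'a\<close>.\<close>

record ('i, 'a, 'm) atlas =
  chart_dom :: "'i \<Rightarrow> 'a set"
  chart_map :: "'i \<Rightarrow> 'a \<Rightarrow> (real, 'm) vec"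

definition points :: "('i, 'a, 'm::finite) atlas \<Rightarrow> 'a set" where
  "points A = (\<Union>i. chart_dom A i)"

definition chart_inv :: "('i, 'a, 'm::finite) atlas \<Rightarrow> 'i \<Rightarrow> real^'m \<Rightarrow> 'a" where
  "chart_inv A i = inv_into (chart_dom A i) (chart_map A i)"

definition transition :: "('i, 'a, 'm::finite) atlas \<Rightarrow> 'i \<Rightarrow> 'i \<Rightarrow> real^'m \<Rightarrow> real^'m" where
  "transition A i j = chart_map A j \<circ> chart_inv A i"

definition transition_deriv ::
  "('i, 'a, 'm::finite) atlas \<Rightarrow> 'a \<Rightarrow> 'i \<Rightarrow> 'i \<Rightarrow> real^'m \<Rightarrow> real^'m" where
  "transition_deriv A p i j = frechet_derivative (transition A i j) (at (chart_map A i p))"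

definition smooth_manifold ::
  "('i, 'a::{t2_space, second_countable_topology}, 'm::finite) atlas \<Rightarrow> bool" where
  "smooth_manifold A \<longleftrightarrow>
     (\<forall>i. open (chart_dom A i) \<and> open (chart_map A i ` chart_dom A i) \<and>
          homeomorphism (chart_dom A i) (chart_map A i ` chart_dom A i)
            (chart_map A i) (chart_inv A i)) \<and>
     (\<forall>i j. smooth_on (chart_map A i ` (chart_dom A i \<inter> chart_dom A j)) (transition A i j))"

text \<open>An oriented atlas carries the orientation for which all of its charts are positively oriented.\<close>

definition oriented_atlas :: "('i, 'a, 'm::finite) atlas \<Rightarrow> bool" where
  "oriented_atlas A \<longleftrightarrow>
     (\<forall>i j. \<forall>p \<in> chart_dom A i \<inter> chart_dom A j. 0 < det (matrix (transition_deriv A p i j)))"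

text \<open>A tangent vector at \<open>p\<close> is the family of its coordinate vectors in all charts around \<open>p\<close>,
  related by the derivatives of the transition maps (and zero, by convention, for the other
  chart indices).\<close>

type_synonym ('i, 'm) tvec = "'i \<Rightarrow> (real, 'm) vec"

definition tangent_space :: "('i, 'a, 'm::finite) atlas \<Rightarrow> 'a \<Rightarrow> ('i, 'm) tvec set" where
  "tangent_space A p =
     {v. (\<forall>i j. p \<in> chart_dom A i \<longrightarrow> p \<in> chart_dom A j \<longrightarrow> v j = transition_deriv A p i j (v i)) \<and>
         (\<forall>i. p \<notin> chart_dom A i \<longrightarrow> v i = 0)}"

definition chart_at :: "('i, 'a, 'm::finite) atlas \<Rightarrow> 'a \<Rightarrow> 'i" where
  "chart_at A p = (SOME i. p \<in> chart_dom A i)"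

text \<open>The tangent vector at \<open>p\<close> whose coordinate vector in the chart \<open>i\<close> is \<open>u\<close>.\<close>

definition tvec_of :: "('i, 'a, 'm::finite) atlas \<Rightarrow> 'a \<Rightarrow> 'i \<Rightarrow> real^'m \<Rightarrow> ('i, 'm) tvec" where
  "tvec_of A p i u = (\<lambda>j. if p \<in> chart_dom A j then transition_deriv A p i j u else 0)"

definition mdiff :: "('i, 'a, 'm::finite) atlas \<Rightarrow> ('a \<Rightarrow> 'b::real_normed_vector) \<Rightarrow> 'a
    \<Rightarrow> ('i, 'm) tvec \<Rightarrow> 'b" where
  "mdiff A f p v = (let i = chart_at A p in
     frechet_derivative (f \<circ> chart_inv A i) (at (chart_map A i p)) (v i))"

definition smooth_map_on :: "('i, 'a, 'm::finite) atlas \<Rightarrow> 'a set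
    \<Rightarrow> ('a \<Rightarrow> 'b::real_normed_vector) \<Rightarrow> bool" where
  "smooth_map_on A U f \<longleftrightarrow>
     (\<forall>i. smooth_on (chart_map A i ` (U \<inter> chart_dom A i)) (f \<circ> chart_inv A i))"

definition immersion :: "('i, 'a, 'm::finite) atlas \<Rightarrow> ('a \<Rightarrow> 'b::real_normed_vector) \<Rightarrow> bool" where
  "immersion A f \<longleftrightarrow> smooth_map_on A (points A) f \<and>
     (\<forall>p\<in>points A. inj_on (mdiff A f p) (tangent_space A p))"

text \<open>Smooth vector fields on an open subset \<open>U\<close> of the manifold.\<close>

definition smooth_vector_field ::
  "('i, 'a, 'm::finite) atlas \<Rightarrow> 'a set \<Rightarrow> ('a \<Rightarrow> ('i, 'm) tvec) \<Rightarrow> bool" where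
  "smooth_vector_field A U X \<longleftrightarrow> (\<forall>p\<in>U. X p \<in> tangent_space A p) \<and>
     (\<forall>i. smooth_on (chart_map A i ` (U \<inter> chart_dom A i)) (\<lambda>u. X (chart_inv A i u) i))"

text \<open>In coordinates, \<open>[X, Y] = dY(X) - dX(Y)\<close>.\<close>

definition lie_bracket :: "('i, 'a, 'm::finite) atlas \<Rightarrow> ('a \<Rightarrow> ('i, 'm) tvec)
    \<Rightarrow> ('a \<Rightarrow> ('i, 'm) tvec) \<Rightarrow> 'a \<Rightarrow> ('i, 'm) tvec" where
  "lie_bracket A X Y p = (\<lambda>i. if p \<in> chart_dom A i then
     frechet_derivative (\<lambda>u. Y (chart_inv A i u) i) (at (chart_map A i p)) (X p i) -
     frechet_derivative (\<lambda>u. X (chart_inv A i u) i) (at (chart_map A i p)) (Y p i) else 0)"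


section \<open>Riemannian geometry\<close>

type_synonym ('i, 'a, 'm) metric = "'a \<Rightarrow> ('i, 'm) tvec \<Rightarrow> ('i, 'm) tvec \<Rightarrow> real"

text \<open>\<open>D p v Y\<close> is the covariant derivative at \<open>p\<close> of the vector field \<open>Y\<close> in direction \<open>v\<close>.\<close>

type_synonym ('i, 'a, 'm) connection =
  "'a \<Rightarrow> ('i, 'm) tvec \<Rightarrow> ('a \<Rightarrow> ('i, 'm) tvec) \<Rightarrow> ('i, 'm) tvec"

definition induced_metric :: "('i, 'a, 'm::finite) atlas \<Rightarrow> ('a \<Rightarrow> 'b::real_inner)
    \<Rightarrow> ('i, 'a, 'm) metric" where
  "induced_metric A f p v w = inner (mdiff A f p v) (mdiff A f p w)"

text \<open>A connection is a local operator, so it is taken to act on vector fields that are only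
  defined on open subsets; this avoids the usual extension by bump functions.\<close>

definition affine_connection ::
  "('i, 'a::topological_space, 'm::finite) atlas \<Rightarrow> ('i, 'a, 'm) connection \<Rightarrow> bool" where
  "affine_connection A D \<longleftrightarrow>
     (\<forall>U. open U \<longrightarrow> U \<subseteq> points A \<longrightarrow>
       (\<forall>Y. smooth_vector_field A U Y \<longrightarrow>
         (\<forall>p\<in>U. \<forall>v\<in>tangent_space A p. D p v Y \<in> tangent_space A p) \<and>
         (\<forall>p\<in>U. \<forall>v\<in>tangent_space A p. \<forall>w\<in>tangent_space A p. \<forall>a b.
            D p (\<lambda>i. a *\<^sub>R v i + b *\<^sub>R w i) Y = (\<lambda>i. a *\<^sub>R D p v Y i + b *\<^sub>R D p w Y i)) \<and>
         (\<forall>f. smooth_map_on A U f \<longrightarrow> (\<forall>p\<in>U. \<forall>v\<in>tangent_space A p.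
            D p v (\<lambda>q i. f q *\<^sub>R Y q i) = (\<lambda>i. mdiff A f p v *\<^sub>R Y p i + f p *\<^sub>R D p v Y i))) \<and>
         (\<forall>Z. smooth_vector_field A U Z \<longrightarrow>
            (\<forall>p\<in>U. \<forall>v\<in>tangent_space A p.
               D p v (\<lambda>q i. Y q i + Z q i) = (\<lambda>i. D p v Y i + D p v Z i)) \<and>
            ((\<forall>q\<in>U. Y q = Z q) \<longrightarrow> (\<forall>p\<in>U. \<forall>v\<in>tangent_space A p. D p v Y = D p v Z)) \<and>
            smooth_vector_field A U (\<lambda>p. D p (Z p) Y))))"

definition levi_civita :: "('i, 'a::topological_space, 'm::finite) atlas \<Rightarrow> ('i, 'a, 'm) metric
    \<Rightarrow> ('i, 'a, 'm) connection \<Rightarrow> bool" where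
  "levi_civita A g D \<longleftrightarrow> affine_connection A D \<and>
     (\<forall>U X Y. open U \<longrightarrow> U \<subseteq> points A \<longrightarrow>
        smooth_vector_field A U X \<longrightarrow> smooth_vector_field A U Y \<longrightarrow>
        (\<forall>p\<in>U. (\<lambda>i. D p (X p) Y i - D p (Y p) X i) = lie_bracket A X Y p) \<and>
        (\<forall>p\<in>U. \<forall>v\<in>tangent_space A p.
           mdiff A (\<lambda>q. g q (X q) (Y q)) p v = g p (D p v X) (Y p) + g p (X p) (D p v Y)))"

definition angle_diff :: "('i, 'a::topological_space, 'm::finite) atlas \<Rightarrow> ('a \<Rightarrow> angle) \<Rightarrow> 'a
    \<Rightarrow> ('i, 'm) tvec \<Rightarrow> real" where
  "angle_diff A \<beta> p v = mdiff A (SOME \<theta>. local_lift \<beta> p \<theta>) p v"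

definition angle_grad :: "('i, 'a::topological_space, 'm::finite) atlas \<Rightarrow> ('i, 'a, 'm) metric
    \<Rightarrow> ('a \<Rightarrow> angle) \<Rightarrow> 'a \<Rightarrow> ('i, 'm) tvec" where
  "angle_grad A g \<beta> p = (THE v. v \<in> tangent_space A p \<and>
     (\<forall>w\<in>tangent_space A p. g p v w = angle_diff A \<beta> p w))"

text \<open>The trace of the endomorphism \<open>v \<mapsto> D\<^sub>v X\<close> of the tangent space, computed in the
  coordinate basis of a chart.\<close>

definition divergence :: "('i, 'a, 'm::finite) atlas \<Rightarrow> ('i, 'a, 'm) connection
    \<Rightarrow> ('a \<Rightarrow> ('i, 'm) tvec) \<Rightarrow> 'a \<Rightarrow> real" where
  "divergence A D X p = (let i = chart_at A p in
     trace (matrix (\<lambda>u. D p (tvec_of A p i u) X i)))"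

text \<open>Here \<open>D\<close> is meant to be the Levi-Civita connection of \<open>g\<close>.\<close>

definition angle_laplacian :: "('i, 'a::topological_space, 'm::finite) atlas
    \<Rightarrow> ('i, 'a, 'm) metric \<Rightarrow> ('i, 'a, 'm) connection \<Rightarrow> ('a \<Rightarrow> angle) \<Rightarrow> 'a \<Rightarrow> real" where
  "angle_laplacian A g D \<beta> p = divergence A D (angle_grad A g \<beta>) p"

text \<open>Frames, indexed by \<open>'m\<close> just as the coordinates are; permuting indices and
  coordinates simultaneously does not affect any of the determinants below.\<close>

definition oriented_frame :: "('i, 'a, 'm::finite) atlas \<Rightarrow> 'a \<Rightarrow> ('m \<Rightarrow> ('i, 'm) tvec) \<Rightarrow> bool" where
  "oriented_frame A p e \<longleftrightarrow> (\<forall>k. e k \<in> tangent_space A p) \<and>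
     (\<forall>i. p \<in> chart_dom A i \<longrightarrow> 0 < det (\<chi> r k. e k i $ r))"

definition oriented_orthonormal_frame :: "('i, 'a, 'm::finite) atlas \<Rightarrow> ('i, 'a, 'm) metric \<Rightarrow> 'a
    \<Rightarrow> ('m \<Rightarrow> ('i, 'm) tvec) \<Rightarrow> bool" where
  "oriented_orthonormal_frame A g p e \<longleftrightarrow> oriented_frame A p e \<and>
     (\<forall>k l. g p (e k) (e l) = (if k = l then 1 else 0))"


section \<open>Lagrangian and Legendrian immersions\<close>

text \<open>The Euclidean metric of \<open>complex^'n\<close> is its library inner product, which is the real
  part of \<^term>\<open>hermitian\<close>.\<close>

definition hermitian :: "complex^'n \<Rightarrow> complex^'n \<Rightarrow> complex" where
  "hermitian z w = (\<Sum>j\<in>UNIV. z $ j * cnj (w $ j))"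

lemma inner_eq_Re_hermitian: "inner z w = Re (hermitian z w)"
  by (simp add: hermitian_def inner_vec_def inner_complex_def)

definition symplectic_form :: "complex^'n \<Rightarrow> complex^'n \<Rightarrow> real" where
  "symplectic_form z w = - Im (hermitian z w)"

definition liouville_form :: "complex^'n \<Rightarrow> complex^'n \<Rightarrow> real" where
  "liouville_form z v = inner v (\<i> *s z) / 2"

definition lagrangian_immersion :: "('i, 'a, 'n::finite) atlas \<Rightarrow> ('a \<Rightarrow> complex^'n) \<Rightarrow> bool" where
  "lagrangian_immersion A f \<longleftrightarrow> immersion A f \<and>
     (\<forall>p\<in>points A. \<forall>v\<in>tangent_space A p. \<forall>w\<in>tangent_space A p.
        symplectic_form (mdiff A f p v) (mdiff A f p w) = 0)"

definition lagrangian_angle :: "('i, 'a, 'n::finite) atlas \<Rightarrow> ('a \<Rightarrow> complex^'n) \<Rightarrow> 'a \<Rightarrow> angle" where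
  "lagrangian_angle A f p = (THE \<beta>. \<forall>e. oriented_frame A p e \<longrightarrow>
     \<beta> = carg (det (\<chi> r k. mdiff A f p (e k) $ r)))"

text \<open>For a manifold of dimension \<open>n - 1 = CARD('m)\<close>, complex \<open>n\<close>-space is
  \<open>complex^('m option)\<close>, with \<open>None\<close> as first index.\<close>

definition legendrian_immersion ::
  "('i, 'a, 'm::finite) atlas \<Rightarrow> ('a \<Rightarrow> complex^('m option)) \<Rightarrow> bool" where
  "legendrian_immersion A f \<longleftrightarrow> immersion A f \<and> (\<forall>p\<in>points A. norm (f p) = 1) \<and>
     (\<forall>p\<in>points A. \<forall>v\<in>tangent_space A p. liouville_form (f p) (mdiff A f p v) = 0)"

definition legendrian_angle ::
  "('i, 'a, 'm::finite) atlas \<Rightarrow> ('a \<Rightarrow> complex^('m option)) \<Rightarrow> 'a \<Rightarrow> angle" where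
  "legendrian_angle A f p = (THE \<beta>. \<forall>e. oriented_orthonormal_frame A (induced_metric A f) p e \<longrightarrow>
     cis_angle \<beta> =
       det (\<chi> r c. case c of None \<Rightarrow> f p $ r | Some k \<Rightarrow> mdiff A f p (e k) $ r))"


section \<open>The product of an interval and a manifold\<close>

definition vec_cons :: "real \<Rightarrow> real^'m \<Rightarrow> real^('m option)" where
  "vec_cons a u = (\<chi> k. case k of None \<Rightarrow> a | Some j \<Rightarrow> u $ j)"

text \<open>As the interval coordinate comes first, an oriented atlas of the manifold yields the atlas
  of the product orientation.\<close>

definition prod_atlas :: "real set \<Rightarrow> ('i, 'a, 'm::finite) atlas \<Rightarrow> ('i, real \<times> 'a, 'm option) atlas"
where
  "prod_atlas I A = \<lparr>chart_dom = (\<lambda>i. I \<times> chart_dom A i),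
     chart_map = (\<lambda>i (s, p). vec_cons s (chart_map A i p))\<rparr>"

text \<open>The tangent vector \<open>(a \<partial>\<^sub>s, v)\<close> of the product at \<open>(s, p)\<close>.\<close>

definition tpair :: "('i, 'a, 'm::finite) atlas \<Rightarrow> 'a \<Rightarrow> real \<Rightarrow> ('i, 'm) tvec
    \<Rightarrow> ('i, 'm option) tvec" where
  "tpair A p a v = (\<lambda>i. if p \<in> chart_dom A i then vec_cons a (v i) else 0)"

definition vec_tail :: "real^('m option) \<Rightarrow> real^'m" where
  "vec_tail w = (\<chi> j. w $ Some j)"

lemma vec_cons_nth [simp]: "vec_cons a u $ None = a" "vec_cons a u $ Some j = u $ j"
  by (simp_all add: vec_cons_def)

lemma vec_tail_cons [simp]: "vec_tail (vec_cons a u) = u"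
  by (simp add: vec_tail_def vec_eq_iff)

lemma vec_cons_tail [simp]: "vec_cons (w $ None) (vec_tail w) = w"
  by (simp add: vec_tail_def vec_cons_def vec_eq_iff split: option.split)

lemma vec_cons_inject [simp]: "vec_cons a u = vec_cons b v \<longleftrightarrow> a = b \<and> u = v"
  by (metis vec_cons_nth(1) vec_tail_cons)

lemma bounded_linear_vec_tail: "bounded_linear vec_tail"
  by (rule linear_conv_bounded_linear[THEN iffD1], rule linearI)
     (simp_all add: vec_tail_def vec_eq_iff)

lemma bounded_linear_vec_cons: "bounded_linear (\<lambda>(a, u). vec_cons a u)"
  by (rule linear_conv_bounded_linear[THEN iffD1], rule linearI)
     (auto simp: vec_cons_def vec_eq_iff split: option.split)

lemma tangent_spaceI:
  assumes "\<And>i j. p \<in> chart_dom A i \<Longrightarrow> p \<in> chart_dom A j \<Longrightarrow> transition_deriv A p i j (v i) = v j"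
    and "\<And>i. p \<notin> chart_dom A i \<Longrightarrow> v i = 0"
  shows "v \<in> tangent_space A p"
  unfolding tangent_space_def mem_Collect_eq using assms(1)[symmetric] assms(2)
  by (intro conjI allI impI)

lemma tangent_spaceD:
  assumes "v \<in> tangent_space A p"
  shows "p \<in> chart_dom A i \<Longrightarrow> p \<in> chart_dom A j \<Longrightarrow> transition_deriv A p i j (v i) = v j"
    and "p \<notin> chart_dom A i \<Longrightarrow> v i = 0"
  using assms unfolding tangent_space_def mem_Collect_eq by (metis, metis)

lemma transition_deriv_prod:
  fixes A :: "('i, 'a::{t2_space, second_countable_topology}, 'm::finite) atlas"
  assumes A: "smooth_manifold A" and "open I" and s: "s \<in> I"
    and i: "x \<in> chart_dom A i" and j: "x \<in> chart_dom A j"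
  shows "transition_deriv (prod_atlas I A) (s, x) i j w =
           vec_cons (w $ None) (transition_deriv A x i j (vec_tail w))"
proof -
  let ?P = "prod_atlas I A" and ?S = "chart_map A i ` (chart_dom A i \<inter> chart_dom A j)"
  have hom: "homeomorphism (chart_dom A i) (chart_map A i ` chart_dom A i)
        (chart_map A i) (chart_inv A i)"
    and op: "open (chart_map A i ` chart_dom A i)" "open (chart_dom A i)" "open (chart_dom A j)"
    using A unfolding smooth_manifold_def by auto
  have cinv: "chart_inv A i (chart_map A i y) = y" if "y \<in> chart_dom A i" for y
    using hom that by (rule homeomorphism_apply1)
  then have inj: "inj_on (chart_map A i) (chart_dom A i)"
    by (rule inj_on_inverseI)
  have "openin (top_of_set (chart_map A i ` chart_dom A i)) ?S"
    by (rule homeomorphism_imp_open_map[OF hom]) (use op in \<open>auto simp: openin_open\<close>)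
  then have opS: "open ?S"
    using op(1) openin_open_trans by blast
  have "Ck_on (Suc 0) ?S (transition A i j)"
    using A unfolding smooth_manifold_def smooth_on_def by blast
  then have "transition A i j differentiable (at (chart_map A i x))"
    using i j by simp
  then have D: "(transition A i j has_derivative transition_deriv A x i j) (at (chart_map A i x))"
    unfolding transition_deriv_def by (simp add: frechet_derivative_works)
  define T where "T = {w. w $ None \<in> I \<and> vec_tail w \<in> ?S}"
  have "T = (\<lambda>w. w $ None) -` I \<inter> vec_tail -` ?S"
    by (auto simp: T_def)
  moreover have "open ((\<lambda>w::real^('m option). w $ None) -` I)"
    using \<open>open I\<close> by (intro open_vimage continuous_intros)
  moreover have "open (vec_tail -` ?S)"
    using opS by (intro open_vimage linear_continuous_on bounded_linear_vec_tail)
  ultimately have opT: "open T" by auto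
  have eq: "vec_cons (w $ None) (transition A i j (vec_tail w)) = transition ?P i j w"
    if wT: "w \<in> T" for w
  proof -
    obtain y where y: "y \<in> chart_dom A i" "y \<in> chart_dom A j" "vec_tail w = chart_map A i y"
      using wT unfolding T_def by blast
    have wI: "w $ None \<in> I" using wT by (simp add: T_def)
    have w: "w = chart_map ?P i (w $ None, y)"
      unfolding prod_atlas_def by (simp add: y(3)[symmetric])
    have injP: "inj_on (chart_map ?P i) (chart_dom ?P i)"
      using inj by (auto simp: inj_on_def prod_atlas_def)
    have "chart_inv ?P i w = (w $ None, y)"
      unfolding chart_inv_def
      using inv_into_f_f[OF injP, of "(w $ None, y)"] y(1) wI w by (simp add: prod_atlas_def)
    then show ?thesis
      using y cinv by (simp add: transition_def prod_atlas_def)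
  qed
  have "((\<lambda>w. transition A i j (vec_tail w)) has_derivative
          (\<lambda>w. transition_deriv A x i j (vec_tail w))) (at (vec_cons s (chart_map A i x)))"
    by (rule has_derivative_compose[OF bounded_linear_imp_has_derivative[OF bounded_linear_vec_tail]])
       (use D in simp)
  then have "((\<lambda>w. (w $ None, transition A i j (vec_tail w))) has_derivative
          (\<lambda>w. (w $ None, transition_deriv A x i j (vec_tail w))))
          (at (vec_cons s (chart_map A i x)))"
    by (intro has_derivative_Pair)
       (auto intro: bounded_linear_imp_has_derivative bounded_linear_vec_nth)
  from bounded_linear.has_derivative[OF bounded_linear_vec_cons this]
  have "((\<lambda>w. vec_cons (w $ None) (transition A i j (vec_tail w))) has_derivative
          (\<lambda>w. vec_cons (w $ None) (transition_deriv A x i j (vec_tail w))))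
          (at (vec_cons s (chart_map A i x)))"
    by simp
  then have "(transition ?P i j has_derivative
          (\<lambda>w. vec_cons (w $ None) (transition_deriv A x i j (vec_tail w))))
          (at (vec_cons s (chart_map A i x)))"
    by (rule has_derivative_transform_within_open[OF _ opT])
       (use s i j eq in \<open>auto simp: T_def\<close>)
  moreover have "chart_map ?P i (s, x) = vec_cons s (chart_map A i x)"
    by (simp add: prod_atlas_def)
  ultimately have "transition_deriv ?P (s, x) i j =
      (\<lambda>w. vec_cons (w $ None) (transition_deriv A x i j (vec_tail w)))"
    unfolding transition_deriv_def[of ?P] by (simp only: frechet_derivative_at[symmetric])
  then show ?thesis by simp
qed

text \<open>Every tangent vector of the product is such a pair.\<close>

lemma tangent_space_prod:
  fixes A :: "('i, 'a::{t2_space, second_countable_topology}, 'm::finite) atlas"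
  assumes A: "smooth_manifold A" and I: "open I" "s \<in> I" and x: "x \<in> points A"
  shows "tangent_space (prod_atlas I A) (s, x) = {tpair A x a v |a v. v \<in> tangent_space A x}"
proof -
  let ?P = "prod_atlas I A"
  have dom: "(s, x) \<in> chart_dom ?P i \<longleftrightarrow> x \<in> chart_dom A i" for i
    using I by (simp add: prod_atlas_def)
  note td = transition_deriv_prod[OF A I]
  obtain i0 where i0: "x \<in> chart_dom A i0" using x by (auto simp: points_def)
  show ?thesis
  proof (intro equalityI subsetI)
    fix V assume V: "V \<in> tangent_space ?P (s, x)"
    define v where "v = (\<lambda>i. if x \<in> chart_dom A i then vec_tail (V i) else 0)"
    have tr: "vec_cons (V i $ None) (transition_deriv A x i j (vec_tail (V i))) = V j"
      if "x \<in> chart_dom A i" "x \<in> chart_dom A j" for i j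
      using tangent_spaceD(1)[OF V, unfolded dom, OF that] unfolding td[OF that] .
    have "v \<in> tangent_space A x"
    proof (rule tangent_spaceI)
      fix i j assume ij: "x \<in> chart_dom A i" "x \<in> chart_dom A j"
      show "transition_deriv A x i j (v i) = v j"
        using arg_cong[OF tr[OF ij], of vec_tail] ij by (simp add: v_def)
    qed (simp add: v_def)
    moreover have "V = tpair A x (V i0 $ None) v"
    proof
      fix i show "V i = tpair A x (V i0 $ None) v i"
      proof (cases "x \<in> chart_dom A i")
        case True
        have "V i0 $ None = V i $ None"
          using arg_cong[OF tr[OF i0 True], of "\<lambda>w. w $ None"] by (simp only: vec_cons_nth)
        with True show ?thesis by (simp add: tpair_def v_def)
      next
        case False
        then show ?thesis
          using tangent_spaceD(2)[OF V, unfolded dom] by (simp add: tpair_def)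
      qed
    qed
    ultimately show "V \<in> {tpair A x a v |a v. v \<in> tangent_space A x}" by blast
  next
    fix V assume "V \<in> {tpair A x a v |a v. v \<in> tangent_space A x}"
    then obtain a v where V: "V = tpair A x a v" and v: "v \<in> tangent_space A x" by blast
    show "V \<in> tangent_space ?P (s, x)"
      by (rule tangent_spaceI) (simp_all add: dom V tpair_def td tangent_spaceD[OF v])
  qed
qed

end

theory Submission
  imports Defs
begin

text \<open>
  The theorem rests on one algebraic fact: for a Legendrian immersion \<open>\<psi>\<close> into the sphere, the
  Hermitian products of the vectors \<open>\<psi>\<close> and \<open>d\<psi>(v)\<close> are all real. Indeed \<open>\<psi>\<close> is a unit vector
  that is Hermitian orthogonal to the image of \<open>d\<psi>\<close> (the real part vanishes because \<open>|\<psi>| = 1\<close>, the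
  imaginary part because of the Liouville form), and differentiating this orthogonality, together
  with the symmetry of second derivatives, makes \<open>(d\<psi>(v), d\<psi>(w))\<close> real
  (\<open>hermitian_deriv_psi\<close>, \<open>hermitian_deriv_deriv\<close>). Since
  \<open>d\<Phi>(a \<partial>\<^sub>s, v) = a \<alpha>' \<psi> + \<alpha> d\<psi>(v)\<close>, the Hermitian product of two such vectors is the real number
  \<open>a b + |\<alpha>|\<^sup>2 g(v, w)\<close> (\<open>hermitian_cone\<close>). Its real part is the induced metric, and that its
  imaginary part vanishes says that \<open>\<Phi>\<close> is Lagrangian.

  The angles are read off from determinants in a chart with coordinate fields \<open>\<partial>\<^sub>k\<close>. Let
  \<open>W = det(\<psi>, \<partial>\<^sub>1\<psi>, ..., \<partial>\<^sub>m\<psi>)\<close>, where \<open>m = n - 1\<close> is the dimension of the manifold. A change of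
  oriented frame multiplies \<open>W\<close> by a positive number, so the Legendrian angle is \<open>arg W\<close>
  (\<open>legendrian_angle_eq\<close>). The corresponding determinant of \<open>\<Phi>\<close> is \<open>\<alpha>' \<alpha>\<^sup>m W\<close>, and its argument is
  \<open>G + arg W\<close>. As arguments of smooth non-vanishing functions, all angles have smooth local lifts
  with differential \<open>Im (dW / W)\<close>, and the formula for the gradient follows from the one for the
  metric.

  The connections are handled extrinsically. On an immersed submanifold with the induced metric, a
  connection that is torsion free and compatible with the metric has to be the tangential part of
  the derivative in the ambient Euclidean space (\<open>levi_civita_induced\<close>). So the covariant derivative
  of \<open>\<nabla>\<beta>\<^sub>\<Phi>\<close> is found by differentiating
  \<open>d\<Phi>(\<nabla>\<beta>\<^sub>\<Phi>) = G' \<alpha>' \<psi> + (\<alpha> / |\<alpha>|\<^sup>2) d\<psi>(\<nabla>\<beta>\<^sub>\<psi>)\<close>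
  and taking the real part of the Hermitian product with \<open>d\<Phi>(b \<partial>\<^sub>s, w)\<close>; by the first paragraph
  almost all terms are real or zero (\<open>connection_grad_Phi\<close>). The Laplacian is the trace of the
  resulting formula in the coordinate basis of a chart (\<open>laplacian_cone\<close>).

  For these computations the gradients must be smooth vector fields, which comes from solving for
  their coordinates by Cramer's rule (\<open>angle_grad_smooth\<close>).
\<close>

section \<open>Calculus of smooth maps\<close>

lemma frechet_derivative_eqI:
  "(f has_derivative F) (at x) \<Longrightarrow> frechet_derivative f (at x) = F"
  by (metis frechet_derivative_at)

text \<open>The derivatives in \<^const>\<open>Ck_on\<close> are those of the total function, but at points of an open
  set, so they see the values on \<open>S\<close> only.\<close>

lemma Ck_on_cong:
  assumes "open S" and "\<And>x. x \<in> S \<Longrightarrow> f x = g x" and "Ck_on k S f"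
  shows "Ck_on k S g"
  using assms
proof (induction k arbitrary: f g)
  case 0
  then show ?case using continuous_on_cong by force
next
  case (Suc k)
  have D: "(g has_derivative frechet_derivative f (at x)) (at x)" if "x \<in> S" for x
  proof (rule has_derivative_transform_within_open[OF _ \<open>open S\<close> that])
    show "(f has_derivative frechet_derivative f (at x)) (at x)"
      using Suc.prems that by (simp add: frechet_derivative_works)
  qed (use Suc.prems in auto)
  have "Ck_on k S (\<lambda>x. frechet_derivative g (at x) v)" for v
    by (rule Suc.IH[OF \<open>open S\<close>, of "\<lambda>x. frechet_derivative f (at x) v"])
       (use Suc.prems frechet_derivative_eqI[OF D] in auto)
  then show ?case using D by (auto simp: differentiable_def)
qed

text \<open>Lets a derivative be given by a formula instead of as a \<^const>\<open>frechet_derivative\<close>; all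
  closure properties below are inductions on \<open>k\<close> that use it.\<close>

lemma Ck_on_SucI:
  assumes "open S" and "\<And>x. x \<in> S \<Longrightarrow> (f has_derivative F x) (at x)"
    and "\<And>v. Ck_on k S (\<lambda>x. F x v)"
  shows "Ck_on (Suc k) S f"
proof -
  have "Ck_on k S (\<lambda>x. frechet_derivative f (at x) v)" for v
    by (rule Ck_on_cong[OF assms(1) _ assms(3)[of v]])
       (use frechet_derivative_eqI[OF assms(2)] in auto)
  then show ?thesis using assms(2) by (auto simp: differentiable_def)
qed

lemma Ck_on_SucD:
  assumes "Ck_on (Suc k) S f" shows "Ck_on k S f"
  using assms
proof (induction k arbitrary: f)
  case 0
  then show ?case
    by (auto intro!: differentiable_imp_continuous_on differentiable_at_imp_differentiable_on)
next
  case (Suc k)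
  then show ?case by (metis Ck_on.simps(2))
qed

lemma Ck_on_has_derivative:
  assumes "Ck_on (Suc k) S f" "x \<in> S"
  shows "(f has_derivative frechet_derivative f (at x)) (at x)"
  using assms by (simp add: frechet_derivative_works)

lemma Ck_on_mono: "Ck_on k S f \<Longrightarrow> T \<subseteq> S \<Longrightarrow> Ck_on k T f"
  by (induction k arbitrary: f) (auto intro: continuous_on_subset)

lemma Ck_on_const: "open S \<Longrightarrow> Ck_on k S (\<lambda>x. c)"
proof (induction k arbitrary: c)
  case (Suc k)
  show ?case by (rule Ck_on_SucI[where F = "\<lambda>x v. 0"]) (use Suc in auto)
qed auto

lemma Ck_on_bounded_linear:
  assumes "open S" "bounded_linear L" "Ck_on k S f"
  shows "Ck_on k S (\<lambda>x. L (f x))"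
  using assms(3)
proof (induction k arbitrary: f)
  case 0
  then show ?case by (auto intro: bounded_linear.continuous_on[OF assms(2)])
next
  case (Suc k)
  show ?case
  proof (rule Ck_on_SucI[OF assms(1)])
    show "((\<lambda>x. L (f x)) has_derivative (\<lambda>v. L (frechet_derivative f (at x) v))) (at x)"
      if "x \<in> S" for x
      by (rule bounded_linear.has_derivative[OF assms(2) Ck_on_has_derivative[OF Suc.prems that]])
    show "Ck_on k S (\<lambda>x. L (frechet_derivative f (at x) v))" for v
      using Suc by auto
  qed
qed

lemma Ck_on_add:
  assumes "open S" "Ck_on k S f" "Ck_on k S g"
  shows "Ck_on k S (\<lambda>x. f x + g x)"
  using assms(2,3)
proof (induction k arbitrary: f g)
  case 0
  then show ?case by (auto intro: continuous_on_add)
next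
  case (Suc k)
  show ?case
  proof (rule Ck_on_SucI[OF assms(1)])
    show "((\<lambda>x. f x + g x) has_derivative
        (\<lambda>v. frechet_derivative f (at x) v + frechet_derivative g (at x) v)) (at x)"
      if "x \<in> S" for x
      by (intro has_derivative_add Ck_on_has_derivative[OF Suc.prems(1) that]
          Ck_on_has_derivative[OF Suc.prems(2) that])
    show "Ck_on k S (\<lambda>x. frechet_derivative f (at x) v + frechet_derivative g (at x) v)" for v
      using Suc by auto
  qed
qed

lemma Ck_on_bilinear:
  assumes "open S" "bounded_bilinear B" "Ck_on k S f" "Ck_on k S g"
  shows "Ck_on k S (\<lambda>x. B (f x) (g x))"
  using assms(3,4)
proof (induction k arbitrary: f g)
  case 0
  then show ?case by (auto intro: bounded_bilinear.continuous_on[OF assms(2)])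
next
  case (Suc k)
  show ?case
  proof (rule Ck_on_SucI[OF assms(1)])
    show "((\<lambda>x. B (f x) (g x)) has_derivative
        (\<lambda>v. B (f x) (frechet_derivative g (at x) v) + B (frechet_derivative f (at x) v) (g x))) (at x)"
      if "x \<in> S" for x
      by (intro bounded_bilinear.FDERIV[OF assms(2)]
          Ck_on_has_derivative[OF Suc.prems(1) that] Ck_on_has_derivative[OF Suc.prems(2) that])
    show "Ck_on k S (\<lambda>x. B (f x) (frechet_derivative g (at x) v) + B (frechet_derivative f (at x) v) (g x))" for v
      using Suc.prems Ck_on_SucD[OF Suc.prems(1)] Ck_on_SucD[OF Suc.prems(2)]
      by (intro Ck_on_add[OF assms(1)] Suc.IH) auto
  qed
qed

lemma Ck_on_sum:
  assumes "open S" "\<And>i. i \<in> K \<Longrightarrow> Ck_on k S (f i)"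
  shows "Ck_on k S (\<lambda>x. \<Sum>i\<in>K. f i x)"
  using assms(2)
  by (induction K rule: infinite_finite_induct)
     (auto intro!: Ck_on_const Ck_on_add assms(1) simp: fun_eq_iff)

text \<open>By the chain rule, the derivative of \<open>h \<circ> f\<close> in direction \<open>v\<close> is the sum over a basis of the
  middle space of a component of \<open>Df(v)\<close> times \<open>Dh(b) \<circ> f\<close>. The sum only contains directional
  derivatives of \<open>h\<close> in fixed directions, to which the induction hypothesis applies; this is where
  the finite dimension enters.\<close>

lemma Ck_on_compose:
  fixes f :: "'a::real_normed_vector \<Rightarrow> 'b::euclidean_space" and h :: "'b \<Rightarrow> 'c::real_normed_vector"
  assumes "open S" "Ck_on k S f" "Ck_on k T h" "f ` S \<subseteq> T"
  shows "Ck_on k S (\<lambda>x. h (f x))"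
  using assms(2,3)
proof (induction k arbitrary: h)
  case 0
  then show ?case using assms(4) by (auto intro: continuous_on_compose2)
next
  case (Suc k)
  let ?Dh = "\<lambda>y. frechet_derivative h (at y)" and ?Df = "\<lambda>x. frechet_derivative f (at x)"
  have Dh: "(h has_derivative ?Dh (f x)) (at (f x))" if "x \<in> S" for x
    using Suc.prems(2) that assms(4) by (intro Ck_on_has_derivative) auto
  have lin: "linear (?Dh (f x))" if "x \<in> S" for x
    using Dh[OF that] has_derivative_linear by blast
  have eq: "?Dh (f x) (?Df x v) = (\<Sum>b\<in>Basis. (?Df x v \<bullet> b) *\<^sub>R ?Dh (f x) b)" if "x \<in> S" for x v
  proof -
    have "?Dh (f x) (?Df x v) = ?Dh (f x) (\<Sum>b\<in>Basis. (?Df x v \<bullet> b) *\<^sub>R b)"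
      by (simp add: euclidean_representation)
    then show ?thesis using lin[OF that] by (simp add: linear_sum linear_cmul)
  qed
  show ?case
  proof (rule Ck_on_SucI[OF assms(1)])
    show "((\<lambda>x. h (f x)) has_derivative (\<lambda>v. \<Sum>b\<in>Basis. (?Df x v \<bullet> b) *\<^sub>R ?Dh (f x) b)) (at x)"
      if "x \<in> S" for x
      using has_derivative_compose[OF Ck_on_has_derivative[OF Suc.prems(1) that] Dh[OF that]]
      by (simp add: eq[OF that])
    have b: "Ck_on k S (\<lambda>x. ?Dh (f x) b)" for b
      using Suc.IH[of "\<lambda>y. ?Dh y b"] Suc.prems Ck_on_SucD[OF Suc.prems(1)] by auto
    show "Ck_on k S (\<lambda>x. \<Sum>b\<in>Basis. (?Df x v \<bullet> b) *\<^sub>R ?Dh (f x) b)" for v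
      using Suc.prems(1)
      by (intro Ck_on_sum Ck_on_bilinear[OF _ bounded_bilinear_scaleR] assms(1) b
          Ck_on_bounded_linear[OF _ bounded_linear_inner_left]) auto
  qed
qed

lemma Ck_on_inverse:
  fixes f :: "'a::real_normed_vector \<Rightarrow> 'b::real_normed_field"
  assumes "open S" "Ck_on k S f" "\<And>x. x \<in> S \<Longrightarrow> f x \<noteq> 0"
  shows "Ck_on k S (\<lambda>x. inverse (f x))"
  using assms(2)
proof (induction k)
  case 0
  then show ?case using assms(3) by (auto intro: continuous_on_inverse)
next
  case (Suc k)
  show ?case
  proof (rule Ck_on_SucI[OF assms(1)])
    show "((\<lambda>x. inverse (f x)) has_derivative
        (\<lambda>v. - (inverse (f x) * frechet_derivative f (at x) v * inverse (f x)))) (at x)"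
      if "x \<in> S" for x
      by (intro Deriv.has_derivative_inverse Ck_on_has_derivative[OF Suc.prems that] assms(3)[OF that])
    have i: "Ck_on k S (\<lambda>x. inverse (f x))"
      using Suc Ck_on_SucD by blast
    show "Ck_on k S (\<lambda>x. - (inverse (f x) * frechet_derivative f (at x) v * inverse (f x)))" for v
      using Suc.prems
      by (intro Ck_on_bounded_linear[OF _ bounded_linear_minus[OF bounded_linear_ident]]
          Ck_on_bilinear[OF _ bounded_bilinear_mult] assms(1) i) auto
  qed
qed

lemma smooth_onD: "smooth_on S f \<Longrightarrow> Ck_on k S f"
  by (simp add: smooth_on_def)

lemma smooth_on_cong:
  "open S \<Longrightarrow> (\<And>x. x \<in> S \<Longrightarrow> f x = g x) \<Longrightarrow> smooth_on S f \<Longrightarrow> smooth_on S g"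
  unfolding smooth_on_def using Ck_on_cong by blast

lemma smooth_on_mono: "smooth_on S f \<Longrightarrow> T \<subseteq> S \<Longrightarrow> smooth_on T f"
  unfolding smooth_on_def using Ck_on_mono by blast

lemma smooth_on_const [simp, intro]: "open S \<Longrightarrow> smooth_on S (\<lambda>x. c)"
  unfolding smooth_on_def using Ck_on_const by blast

lemma smooth_on_has_derivative:
  "smooth_on S f \<Longrightarrow> x \<in> S \<Longrightarrow> (f has_derivative frechet_derivative f (at x)) (at x)"
  using Ck_on_has_derivative smooth_onD by blast

lemma smooth_on_derivative: "smooth_on S f \<Longrightarrow> smooth_on S (\<lambda>x. frechet_derivative f (at x) v)"
  unfolding smooth_on_def using Ck_on.simps(2) by blast

lemma smooth_on_continuous_on: "smooth_on S f \<Longrightarrow> continuous_on S f"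
  using smooth_onD[of S f 0] by simp

lemma smooth_onI_derivative:
  assumes "open S" and "\<And>x. x \<in> S \<Longrightarrow> (f has_derivative F x) (at x)"
    and "\<And>v. smooth_on S (\<lambda>x. F x v)"
  shows "smooth_on S f"
  unfolding smooth_on_def
proof
  show "Ck_on k S f" for k
    using Ck_on_SucI[OF assms(1,2) smooth_onD[OF assms(3)]] Ck_on_SucD by blast
qed

lemma smooth_on_bounded_linear:
  "open S \<Longrightarrow> bounded_linear L \<Longrightarrow> smooth_on S f \<Longrightarrow> smooth_on S (\<lambda>x. L (f x))"
  unfolding smooth_on_def using Ck_on_bounded_linear by blast

lemma smooth_on_ident: "open S \<Longrightarrow> smooth_on S (\<lambda>x. x)"
  by (rule smooth_onI_derivative[where F = "\<lambda>x v. v"]) auto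

lemma smooth_on_linear: "open S \<Longrightarrow> bounded_linear L \<Longrightarrow> smooth_on S L"
  using smooth_on_bounded_linear[of S L "\<lambda>x. x"] smooth_on_ident by auto

lemma smooth_on_bilinear:
  "open S \<Longrightarrow> bounded_bilinear B \<Longrightarrow> smooth_on S f \<Longrightarrow> smooth_on S g
    \<Longrightarrow> smooth_on S (\<lambda>x. B (f x) (g x))"
  unfolding smooth_on_def using Ck_on_bilinear by blast

lemma smooth_on_sum:
  "open S \<Longrightarrow> (\<And>i. i \<in> K \<Longrightarrow> smooth_on S (f i)) \<Longrightarrow> smooth_on S (\<lambda>x. \<Sum>i\<in>K. f i x)"
  unfolding smooth_on_def using Ck_on_sum[where K=K and f=f] by blast

lemma smooth_on_compose:
  fixes f :: "'a::real_normed_vector \<Rightarrow> 'b::euclidean_space" and h :: "'b \<Rightarrow> 'c::real_normed_vector"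
  assumes "open S" "smooth_on S f" "smooth_on T h" "f ` S \<subseteq> T"
  shows "smooth_on S (\<lambda>x. h (f x))"
  using assms Ck_on_compose unfolding smooth_on_def by blast

lemma smooth_on_inverse:
  fixes f :: "'a::real_normed_vector \<Rightarrow> 'b::real_normed_field"
  assumes "open S" "smooth_on S f" "\<And>x. x \<in> S \<Longrightarrow> f x \<noteq> 0"
  shows "smooth_on S (\<lambda>x. inverse (f x))"
  using assms Ck_on_inverse unfolding smooth_on_def by blast

lemmas smooth_on_mult = smooth_on_bilinear[OF _ bounded_bilinear_mult]
lemmas smooth_on_inner = smooth_on_bilinear[OF _ bounded_bilinear_inner]

lemma smooth_on_prod:
  fixes f :: "'i \<Rightarrow> 'a::real_normed_vector \<Rightarrow> 'b::real_normed_field"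
  assumes "open S" "\<And>i. i \<in> K \<Longrightarrow> smooth_on S (f i)"
  shows "smooth_on S (\<lambda>x. \<Prod>i\<in>K. f i x)"
  using assms(2)
  by (induction K rule: infinite_finite_induct)
     (auto intro!: smooth_on_const smooth_on_mult assms(1))

lemma smooth_on_divide:
  fixes f :: "'a::real_normed_vector \<Rightarrow> 'b::real_normed_field"
  assumes "open S" "smooth_on S f" "smooth_on S g" "\<And>x. x \<in> S \<Longrightarrow> g x \<noteq> 0"
  shows "smooth_on S (\<lambda>x. f x / g x)"
  unfolding divide_inverse by (intro smooth_on_mult smooth_on_inverse assms)

lemma smooth_on_power:
  fixes f :: "'a::real_normed_vector \<Rightarrow> 'b::real_normed_field"
  assumes "open S" "smooth_on S f"
  shows "smooth_on S (\<lambda>x. f x ^ k)"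
  by (induction k) (auto intro!: smooth_on_const smooth_on_mult assms)

lemma smooth_on_vec_nth:
  assumes "open S" "smooth_on S f" shows "smooth_on S (\<lambda>x. f x $ i)"
  by (rule smooth_on_bounded_linear[OF assms(1) bounded_linear_vec_nth assms(2)])

lemma bounded_linear_axis: "bounded_linear (axis i :: 'b::real_normed_vector \<Rightarrow> 'b^'n::finite)"
proof
  show "\<exists>K. \<forall>x::'b. norm (axis i x :: 'b^'n) \<le> norm x * K"
    by (rule exI[of _ 1])
       (simp add: norm_vec_def L2_set_def axis_def if_distrib[of "\<lambda>y. (norm y)\<^sup>2"] cong: if_cong)
qed (auto simp: axis_def vec_eq_iff)

lemma vec_lambda_eq_sum_axis: "(\<chi> i. f i) = (\<Sum>i\<in>UNIV. axis i (f i) :: 'b::real_normed_vector^'n::finite)"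
  by (simp add: vec_eq_iff axis_def if_distrib cong: if_cong)

lemma smooth_on_vec_lambda:
  fixes f :: "'n::finite \<Rightarrow> 'a::real_normed_vector \<Rightarrow> 'b::real_normed_vector"
  assumes "open S" "\<And>i. smooth_on S (f i)"
  shows "smooth_on S (\<lambda>x. \<chi> i. f i x)"
  unfolding vec_lambda_eq_sum_axis
  by (intro smooth_on_sum smooth_on_bounded_linear[OF _ bounded_linear_axis] assms)

lemma smooth_on_det:
  fixes M :: "'a::real_normed_vector \<Rightarrow> 'b::real_normed_field^'n::finite^'n"
  assumes "open S" "\<And>i j. smooth_on S (\<lambda>x. M x $ i $ j)"
  shows "smooth_on S (\<lambda>x. det (M x))"
  unfolding det_def by (intro smooth_on_sum smooth_on_mult smooth_on_prod smooth_on_const assms)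

section \<open>Symmetry of second derivatives\<close>

text \<open>The second difference on a square with sides \<open>t v\<close> and \<open>t w\<close> is \<open>t\<^sup>2\<close> times a mixed second
  derivative at some point of the square: apply the mean value theorem in direction \<open>v\<close> to the
  difference of the values on two opposite sides, and then in direction \<open>w\<close> to the derivative.\<close>

lemma second_difference_mvt:
  fixes g :: "'a::real_normed_vector \<Rightarrow> real"
  assumes C: "Ck_on 2 S g" and t: "0 < t"
    and sub: "\<And>a b. a \<in> {0..t} \<Longrightarrow> b \<in> {0..t} \<Longrightarrow> x + a *\<^sub>R v + b *\<^sub>R w \<in> S"
  obtains a b where "a \<in> {0..t}" "b \<in> {0..t}"
    "g (x + t *\<^sub>R v + t *\<^sub>R w) - g (x + t *\<^sub>R v) - g (x + t *\<^sub>R w) + g x =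
      t * t * frechet_derivative (\<lambda>y. frechet_derivative g (at y) v) (at (x + a *\<^sub>R v + b *\<^sub>R w)) w"
proof -
  have C2: "Ck_on (Suc (Suc 0)) S g" using C by (simp add: numeral_2_eq_2)
  let ?D = "\<lambda>y. frechet_derivative g (at y)"
  let ?DD = "\<lambda>y. frechet_derivative (\<lambda>y. ?D y v) (at y)"
  have D: "(g has_derivative ?D y) (at y)" if "y \<in> S" for y
    using Ck_on_has_derivative[OF C2 that] .
  have "Ck_on (Suc 0) S (\<lambda>y. ?D y v)" using C2 by (metis Ck_on.simps(2))
  then have DD: "((\<lambda>y. ?D y v) has_derivative ?DD y) (at y)" if "y \<in> S" for y
    using Ck_on_has_derivative that by blast
  have scale: "?D y (h *\<^sub>R u) = h * ?D y u" if "y \<in> S" for y h u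
    using linear_cmul[OF has_derivative_linear[OF D[OF that]]] by simp
  have scale2: "?DD y (h *\<^sub>R u) = h * ?DD y u" if "y \<in> S" for y h u
    using linear_cmul[OF has_derivative_linear[OF DD[OF that]]] by simp
  define h where "h a = g (x + a *\<^sub>R v + t *\<^sub>R w) - g (x + a *\<^sub>R v)" for a
  have m: "x + a *\<^sub>R v \<in> S" if "a \<in> {0..t}" for a using sub[OF that, of 0] t by simp
  have line: "((\<lambda>a. g (z + a *\<^sub>R u)) has_derivative (\<lambda>k. ?D (z + a *\<^sub>R u) (k *\<^sub>R u))) (at a)"
    if "z + a *\<^sub>R u \<in> S" for z a u
    by (rule has_derivative_compose[where f = "\<lambda>a. z + a *\<^sub>R u", OF _ D[OF that]]) (auto intro!: derivative_eq_intros)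
  have hd: "(h has_derivative (\<lambda>k. k * (?D (x + a *\<^sub>R v + t *\<^sub>R w) v - ?D (x + a *\<^sub>R v) v))) (at a)"
    if a: "a \<in> {0..t}" for a
  proof -
    have *: "x + t *\<^sub>R w + a *\<^sub>R v \<in> S" using sub[OF a, of t] t by (simp add: algebra_simps)
    show ?thesis
      using has_derivative_diff[OF line[OF *] line[OF m[OF a]]] scale[OF *] scale[OF m[OF a]]
      by (simp add: h_def[abs_def] algebra_simps)
  qed
  obtain a where a: "0 < a" "a < t"
    and ha: "h t - h 0 = t * (?D (x + a *\<^sub>R v + t *\<^sub>R w) v - ?D (x + a *\<^sub>R v) v)"
    using mvt_simple[OF t, of h "\<lambda>a k. k * (?D (x + a *\<^sub>R v + t *\<^sub>R w) v - ?D (x + a *\<^sub>R v) v)"]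
      hd[THEN has_derivative_at_withinI] by auto
  define j where "j b = ?D (x + a *\<^sub>R v + b *\<^sub>R w) v" for b
  have jd: "(j has_derivative (\<lambda>k. k * ?DD (x + a *\<^sub>R v + b *\<^sub>R w) w)) (at b)"
    if b: "b \<in> {0..t}" for b
  proof -
    have *: "x + a *\<^sub>R v + b *\<^sub>R w \<in> S" using sub[OF _ b, of a] a by simp
    have "((\<lambda>b. ?D (x + a *\<^sub>R v + b *\<^sub>R w) v) has_derivative
        (\<lambda>k. ?DD (x + a *\<^sub>R v + b *\<^sub>R w) (k *\<^sub>R w))) (at b)"
      by (rule has_derivative_compose[where f = "\<lambda>b. x + a *\<^sub>R v + b *\<^sub>R w", OF _ DD[OF *]])
         (auto intro!: derivative_eq_intros)
    then show ?thesis by (simp add: scale2[OF *] j_def[abs_def])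
  qed
  obtain b where b: "0 < b" "b < t" and jb: "j t - j 0 = t * ?DD (x + a *\<^sub>R v + b *\<^sub>R w) w"
    using mvt_simple[OF t, of j "\<lambda>b k. k * ?DD (x + a *\<^sub>R v + b *\<^sub>R w) w"]
      jd[THEN has_derivative_at_withinI] by auto
  show thesis
    using that[of a b] a b ha jb by (simp add: h_def j_def algebra_simps)
qed

text \<open>The second difference of \<open>second_difference_mvt\<close> is symmetric in \<open>v\<close> and \<open>w\<close>, so the two mixed
  derivatives agree at two points close to \<open>x\<close>, and hence at \<open>x\<close> by continuity.\<close>

lemma second_derivative_symmetric_real:
  fixes g :: "'a::real_normed_vector \<Rightarrow> real"
  assumes "open S" and C: "Ck_on 2 S g" and x: "x \<in> S"
  shows "frechet_derivative (\<lambda>y. frechet_derivative g (at y) v) (at x) w =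
         frechet_derivative (\<lambda>y. frechet_derivative g (at y) w) (at x) v"
proof -
  define H where "H v w y = frechet_derivative (\<lambda>y. frechet_derivative g (at y) v) (at y) w" for v w y
  have "continuous_on S (H v w)" for v w
    using C by (simp add: H_def[abs_def] numeral_2_eq_2)
  then have cont: "isCont (H v w) x" for v w
    using \<open>open S\<close> x continuous_on_eq_continuous_at by blast
  have "\<bar>H v w x - H w v x\<bar> \<le> e" if e: "e > 0" for e
  proof -
    obtain d0 where d0: "d0 > 0" "ball x d0 \<subseteq> S" using \<open>open S\<close> x openE by blast
    obtain d1 where d1: "d1 > 0" "\<And>y. dist y x < d1 \<Longrightarrow> dist (H v w y) (H v w x) < e/2"
      using cont[of v w] e unfolding continuous_at_eps_delta by (metis half_gt_zero)
    obtain d2 where d2: "d2 > 0" "\<And>y. dist y x < d2 \<Longrightarrow> dist (H w v y) (H w v x) < e/2"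
      using cont[of w v] e unfolding continuous_at_eps_delta by (metis half_gt_zero)
    define d where "d = min d0 (min d1 d2)"
    define N where "N = norm v + norm w + 1"
    have dN: "d > 0" "N > 0" using d0 d1 d2 by (auto simp: d_def N_def add_nonneg_pos)
    (* small enough for the square with sides t v and t w at x to lie in the ball of radius d *)
    define t where "t = d / N / 2"
    have t: "t > 0" using dN by (simp add: t_def)
    have close: "dist (x + a *\<^sub>R v' + b *\<^sub>R w') x < d"
      if "a \<in> {0..t}" "b \<in> {0..t}" "{v', w'} = {v, w}" for a b v' w'
    proof -
      have "dist (x + a *\<^sub>R v' + b *\<^sub>R w') x \<le> a * norm v' + b * norm w'"
        using that norm_triangle_ineq[of "a *\<^sub>R v'" "b *\<^sub>R w'"] by (simp add: dist_norm add.assoc)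
      also have "\<dots> \<le> t * norm v' + t * norm w'"
        using that by (intro add_mono mult_right_mono) auto
      also have "\<dots> = t * (norm v + norm w)"
        using that(3) by (auto simp: doubleton_eq_iff algebra_simps)
      also have "\<dots> < t * N" using t by (simp add: N_def)
      also have "\<dots> < d" using dN by (simp add: t_def)
      finally show ?thesis .
    qed
    have "x + a *\<^sub>R v' + b *\<^sub>R w' \<in> S"
      if "a \<in> {0..t}" "b \<in> {0..t}" "{v', w'} = {v, w}" for a b v' w'
      using close[OF that] d0 by (auto simp: d_def dist_commute)
    note sub = this
    obtain a b where ab: "a \<in> {0..t}" "b \<in> {0..t}"
      "g (x + t *\<^sub>R v + t *\<^sub>R w) - g (x + t *\<^sub>R v) - g (x + t *\<^sub>R w) + g x =
        t * t * H v w (x + a *\<^sub>R v + b *\<^sub>R w)"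
      using second_difference_mvt[OF C t sub, of v w] unfolding H_def by blast
    obtain a' b' where ab': "a' \<in> {0..t}" "b' \<in> {0..t}"
      "g (x + t *\<^sub>R w + t *\<^sub>R v) - g (x + t *\<^sub>R w) - g (x + t *\<^sub>R v) + g x =
        t * t * H w v (x + a' *\<^sub>R w + b' *\<^sub>R v)"
      using second_difference_mvt[OF C t sub, of w v] unfolding H_def by blast
    have "t * t * H v w (x + a *\<^sub>R v + b *\<^sub>R w) = t * t * H w v (x + a' *\<^sub>R w + b' *\<^sub>R v)"
      using ab(3) ab'(3) by (simp add: algebra_simps)
    then have "H v w (x + a *\<^sub>R v + b *\<^sub>R w) = H w v (x + a' *\<^sub>R w + b' *\<^sub>R v)"
      using t by simp
    moreover have "dist (H v w (x + a *\<^sub>R v + b *\<^sub>R w)) (H v w x) < e/2"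
      using close[OF ab(1,2)] by (intro d1(2)) (auto simp: d_def)
    moreover have "dist (H w v (x + a' *\<^sub>R w + b' *\<^sub>R v)) (H w v x) < e/2"
      using close[OF ab'(1,2)] by (intro d2(2)) (auto simp: d_def)
    ultimately show ?thesis by (simp add: dist_real_def abs_if split: if_splits)
  qed
  then have "\<bar>H v w x - H w v x\<bar> \<le> 0" by (rule field_le_epsilon[rule_format]) simp
  then show ?thesis by (simp add: H_def)
qed

lemma second_derivative_symmetric:
  fixes f :: "'a::real_normed_vector \<Rightarrow> 'b::euclidean_space"
  assumes "open S" and f: "smooth_on S f" and x: "x \<in> S"
  shows "frechet_derivative (\<lambda>y. frechet_derivative f (at y) v) (at x) w =
         frechet_derivative (\<lambda>y. frechet_derivative f (at y) w) (at x) v"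
proof (rule euclidean_eqI)
  fix c :: 'b
  let ?D = "\<lambda>y. frechet_derivative f (at y)" and ?g = "\<lambda>y. f y \<bullet> c"
  note inn = bounded_linear.has_derivative[OF bounded_linear_inner_left]
  have g: "frechet_derivative ?g (at y) = (\<lambda>u. ?D y u \<bullet> c)" if "y \<in> S" for y
    by (rule frechet_derivative_eqI[OF inn[OF smooth_on_has_derivative[OF f that]]])
  have "frechet_derivative (\<lambda>y. frechet_derivative ?g (at y) v) (at x) =
      (\<lambda>u. frechet_derivative (\<lambda>y. ?D y v) (at x) u \<bullet> c)" for v
    by (intro frechet_derivative_eqI has_derivative_transform_within_open[OF
          inn[OF smooth_on_has_derivative[OF smooth_on_derivative[OF f, of v] x]] \<open>open S\<close> x])
       (simp add: g)
  then show "frechet_derivative (\<lambda>y. ?D y v) (at x) w \<bullet> c = frechet_derivative (\<lambda>y. ?D y w) (at x) v \<bullet> c"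
    using second_derivative_symmetric_real[OF \<open>open S\<close> smooth_onD[OF
        smooth_on_bounded_linear[OF \<open>open S\<close> bounded_linear_inner_left f, of c]] x, of v w]
    by simp
qed

section \<open>Derivatives along vector fields\<close>

text \<open>The product rule for the derivative \<open>df(Y)\<close> of \<open>f\<close> along a varying vector \<open>y\<close>: one term with the
  second derivative of \<open>f\<close> for frozen \<open>y\<close>, and one with the derivative of \<open>y\<close>. Expanding \<open>y\<close> in a basis
  reduces it to the product rule for numbers and vectors.\<close>

lemma has_derivative_along_field:
  fixes f :: "'a::euclidean_space \<Rightarrow> 'b::real_normed_vector"
  assumes "open S" and f: "smooth_on S f" and y: "smooth_on S y" and u: "u \<in> S"
  shows "((\<lambda>z. frechet_derivative f (at z) (y z)) has_derivative
      (\<lambda>v. frechet_derivative (\<lambda>z. frechet_derivative f (at z) (y u)) (at u) v +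
           frechet_derivative f (at u) (frechet_derivative y (at u) v))) (at u)"
proof -
  let ?D = "\<lambda>z. frechet_derivative f (at z)"
  let ?DD = "\<lambda>b. frechet_derivative (\<lambda>z. ?D z b) (at u)" and ?Dy = "frechet_derivative y (at u)"
  have expand: "?D z w = (\<Sum>b\<in>Basis. (w \<bullet> b) *\<^sub>R ?D z b)" if "z \<in> S" for z w
  proof -
    have lin: "linear (?D z)" using smooth_on_has_derivative[OF f that] has_derivative_linear by blast
    have "?D z w = ?D z (\<Sum>b\<in>Basis. (w \<bullet> b) *\<^sub>R b)" by (simp add: euclidean_representation)
    then show ?thesis using lin by (simp add: linear_sum linear_cmul)
  qed
  have DD: "((\<lambda>z. ?D z b) has_derivative ?DD b) (at u)" for b
    by (rule smooth_on_has_derivative[OF smooth_on_derivative[OF f] u])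
  have DDsum: "?DD w = (\<lambda>v. \<Sum>b\<in>Basis. (w \<bullet> b) *\<^sub>R ?DD b v)" for w
  proof (rule frechet_derivative_eqI, rule has_derivative_transform_within_open[OF _ \<open>open S\<close> u])
    show "((\<lambda>z. \<Sum>b\<in>Basis. (w \<bullet> b) *\<^sub>R ?D z b) has_derivative
        (\<lambda>v. \<Sum>b\<in>Basis. (w \<bullet> b) *\<^sub>R ?DD b v)) (at u)"
      by (intro has_derivative_sum has_derivative_scaleR_right DD)
  qed (simp add: expand[symmetric])
  have "((\<lambda>z. \<Sum>b\<in>Basis. (y z \<bullet> b) *\<^sub>R ?D z b) has_derivative
      (\<lambda>v. \<Sum>b\<in>Basis. (y u \<bullet> b) *\<^sub>R ?DD b v + (?Dy v \<bullet> b) *\<^sub>R ?D u b)) (at u)"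
    by (intro has_derivative_sum has_derivative_scaleR DD
        bounded_linear.has_derivative[OF bounded_linear_inner_left] smooth_on_has_derivative[OF y u])
  also have "(\<lambda>v. \<Sum>b\<in>Basis. (y u \<bullet> b) *\<^sub>R ?DD b v + (?Dy v \<bullet> b) *\<^sub>R ?D u b) =
      (\<lambda>v. ?DD (y u) v + ?D u (?Dy v))"
    by (simp add: sum.distrib DDsum[of "y u"] expand[OF u, of "?Dy _"])
  finally show ?thesis
    by (rule has_derivative_transform_within_open[OF _ \<open>open S\<close> u]) (simp add: expand[symmetric])
qed

section \<open>Determinants\<close>

lemma det_of_real:
  fixes M :: "real^'n::finite^'n"
  shows "det ((\<chi> i j. of_real (M $ i $ j)) :: 'b::real_field^'n^'n) = of_real (det M)"
  by (simp add: det_def of_real_prod)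

lemma det_cnj: "det (\<chi> i j. cnj (M $ i $ j)) = cnj (det (M :: complex^'n::finite^'n))"
  by (simp add: det_def)

text \<open>Only these permutations contribute to the determinant of a matrix whose first column vanishes
  below the diagonal.\<close>

lemma permutes_option_fixing_None:
  "{p. p permutes (UNIV :: 'm::finite option set) \<and> p None = None} = map_option ` {p. p permutes UNIV}"
proof (intro equalityI subsetI)
  fix p :: "'m option \<Rightarrow> 'm option" assume "p \<in> {p. p permutes UNIV \<and> p None = None}"
  then have p: "p permutes UNIV" "p None = None" by auto
  then have inj: "inj p" using permutes_inj by blast
  have S: "\<exists>k'. p (Some k) = Some k'" for k
    using inj p(2) by (metis injD not_Some_eq)
  define q where "q k = the (p (Some k))" for k
  have q: "p (Some k) = Some (q k)" for k using S[of k] by (auto simp: q_def)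
  have "inj q" using inj q by (metis injI injD option.inject)
  then have "q permutes UNIV"
    by (simp add: permutes_def) (metis UNIV_I finite_UNIV_inj_surj finite_class.finite_UNIV inj_def surj_def)
  moreover have "p = map_option q"
    by (rule ext) (metis q p(2) not_Some_eq option.simps(8) option.simps(9))
  ultimately show "p \<in> map_option ` {p. p permutes UNIV}" by blast
next
  fix p :: "'m option \<Rightarrow> 'm option" assume "p \<in> map_option ` {p. p permutes UNIV}"
  then obtain q where q: "q permutes UNIV" "p = map_option q" by auto
  then have "inj p" using option.inj_map permutes_inj by blast
  then have "p permutes UNIV"
    by (simp add: permutes_def) (metis UNIV_I finite_UNIV_inj_surj finite_class.finite_UNIV inj_def surj_def)
  then show "p \<in> {p. p permutes UNIV \<and> p None = None}" using q by auto
qed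

lemma sign_map_option:
  assumes "p permutes (UNIV :: 'm::finite set)"
  shows "sign (map_option p) = sign p"
  using assms finite[of "UNIV :: 'm set"]
proof (induction rule: permutes_induct)
  case id
  show ?case by (simp only: option.map_id0 sign_id)
next
  case (swap a b p)
  have "map_option (Transposition.transpose a b \<circ> p) =
      Transposition.transpose (Some a) (Some b) \<circ> map_option p"
    by (rule ext, rename_tac x, case_tac x) (auto simp: Transposition.transpose_def)
  moreover have "map_option p permutes UNIV"
    using permutes_option_fixing_None[where ?'m = 'm] swap.hyps by blast
  ultimately have "sign (map_option (Transposition.transpose a b \<circ> p)) =
      sign (Transposition.transpose (Some a) (Some b)) * sign (map_option p)"
    by (metis finite permutation_permutes permutation_swap_id sign_compose)
  also have "\<dots> = sign (Transposition.transpose a b) * sign p"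
    using swap by (simp add: sign_swap_id)
  also have "\<dots> = sign (Transposition.transpose a b \<circ> p)"
    using swap.hyps by (metis finite permutation_permutes permutation_swap_id sign_compose)
  finally show ?case .
qed

text \<open>Expansion along the first column, for matrices indexed by \<^typ>\<open>'m option\<close>. A permutation that
  moves \<^const>\<open>None\<close> picks up one of the zeros in that column; the others are the permutations of
  \<^typ>\<open>'m\<close>, with the same sign.\<close>

lemma det_block_option:
  fixes M :: "'b::comm_ring_1^('m::finite option)^('m option)"
  assumes "\<And>k. M $ Some k $ None = 0"
  shows "det M = M $ None $ None * det (\<chi> i j. M $ Some i $ Some j)"
proof -
  let ?N = "\<chi> i j. M $ Some i $ Some j"
  let ?f = "\<lambda>p. of_int (sign p) * (\<Prod>i\<in>UNIV. M $ i $ p i)"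
  have "det M = sum ?f {p. p permutes UNIV}" by (simp add: det_def)
  also have "\<dots> = sum ?f {p. p permutes UNIV \<and> p None = None}"
  proof (rule sum.mono_neutral_right)
    show "\<forall>p\<in>{p. p permutes UNIV} - {p. p permutes UNIV \<and> p None = None}. ?f p = 0"
    proof
      fix p :: "'m option \<Rightarrow> 'm option"
      assume "p \<in> {p. p permutes UNIV} - {p. p permutes UNIV \<and> p None = None}"
      then have p: "p permutes UNIV" "p None \<noteq> None" by auto
      obtain i where i: "p i = None" using permutes_surj[OF p(1)] by (metis surjD)
      then obtain k where "i = Some k" using p(2) by (cases i) auto
      with i have "M $ i $ p i = 0" using assms by simp
      then have "(\<Prod>i\<in>UNIV. M $ i $ p i) = 0" by (intro prod_zero) auto
      then show "?f p = 0" by simp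
    qed
  qed auto
  also have "\<dots> = sum (?f \<circ> map_option) {p. p permutes UNIV}"
    unfolding permutes_option_fixing_None
  proof (rule sum.reindex, rule inj_onI)
    fix q r :: "'m \<Rightarrow> 'm" assume eq: "map_option q = map_option r"
    show "q = r" using fun_cong[OF eq, of "Some k" for k] by (auto simp: fun_eq_iff)
  qed
  also have "\<dots> = (\<Sum>p | p permutes UNIV. M $ None $ None * (of_int (sign p) * (\<Prod>i\<in>UNIV. ?N $ i $ p i)))"
    by (intro sum.cong) (auto simp: sign_map_option UNIV_option_conv prod.reindex)
  also have "\<dots> = M $ None $ None * det ?N" by (simp add: det_def sum_distrib_left)
  finally show ?thesis .
qed

section \<open>Angles and their local lifts\<close>

lemma cis_eq_iff: "cis a = cis b \<longleftrightarrow> (\<exists>n::int. a = b + 2 * pi * of_int n)"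
  using sin_cos_eq_iff[of a b] by (auto simp: complex_eq_iff)

lemma angle_of_eq_iff: "angle_of a = angle_of b \<longleftrightarrow> cis a = cis b"
proof -
  have "angle_of a = angle_of b \<longleftrightarrow> (\<exists>n::int. b = a + of_int n * (2 * pi))"
    by (simp add: angle.abs_eq_iff rcong_altdef)
  also have "\<dots> \<longleftrightarrow> cis b = cis a"
    by (auto simp: cis_eq_iff mult.commute)
  finally show ?thesis by auto
qed

lemma cis_angle_inject: "cis_angle x = cis_angle y \<longleftrightarrow> x = y"
  by (induct x rule: angle.abs_induct, induct y rule: angle.abs_induct)
     (simp add: cis_angle.abs_eq angle_of_eq_iff)

lemma cis_angle_add: "cis_angle (x + y) = cis_angle x * cis_angle y"
  by transfer (simp add: cis_mult)

lemma cis_angle_carg: "z \<noteq> 0 \<Longrightarrow> cis_angle (carg z) = sgn z"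
  by (simp add: carg_def cis_angle.abs_eq cis_Arg)

lemma carg_eqI: "z \<noteq> 0 \<Longrightarrow> cis_angle \<beta> = sgn z \<Longrightarrow> carg z = \<beta>"
  using cis_angle_carg cis_angle_inject by metis

lemma carg_mult: "z \<noteq> 0 \<Longrightarrow> w \<noteq> 0 \<Longrightarrow> carg (z * w) = carg z + carg w"
  by (rule carg_eqI) (auto simp: cis_angle_add cis_angle_carg sgn_mult)

lemma carg_power:
  assumes "z \<noteq> 0" shows "carg (z ^ k) = (\<Sum>_<k. carg z)"
proof (induction k)
  case 0
  show ?case by (rule carg_eqI) (auto simp: zero_angle_def cis_angle.abs_eq)
next
  case (Suc k)
  then show ?case using assms by (simp add: carg_mult add.commute)
qed

lemma carg_mult_pos: "0 < r \<Longrightarrow> z \<noteq> 0 \<Longrightarrow> carg (of_real r * z) = carg z"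
  by (intro carg_eqI) (auto simp: cis_angle_carg sgn_mult sgn_of_real)

lemma cis_Im_Ln: "z \<noteq> 0 \<Longrightarrow> cis (Im (Ln z)) = sgn z"
  using Arg_eq_Im_Ln cis_Arg by metis

text \<open>The argument of \<open>W\<close> is lifted relative to its value at \<open>p\<close>: near \<open>p\<close> the quotient \<open>W q / W p\<close> is
  close to \<open>1\<close>, where the principal logarithm is continuous, whereas \<open>W p\<close> itself may lie on the
  branch cut.\<close>

lemma local_lift_exists:
  fixes W :: "'a::topological_space \<Rightarrow> complex"
  assumes U: "open U" "p \<in> U" and W: "continuous_on U W" "\<And>q. q \<in> U \<Longrightarrow> W q \<noteq> 0"
    and \<beta>: "\<And>q. q \<in> U \<Longrightarrow> \<beta> q = carg (W q)"
  shows "local_lift \<beta> p (\<lambda>q. Arg (W p) + Im (Ln (W q / W p)))"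
proof -
  define U' where "U' = (\<lambda>q. W q / W p) -` (- \<real>\<^sub>\<le>\<^sub>0) \<inter> U"
  have c: "continuous_on U (\<lambda>q. W q / W p)"
    by (intro continuous_intros W) (use W U in auto)
  have "open U'"
    unfolding U'_def using continuous_on_open_vimage[OF \<open>open U\<close>] c closed_nonpos_Reals_complex
    by (metis open_Compl)
  moreover have "p \<in> U'" using U W by (simp add: U'_def)
  moreover have "continuous_on U' (\<lambda>q. Arg (W p) + Im (Ln (W q / W p)))"
    by (intro continuous_intros continuous_on_subset[OF c]) (auto simp: U'_def)
  moreover have "angle_of (Arg (W p) + Im (Ln (W q / W p))) = \<beta> q" if "q \<in> U'" for q
  proof -
    have q: "q \<in> U" "W q \<noteq> 0" "W p \<noteq> 0" using that W U by (auto simp: U'_def)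
    have "cis (Arg (W p) + Im (Ln (W q / W p))) = sgn (W p) * sgn (W q / W p)"
      using q by (simp add: cis_mult[symmetric] cis_Arg cis_Im_Ln)
    also have "\<dots> = sgn (W q)" using q by (subst sgn_mult[symmetric]) simp
    finally show ?thesis using \<beta>[OF q(1)] carg_eqI[OF q(2), symmetric]
      by (metis cis_angle.abs_eq)
  qed
  ultimately show ?thesis unfolding local_lift_def by blast
qed

text \<open>Two lifts differ by a continuous function with values in \<open>2\<pi>\<int>\<close>, which is constant near \<open>p\<close>. As the
  derivative of an angle is defined through an arbitrary choice of lift, this is what gives it a
  value.\<close>

lemma local_lift_unique:
  fixes \<beta> :: "'a::t2_space \<Rightarrow> angle"
  assumes "local_lift \<beta> p \<theta>" "local_lift \<beta> p \<eta>"
  shows "\<forall>\<^sub>F q in nhds p. \<theta> q - \<theta> p = \<eta> q - \<eta> p"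
proof -
  obtain U where U: "open U" "p \<in> U" "continuous_on U \<theta>" "\<And>q. q \<in> U \<Longrightarrow> angle_of (\<theta> q) = \<beta> q"
    using assms(1) unfolding local_lift_def by auto
  obtain V where V: "open V" "p \<in> V" "continuous_on V \<eta>" "\<And>q. q \<in> V \<Longrightarrow> angle_of (\<eta> q) = \<beta> q"
    using assms(2) unfolding local_lift_def by auto
  let ?d = "\<lambda>q. \<theta> q - \<eta> q"
  have "continuous_on (U \<inter> V) ?d"
    by (intro continuous_on_diff continuous_on_subset[OF U(3)] continuous_on_subset[OF V(3)]) auto
  then have "isCont ?d p" using U V by (simp add: continuous_on_eq_continuous_at)
  then have "(?d \<longlongrightarrow> ?d p) (nhds p)"
    by (simp add: isCont_def tendsto_nhds_iff)
  then have close: "\<forall>\<^sub>F q in nhds p. dist (?d q) (?d p) < 2 * pi"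
    by (rule tendstoD) simp
  have near: "\<forall>\<^sub>F q in nhds p. q \<in> U \<inter> V"
    using U V by (intro eventually_nhds_in_open) auto
  have ex: "\<exists>n::int. ?d q = 2 * pi * of_int n" if "q \<in> U \<inter> V" for q
  proof -
    have "cis (\<theta> q) = cis (\<eta> q)" using U(4)[of q] V(4)[of q] that angle_of_eq_iff[of "\<theta> q" "\<eta> q"] by auto
    then obtain n :: int where "\<theta> q = \<eta> q + 2 * pi * of_int n" unfolding cis_eq_iff by auto
    then show ?thesis by auto
  qed
  define n where "n q = (SOME n::int. ?d q = 2 * pi * of_int n)" for q
  have n: "?d q = 2 * pi * of_int (n q)" if "q \<in> U \<inter> V" for q
    unfolding n_def by (rule someI_ex) (rule ex[OF that])
  show ?thesis
    using close near
  proof eventually_elim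
    case (elim q)
    have "\<bar>2 * pi * real_of_int (n q) - 2 * pi * of_int (n p)\<bar> < 2 * pi"
      using elim n[of q] n[of p] U V by (simp add: dist_real_def)
    then have "2 * pi * \<bar>real_of_int (n q - n p)\<bar> < 2 * pi * 1"
      by (simp add: abs_mult flip: right_diff_distrib)
    then have "\<bar>real_of_int (n q - n p)\<bar> < 1"
      using pi_gt_zero by (metis mult_less_cancel_left_pos mult_pos_pos zero_less_numeral)
    then have "n q = n p" by linarith
    then show ?case using elim n[of q] n[of p] U V by auto
  qed
qed

text \<open>The logarithmic derivative of \<open>W\<close> has imaginary part \<open>d arg W\<close>. The map \<open>c\<close> is the inverse of a
  chart, or the identity for curves.\<close>

lemma local_lift_has_derivative:
  fixes c :: "'c::real_normed_vector \<Rightarrow> 'a::t2_space" and W :: "'a \<Rightarrow> complex"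
  assumes U: "open U" "p \<in> U" and W: "continuous_on U W" "\<And>q. q \<in> U \<Longrightarrow> W q \<noteq> 0"
    and \<beta>: "\<And>q. q \<in> U \<Longrightarrow> \<beta> q = carg (W q)"
    and c: "isCont c u" "c u = p" and D: "((\<lambda>y. W (c y)) has_derivative D) (at u)"
    and \<theta>: "local_lift \<beta> p \<theta>"
  shows "((\<lambda>y. \<theta> (c y)) has_derivative (\<lambda>v. Im (D v / W p))) (at u)"
proof -
  have Wp: "W p \<noteq> 0" using U W by auto
  have "\<forall>\<^sub>F q in nhds p. \<theta> q = \<theta> p + Im (Ln (W q / W p))"
    using local_lift_unique[OF \<theta> local_lift_exists[OF U W \<beta>]] Wp by (simp add: algebra_simps)
  moreover have "filterlim c (nhds p) (nhds u)"
    using c(1) unfolding isCont_def c(2)[symmetric] by (simp only: tendsto_at_iff_tendsto_nhds)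
  ultimately have ev: "\<forall>\<^sub>F y in nhds u. \<theta> (c y) = \<theta> p + Im (Ln (W (c y) / W p))"
    by (rule eventually_compose_filterlim)
  have "((\<lambda>y. W (c y) / W p) has_derivative (\<lambda>v. D v / W p)) (at u)"
    using bounded_linear.has_derivative[OF bounded_linear_divide D] .
  then have "((\<lambda>y. Ln (W (c y) / W p)) has_derivative (\<lambda>v. 1 * (D v / W p))) (at u)"
  proof (rule has_derivative_compose)
    have "(Ln has_field_derivative inverse 1) (at 1)" by (rule has_field_derivative_Ln) simp
    then show "(Ln has_derivative (*) 1) (at (W (c u) / W p))"
      using c Wp by (simp add: has_field_derivative_def)
  qed
  then have "((\<lambda>y. \<theta> p + Im (Ln (W (c y) / W p))) has_derivative (\<lambda>v. Im (D v / W p))) (at u)"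
    by (auto intro!: derivative_eq_intros)
  then show ?thesis
  proof (rule has_derivative_transform_eventually)
    show "\<forall>\<^sub>F y in at u. \<theta> p + Im (Ln (W (c y) / W p)) = \<theta> (c y)"
      using ev by (auto simp: eventually_at_filter elim: eventually_mono)
  qed (use c Wp in auto)
qed

section \<open>Charts, tangent vectors and differentials\<close>

locale manifold =
  fixes A :: "('i, 'a::{t2_space, second_countable_topology}, 'm::finite) atlas"
  assumes smooth_manifold: "smooth_manifold A"
begin

lemma open_chart_dom: "open (chart_dom A i)"
  using smooth_manifold unfolding smooth_manifold_def by auto

lemma chart_homeomorphism:
  "homeomorphism (chart_dom A i) (chart_map A i ` chart_dom A i) (chart_map A i) (chart_inv A i)"
  using smooth_manifold unfolding smooth_manifold_def by auto

lemma chart_inv_map [simp]: "p \<in> chart_dom A i \<Longrightarrow> chart_inv A i (chart_map A i p) = p"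
  using chart_homeomorphism homeomorphism_apply1 by blast

lemma open_points: "open (points A)"
  unfolding points_def using open_chart_dom by auto

lemma open_chart_image: "open U \<Longrightarrow> open (chart_map A i ` (U \<inter> chart_dom A i))"
proof -
  assume U: "open U"
  have "openin (top_of_set (chart_map A i ` chart_dom A i)) (chart_map A i ` (U \<inter> chart_dom A i))"
    by (rule homeomorphism_imp_open_map[OF chart_homeomorphism]) (use U in \<open>auto simp: openin_open\<close>)
  moreover have "open (chart_map A i ` chart_dom A i)"
    using smooth_manifold unfolding smooth_manifold_def by auto
  ultimately show ?thesis using openin_open_trans by blast
qed

lemma open_chart_image_subset: "open U \<Longrightarrow> U \<subseteq> chart_dom A i \<Longrightarrow> open (chart_map A i ` U)"
  using open_chart_image[of U i] by (simp add: Int_absorb2)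

lemma isCont_chart_inv:
  assumes "p \<in> chart_dom A i" shows "isCont (chart_inv A i) (chart_map A i p)"
proof -
  have "continuous_on (chart_map A i ` chart_dom A i) (chart_inv A i)"
    using chart_homeomorphism homeomorphism_def by metis
  moreover have "open (chart_map A i ` chart_dom A i)"
    by (intro open_chart_image_subset open_chart_dom) auto
  ultimately show ?thesis using assms continuous_on_eq_continuous_at by blast
qed

lemma transition_smooth:
  "smooth_on (chart_map A i ` (chart_dom A i \<inter> chart_dom A j)) (transition A i j)"
  using smooth_manifold unfolding smooth_manifold_def by auto

lemma transition_has_derivative:
  assumes "p \<in> chart_dom A i" "p \<in> chart_dom A j"
  shows "(transition A i j has_derivative transition_deriv A p i j) (at (chart_map A i p))"
  unfolding transition_deriv_def
  by (rule smooth_on_has_derivative[OF transition_smooth]) (use assms in auto)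

lemma linear_transition_deriv:
  "p \<in> chart_dom A i \<Longrightarrow> p \<in> chart_dom A j \<Longrightarrow> linear (transition_deriv A p i j)"
  using transition_has_derivative has_derivative_linear by blast

text \<open>Two coordinate expressions of \<open>f\<close> differ by a transition map, so this is the chain rule. It
  makes differentials, and hence tangent vectors, independent of the chart.\<close>

lemma has_derivative_change_chart:
  assumes i: "p \<in> chart_dom A i" and j: "p \<in> chart_dom A j"
    and f: "(f \<circ> chart_inv A j has_derivative F) (at (chart_map A j p))"
  shows "(f \<circ> chart_inv A i has_derivative (\<lambda>u. F (transition_deriv A p i j u))) (at (chart_map A i p))"
proof (rule has_derivative_transform_within_open)
  show "((\<lambda>u. (f \<circ> chart_inv A j) (transition A i j u)) has_derivative
      (\<lambda>u. F (transition_deriv A p i j u))) (at (chart_map A i p))"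
    by (rule has_derivative_compose[OF transition_has_derivative[OF i j]])
       (use f i in \<open>simp add: transition_def o_def\<close>)
  show "open (chart_map A i ` (chart_dom A j \<inter> chart_dom A i))"
    by (rule open_chart_image[OF open_chart_dom])
qed (use i j in \<open>auto simp: transition_def\<close>)

lemma transition_deriv_comp:
  assumes "p \<in> chart_dom A i" "p \<in> chart_dom A j" "p \<in> chart_dom A k"
  shows "transition_deriv A p j k (transition_deriv A p i j u) = transition_deriv A p i k u"
  using has_derivative_change_chart[OF assms(1,2), of "chart_map A k"]
    transition_has_derivative[OF assms(2,3)] transition_has_derivative[OF assms(1,3)]
    has_derivative_unique unfolding transition_def[symmetric] by metis

lemma transition_deriv_self:
  assumes "p \<in> chart_dom A i"
  shows "transition_deriv A p i i u = u"
proof -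
  have "(transition A i i has_derivative (\<lambda>u. u)) (at (chart_map A i p))"
    by (rule has_derivative_transform_within_open[OF has_derivative_ident,
          of "chart_map A i ` chart_dom A i"])
       (use assms open_chart_image_subset[OF open_chart_dom] in \<open>auto simp: transition_def\<close>)
  then show ?thesis
    using transition_has_derivative[OF assms assms] has_derivative_unique by metis
qed

lemma tvec_of_in_tangent_space: "p \<in> chart_dom A i \<Longrightarrow> tvec_of A p i u \<in> tangent_space A p"
  by (rule tangent_spaceI) (auto simp: tvec_of_def transition_deriv_comp)

lemma tvec_of_same: "p \<in> chart_dom A i \<Longrightarrow> tvec_of A p i u i = u"
  by (simp add: tvec_of_def transition_deriv_self)

lemma tangent_eqI:
  assumes "v \<in> tangent_space A p" "w \<in> tangent_space A p" "p \<in> chart_dom A i" "v i = w i"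
  shows "v = w"
proof
  fix j show "v j = w j"
    using tangent_spaceD(1)[OF assms(1), of i j] tangent_spaceD(1)[OF assms(2), of i j]
      tangent_spaceD(2)[OF assms(1), of j] tangent_spaceD(2)[OF assms(2), of j] assms(3,4)
    by (cases "p \<in> chart_dom A j") auto
qed

lemma tvec_of_coordinate:
  "v \<in> tangent_space A p \<Longrightarrow> p \<in> chart_dom A i \<Longrightarrow> tvec_of A p i (v i) = v"
  by (rule tangent_eqI[OF tvec_of_in_tangent_space]) (auto simp: tvec_of_same)

lemma tangent_space_lincomb:
  assumes "v \<in> tangent_space A p" "w \<in> tangent_space A p"
  shows "(\<lambda>i. a *\<^sub>R v i + b *\<^sub>R w i) \<in> tangent_space A p"
  by (rule tangent_spaceI)
     (use assms in \<open>auto simp: tangent_spaceD linear_add[OF linear_transition_deriv]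
        linear_cmul[OF linear_transition_deriv]\<close>)

lemma tangent_space_zero: "(\<lambda>_. 0) \<in> tangent_space A p"
  by (rule tangent_spaceI) (auto simp: linear_0[OF linear_transition_deriv])

lemma tangent_space_scale:
  "v \<in> tangent_space A p \<Longrightarrow> (\<lambda>i. a *\<^sub>R v i) \<in> tangent_space A p"
  using tangent_space_lincomb[of v p v a 0] by simp

lemma chart_at_dom: "p \<in> points A \<Longrightarrow> p \<in> chart_dom A (chart_at A p)"
  unfolding chart_at_def points_def by (rule someI_ex) auto

lemma chart_dom_points: "p \<in> chart_dom A i \<Longrightarrow> p \<in> points A"
  unfolding points_def by auto

text \<open>The definition of \<^const>\<open>mdiff\<close> uses the chart \<^const>\<open>chart_at\<close>, which varies wildly with the
  point; differentiation in a neighbourhood needs one fixed chart.\<close>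

lemma mdiff_chart:
  assumes p: "p \<in> chart_dom A i" and v: "v \<in> tangent_space A p"
    and f: "(f \<circ> chart_inv A i has_derivative F) (at (chart_map A i p))"
  shows "mdiff A f p v = F (v i)"
proof -
  let ?j = "chart_at A p"
  have j: "p \<in> chart_dom A ?j" using p chart_at_dom chart_dom_points by blast
  show ?thesis
    using frechet_derivative_eqI[OF has_derivative_change_chart[OF j p f]] tangent_spaceD(1)[OF v j p]
    by (simp add: mdiff_def Let_def)
qed

lemma angle_diff_chart:
  assumes U: "open U" "p \<in> U" and W: "continuous_on U W" "\<And>q. q \<in> U \<Longrightarrow> W q \<noteq> 0"
    and \<beta>: "\<And>q. q \<in> U \<Longrightarrow> \<beta> q = carg (W q)"
    and p: "p \<in> chart_dom A i" and v: "v \<in> tangent_space A p"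
    and D: "((\<lambda>u. W (chart_inv A i u)) has_derivative D) (at (chart_map A i p))"
  shows "angle_diff A \<beta> p v = Im (D (v i) / W p)"
proof -
  let ?\<theta> = "SOME \<theta>. local_lift \<beta> p \<theta>"
  have "local_lift \<beta> p ?\<theta>"
    by (rule someI[where P = "local_lift \<beta> p", OF local_lift_exists[OF U W \<beta>]])
  then have "((\<lambda>u. ?\<theta> (chart_inv A i u)) has_derivative (\<lambda>v. Im (D v / W p))) (at (chart_map A i p))"
    using local_lift_has_derivative[OF U W \<beta> isCont_chart_inv[OF p] _ D] p by simp
  then show ?thesis
    unfolding angle_diff_def by (intro mdiff_chart[OF p v]) (simp add: o_def)
qed

lemma smooth_vector_field_mono:
  "smooth_vector_field A U X \<Longrightarrow> V \<subseteq> U \<Longrightarrow> smooth_vector_field A V X"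
  unfolding smooth_vector_field_def by (meson Int_mono image_mono order_refl smooth_on_mono subsetD)

lemma smooth_vector_field_coordinate:
  assumes "smooth_vector_field A U X" "U \<subseteq> chart_dom A i"
  shows "smooth_on (chart_map A i ` U) (\<lambda>u. X (chart_inv A i u) i)"
  using assms by (metis Int_absorb2 smooth_vector_field_def)

text \<open>Vector fields with constant coordinates in one chart provide an extension of each tangent vector
  to a smooth field, on which a connection can be evaluated.\<close>

lemma smooth_vector_field_tvec_of:
  assumes "open U" "U \<subseteq> chart_dom A i"
  shows "smooth_vector_field A U (\<lambda>q. tvec_of A q i u)"
  unfolding smooth_vector_field_def
proof (intro conjI allI ballI)
  show "tvec_of A p i u \<in> tangent_space A p" if "p \<in> U" for p
    using that assms by (auto intro: tvec_of_in_tangent_space)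
  fix j
  let ?S = "chart_map A j ` (U \<inter> chart_dom A j)"
  have op: "open ?S" by (rule open_chart_image[OF assms(1)])
  have "smooth_on ?S (\<lambda>y. frechet_derivative (transition A i j) (at (transition A j i y)) u)"
    by (rule smooth_on_compose[OF op smooth_on_mono[OF transition_smooth]
          smooth_on_derivative[OF transition_smooth]])
       (use assms in \<open>auto simp: transition_def\<close>)
  then show "smooth_on ?S (\<lambda>y. tvec_of A (chart_inv A j y) i u j)"
    by (rule smooth_on_cong[OF op, rotated])
       (use assms in \<open>auto simp: tvec_of_def transition_deriv_def transition_def\<close>)
qed

end

section \<open>The Levi-Civita connection of an immersed manifold\<close>

lemma affine_connection_tangent:
  assumes "affine_connection A D" "open U" "U \<subseteq> points A" "smooth_vector_field A U Y"
    "p \<in> U" "v \<in> tangent_space A p"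
  shows "D p v Y \<in> tangent_space A p"
  using assms(1)[unfolded affine_connection_def, THEN spec, THEN mp, OF assms(2), THEN mp, OF assms(3),
      THEN spec, THEN mp, OF assms(4), THEN conjunct1] assms(5,6) by blast

lemma affine_connection_lincomb:
  assumes "affine_connection A D" "open U" "U \<subseteq> points A" "smooth_vector_field A U Y"
    "p \<in> U" "v \<in> tangent_space A p" "w \<in> tangent_space A p"
  shows "D p (\<lambda>i. a *\<^sub>R v i + b *\<^sub>R w i) Y = (\<lambda>i. a *\<^sub>R D p v Y i + b *\<^sub>R D p w Y i)"
  using assms(1)[unfolded affine_connection_def, THEN spec, THEN mp, OF assms(2), THEN mp, OF assms(3),
      THEN spec, THEN mp, OF assms(4), THEN conjunct2, THEN conjunct1] assms(5-7) by blast

lemma levi_civita_torsion_free: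
  assumes "levi_civita A g D" "open U" "U \<subseteq> points A" "smooth_vector_field A U X"
    "smooth_vector_field A U Y" "p \<in> U"
  shows "(\<lambda>i. D p (X p) Y i - D p (Y p) X i) = lie_bracket A X Y p"
  using assms(1)[unfolded levi_civita_def, THEN conjunct2, THEN spec, THEN spec, THEN spec,
      THEN mp, OF assms(2), THEN mp, OF assms(3), THEN mp, OF assms(4), THEN mp, OF assms(5),
      THEN conjunct1] assms(6) by (rule bspec)

lemma levi_civita_metric:
  assumes "levi_civita A g D" "open U" "U \<subseteq> points A" "smooth_vector_field A U X"
    "smooth_vector_field A U Y" "p \<in> U" "v \<in> tangent_space A p"
  shows "mdiff A (\<lambda>q. g q (X q) (Y q)) p v = g p (D p v X) (Y p) + g p (X p) (D p v Y)"
  using assms(1)[unfolded levi_civita_def, THEN conjunct2, THEN spec, THEN spec, THEN spec,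
      THEN mp, OF assms(2), THEN mp, OF assms(3), THEN mp, OF assms(4), THEN mp, OF assms(5),
      THEN conjunct2, THEN bspec, OF assms(6)] assms(7) by (rule bspec)

locale immersed_manifold = manifold A
  for A :: "('i, 'a::{t2_space, second_countable_topology}, 'm::finite) atlas" +
  fixes f :: "'a \<Rightarrow> 'b::euclidean_space"
  assumes immersion: "immersion A f"
begin

abbreviation coord_map :: "'i \<Rightarrow> real^'m \<Rightarrow> 'b" where
  "coord_map i \<equiv> f \<circ> chart_inv A i"

abbreviation coord_deriv :: "'i \<Rightarrow> real^'m \<Rightarrow> real^'m \<Rightarrow> 'b" where
  "coord_deriv i u \<equiv> frechet_derivative (coord_map i) (at u)"

lemma coord_map_smooth: "smooth_on (chart_map A i ` chart_dom A i) (coord_map i)"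
proof -
  have "points A \<inter> chart_dom A i = chart_dom A i" by (auto simp: points_def)
  moreover have "smooth_on (chart_map A i ` (points A \<inter> chart_dom A i)) (coord_map i)"
    using immersion unfolding immersion_def smooth_map_on_def by blast
  ultimately show ?thesis by simp
qed

lemma open_coord: "open (chart_map A i ` chart_dom A i)"
  by (intro open_chart_image_subset open_chart_dom) auto

lemma coord_has_derivative:
  "p \<in> chart_dom A i \<Longrightarrow> (coord_map i has_derivative coord_deriv i (chart_map A i p)) (at (chart_map A i p))"
  by (rule smooth_on_has_derivative[OF coord_map_smooth]) auto

lemma linear_coord_deriv: "p \<in> chart_dom A i \<Longrightarrow> linear (coord_deriv i (chart_map A i p))"
  using coord_has_derivative has_derivative_linear by blast

lemma mdiff_coord:
  "p \<in> chart_dom A i \<Longrightarrow> v \<in> tangent_space A p \<Longrightarrow> mdiff A f p v = coord_deriv i (chart_map A i p) (v i)"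
  by (rule mdiff_chart[OF _ _ coord_has_derivative])

lemma coord_deriv_inj:
  assumes "p \<in> chart_dom A i" "coord_deriv i (chart_map A i p) u = coord_deriv i (chart_map A i p) u'"
  shows "u = u'"
proof -
  have "mdiff A f p (tvec_of A p i u) = mdiff A f p (tvec_of A p i u')"
    using assms by (simp add: mdiff_coord tvec_of_in_tangent_space tvec_of_same)
  then have "tvec_of A p i u = tvec_of A p i u'"
    using immersion chart_dom_points[OF assms(1)] tvec_of_in_tangent_space[OF assms(1)]
    unfolding immersion_def inj_on_def by blast
  then have "tvec_of A p i u i = tvec_of A p i u' i" by simp
  then show ?thesis using assms(1) by (simp add: tvec_of_same)
qed

lemma mdiff_lincomb:
  assumes "p \<in> points A" "v \<in> tangent_space A p" "w \<in> tangent_space A p"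
  shows "mdiff A f p (\<lambda>i. a *\<^sub>R v i + b *\<^sub>R w i) = a *\<^sub>R mdiff A f p v + b *\<^sub>R mdiff A f p w"
proof -
  obtain i where i: "p \<in> chart_dom A i" using assms by (auto simp: points_def)
  show ?thesis
    using mdiff_coord[OF i] assms tangent_space_lincomb[OF assms(2,3)] linear_coord_deriv[OF i]
    by (simp add: linear_add linear_cmul)
qed

lemma mdiff_scale:
  "x \<in> points A \<Longrightarrow> v \<in> tangent_space A x \<Longrightarrow> mdiff A f x (\<lambda>i. a *\<^sub>R v i) = a *\<^sub>R mdiff A f x v"
  using mdiff_lincomb[of x v v a 0] by simp

text \<open>The induced metric is non-degenerate.\<close>

lemma tangent_eqI_inner:
  assumes p: "p \<in> points A" and v: "v \<in> tangent_space A p" and w: "w \<in> tangent_space A p"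
    and eq: "\<And>z. z \<in> tangent_space A p \<Longrightarrow>
      mdiff A f p v \<bullet> mdiff A f p z = mdiff A f p w \<bullet> mdiff A f p z"
  shows "v = w"
proof -
  let ?z = "\<lambda>i. 1 *\<^sub>R v i + (-1) *\<^sub>R w i"
  have z: "?z \<in> tangent_space A p" by (rule tangent_space_lincomb[OF v w])
  have dz: "mdiff A f p ?z = mdiff A f p v - mdiff A f p w"
    using mdiff_lincomb[OF p v w, of 1 "-1"] by simp
  have "(mdiff A f p v - mdiff A f p w) \<bullet> (mdiff A f p v - mdiff A f p w) = 0"
    using eq[OF z] unfolding dz by (simp add: inner_diff_left)
  then have "mdiff A f p v = mdiff A f p w" by simp
  then show ?thesis
    using immersion p v w unfolding immersion_def inj_on_def by blast
qed

lemma mdiff_field_coord: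
  assumes U: "open U" "U \<subseteq> chart_dom A i" and Y: "smooth_vector_field A U Y"
    and u: "u \<in> chart_map A i ` U"
  shows "mdiff A f (chart_inv A i u) (Y (chart_inv A i u)) = coord_deriv i u (Y (chart_inv A i u) i)"
proof -
  obtain q where q: "q \<in> U" "u = chart_map A i q" using u by auto
  then have "q \<in> chart_dom A i" "Y q \<in> tangent_space A q"
    using U Y by (auto simp: smooth_vector_field_def)
  then show ?thesis using q mdiff_coord by simp
qed

text \<open>The first summand is symmetric in \<open>v\<close> and \<open>Y p\<close>, so it cancels when two fields are exchanged and the
  results subtracted; the second summands then combine to \<open>df\<close> of the Lie bracket.\<close>

lemma field_has_derivative:
  assumes U: "open U" "U \<subseteq> chart_dom A i" and Y: "smooth_vector_field A U Y" and p: "p \<in> U"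
  defines "y \<equiv> \<lambda>u. Y (chart_inv A i u) i"
  shows "((\<lambda>q. mdiff A f q (Y q)) \<circ> chart_inv A i has_derivative
      (\<lambda>v. frechet_derivative (\<lambda>z. coord_deriv i z (Y p i)) (at (chart_map A i p)) v +
           coord_deriv i (chart_map A i p) (frechet_derivative y (at (chart_map A i p)) v)))
      (at (chart_map A i p))"
proof -
  let ?S = "chart_map A i ` U"
  have op: "open ?S" by (rule open_chart_image_subset[OF U])
  have f: "smooth_on ?S (coord_map i)" using U by (intro smooth_on_mono[OF coord_map_smooth]) auto
  have y: "smooth_on ?S y" unfolding y_def by (rule smooth_vector_field_coordinate[OF Y U(2)])
  have yp: "y (chart_map A i p) = Y p i" using p U by (auto simp: y_def)
  show ?thesis
  proof (rule has_derivative_transform_within_open[OF _ op])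
    show "((\<lambda>z. coord_deriv i z (y z)) has_derivative
        (\<lambda>v. frechet_derivative (\<lambda>z. coord_deriv i z (Y p i)) (at (chart_map A i p)) v +
           coord_deriv i (chart_map A i p) (frechet_derivative y (at (chart_map A i p)) v)))
        (at (chart_map A i p))"
      using has_derivative_along_field[OF op f y, of "chart_map A i p"] p unfolding yp by auto
  qed (use p mdiff_field_coord[OF U Y] in \<open>auto simp: y_def\<close>)
qed

lemma mdiff_field:
  assumes U: "open U" "U \<subseteq> chart_dom A i" and Y: "smooth_vector_field A U Y" and p: "p \<in> U"
    and v: "v \<in> tangent_space A p"
  defines "y \<equiv> \<lambda>u. Y (chart_inv A i u) i"
  shows "mdiff A (\<lambda>q. mdiff A f q (Y q)) p v =
           frechet_derivative (\<lambda>z. coord_deriv i z (Y p i)) (at (chart_map A i p)) (v i) +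
           coord_deriv i (chart_map A i p) (frechet_derivative y (at (chart_map A i p)) (v i))"
  unfolding y_def
  by (rule mdiff_chart[OF _ v field_has_derivative[OF U Y p]]) (use U p in auto)

lemma mdiff_inner_fields:
  assumes U: "open U" "U \<subseteq> chart_dom A i" and p: "p \<in> U" and v: "v \<in> tangent_space A p"
    and X: "smooth_vector_field A U X" and Y: "smooth_vector_field A U Y"
  shows "mdiff A (\<lambda>q. mdiff A f q (X q) \<bullet> mdiff A f q (Y q)) p v =
     mdiff A (\<lambda>q. mdiff A f q (X q)) p v \<bullet> mdiff A f p (Y p) +
     mdiff A f p (X p) \<bullet> mdiff A (\<lambda>q. mdiff A f q (Y q)) p v"
proof -
  have i: "p \<in> chart_dom A i" using U p by auto
  note dX = field_has_derivative[OF U X p] and dY = field_has_derivative[OF U Y p]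
  show ?thesis
    unfolding mdiff_chart[OF i v dX] mdiff_chart[OF i v dY]
    by (rule trans[OF mdiff_chart[OF i v]])
       (use has_derivative_inner[OF dX dY] i in \<open>auto simp: o_def algebra_simps\<close>)
qed

text \<open>For fields \<open>X\<close>, \<open>Y\<close> let \<open>T(X, Y)\<close> be \<open>df(D\<^sub>X Y)\<close> minus the ambient derivative of \<open>df(Y)\<close> in
  direction \<open>X\<close>. It is symmetric: \<open>D\<close> is torsion free, and the derivative of \<open>df(Y)\<close> along \<open>X\<close> minus
  the one of \<open>df(X)\<close> along \<open>Y\<close> is \<open>df([X, Y])\<close> because second derivatives are symmetric. Since \<open>D\<close>
  and the ambient derivative both satisfy the product rule for the metric, \<open>\<langle>T(X, Y), df(Z)\<rangle>\<close> is
  skew in \<open>Y\<close>, \<open>Z\<close>. A trilinear expression that is symmetric in the first two and skew in the last two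
  arguments vanishes. This is the uniqueness of the Levi-Civita connection, in a form in which the
  connection never has to be computed from Christoffel symbols.\<close>

theorem levi_civita_induced:
  assumes D: "levi_civita A (induced_metric A f) D"
    and U: "open U" "U \<subseteq> points A" and Y: "smooth_vector_field A U Y" and p: "p \<in> U"
    and v: "v \<in> tangent_space A p" and w: "w \<in> tangent_space A p"
  shows "mdiff A f p (D p v Y) \<bullet> mdiff A f p w = mdiff A (\<lambda>q. mdiff A f q (Y q)) p v \<bullet> mdiff A f p w"
proof -
  obtain i where i: "p \<in> chart_dom A i" using U p by (auto simp: points_def)
  define V where "V = U \<inter> chart_dom A i"
  have V: "open V" "V \<subseteq> chart_dom A i" "V \<subseteq> points A" "p \<in> V"
    using U p i open_chart_dom by (auto simp: V_def)
  let ?F = "\<lambda>X. smooth_vector_field A V X" and ?d = "\<lambda>X q. mdiff A f q (X q)"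
  define T where "T X Y = mdiff A f p (D p (X p) Y) - mdiff A (?d Y) p (X p)" for X Y
  have conn: "affine_connection A D" using D by (simp add: levi_civita_def)
  have tan: "X p \<in> tangent_space A p" if "?F X" for X
    using that V by (auto simp: smooth_vector_field_def)
  have Dtan: "D p v X \<in> tangent_space A p" if "?F X" "v \<in> tangent_space A p" for X v
    by (rule affine_connection_tangent[OF conn V(1,3) that(1) V(4) that(2)])
  have sym: "T X Y = T Y X" if X: "?F X" and Y: "?F Y" for X Y
  proof -
    have torsion: "(\<lambda>i. D p (X p) Y i - D p (Y p) X i) = lie_bracket A X Y p"
      by (rule levi_civita_torsion_free[OF D V(1,3) X Y V(4)])
    have br: "D p (X p) Y i - D p (Y p) X i =
        frechet_derivative (\<lambda>u. Y (chart_inv A i u) i) (at (chart_map A i p)) (X p i) -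
        frechet_derivative (\<lambda>u. X (chart_inv A i u) i) (at (chart_map A i p)) (Y p i)"
      using fun_cong[OF torsion, of i] i by (simp add: lie_bracket_def)
    have "mdiff A f p (D p (X p) Y) - mdiff A f p (D p (Y p) X) =
        coord_deriv i (chart_map A i p) (D p (X p) Y i - D p (Y p) X i)"
      by (simp add: mdiff_coord[OF i] Dtan tan X Y linear_diff[OF linear_coord_deriv[OF i]])
    also have "\<dots> = mdiff A (?d Y) p (X p) - mdiff A (?d X) p (Y p)"
      unfolding br mdiff_field[OF V(1,2) X V(4) tan[OF Y]] mdiff_field[OF V(1,2) Y V(4) tan[OF X]]
        linear_diff[OF linear_coord_deriv[OF i]]
        second_derivative_symmetric[OF open_coord coord_map_smooth imageI[OF i], of "X p i" "Y p i"]
      by simp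
    finally show ?thesis by (simp add: T_def algebra_simps)
  qed
  have skew: "T X Y \<bullet> ?d Z p + ?d Y p \<bullet> T X Z = 0" if X: "?F X" and Y: "?F Y" and Z: "?F Z" for X Y Z
  proof -
    have "mdiff A (\<lambda>q. induced_metric A f q (Y q) (Z q)) p (X p) =
        induced_metric A f p (D p (X p) Y) (Z p) + induced_metric A f p (Y p) (D p (X p) Z)"
      by (rule levi_civita_metric[OF D V(1,3) Y Z V(4) tan[OF X]])
    then show ?thesis
      using mdiff_inner_fields[OF V(1,2,4) tan[OF X] Y Z]
      by (simp add: induced_metric_def T_def inner_diff_left inner_diff_right)
  qed
  have zero: "T X Y \<bullet> ?d Z p = 0" if X: "?F X" and Y: "?F Y" and Z: "?F Z" for X Y Z
    using skew[OF X Y Z] skew[OF Y Z X] skew[OF Z X Y]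
    unfolding sym[OF Z X] sym[OF Z Y] sym[OF Y X]
      inner_commute[of "?d Y p" "T X Z"] inner_commute[of "?d X p" "T Y Z"]
      inner_commute[of "?d Z p" "T X Y"] by linarith
  have FY: "?F Y" using smooth_vector_field_mono[OF Y] by (simp add: V_def)
  have "T (\<lambda>q. tvec_of A q i (v i)) Y \<bullet> ?d (\<lambda>q. tvec_of A q i (w i)) p = 0"
    by (intro zero FY smooth_vector_field_tvec_of V)
  then show ?thesis
    by (simp add: T_def tvec_of_coordinate v w i inner_diff_left)
qed

end

section \<open>Gradients of angle-valued maps\<close>

text \<open>Smoothness of an angle is expressed through a complex function \<open>W\<close> with argument \<open>\<beta>\<close>; unlike a
  real lift, it exists on the whole of a chart, whatever the topology of the chart domain.\<close>

definition smooth_angle_map :: "('i, 'a, 'm::finite) atlas \<Rightarrow> ('a \<Rightarrow> angle) \<Rightarrow> bool" where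
  "smooth_angle_map A \<beta> \<longleftrightarrow> (\<forall>i. \<exists>W. smooth_on (chart_map A i ` chart_dom A i) W \<and>
     (\<forall>p\<in>chart_dom A i. W (chart_map A i p) \<noteq> 0 \<and> \<beta> p = carg (W (chart_map A i p))))"

lemma linear_axis_expand:
  fixes L :: "real^'n::finite \<Rightarrow> 'c::real_vector"
  assumes "linear L" shows "L x = (\<Sum>k\<in>UNIV. (x $ k) *\<^sub>R L (axis k 1))"
proof -
  have "L x = L (\<Sum>k\<in>UNIV. (x $ k) *\<^sub>R axis k 1)"
    using basis_expansion[of x] by (simp add: scalar_mult_eq_scaleR)
  then show ?thesis using assms by (simp add: linear_sum linear_cmul)
qed

context manifold
begin

lemma angle_diff_coord:
  assumes W: "smooth_on (chart_map A i ` chart_dom A i) W"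
    and \<beta>: "\<And>q. q \<in> chart_dom A i \<Longrightarrow> W (chart_map A i q) \<noteq> 0 \<and> \<beta> q = carg (W (chart_map A i q))"
    and p: "p \<in> chart_dom A i" and v: "v \<in> tangent_space A p"
  shows "angle_diff A \<beta> p v =
    Im (frechet_derivative W (at (chart_map A i p)) (v i) / W (chart_map A i p))"
proof (rule angle_diff_chart[where U = "chart_dom A i" and W = "\<lambda>q. W (chart_map A i q)"])
  have "continuous_on (chart_dom A i) (chart_map A i)"
    using chart_homeomorphism homeomorphism_def by metis
  then show "continuous_on (chart_dom A i) (\<lambda>q. W (chart_map A i q))"
    using continuous_on_compose2[OF smooth_on_continuous_on[OF W]] by auto
  show "((\<lambda>u. W (chart_map A i (chart_inv A i u))) has_derivative
      frechet_derivative W (at (chart_map A i p))) (at (chart_map A i p))"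
    by (rule has_derivative_transform_within_open[OF smooth_on_has_derivative[OF W], of _ "chart_map A i ` chart_dom A i"])
       (use p open_chart_image_subset[OF open_chart_dom] in auto)
qed (use p v \<beta> open_chart_dom in auto)

end

context immersed_manifold
begin

definition gram :: "'i \<Rightarrow> real^'m \<Rightarrow> real^'m^'m" where
  "gram i u = (\<chi> k l. coord_deriv i u (axis k 1) \<bullet> coord_deriv i u (axis l 1))"

lemma gram_mult:
  assumes "p \<in> chart_dom A i"
  shows "(gram i (chart_map A i p) *v x) $ k =
    coord_deriv i (chart_map A i p) x \<bullet> coord_deriv i (chart_map A i p) (axis k 1)"
  by (subst inner_commute, subst linear_axis_expand[OF linear_coord_deriv[OF assms], of x])
     (simp add: gram_def matrix_vector_mult_def inner_sum_right mult.commute)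

text \<open>If the Gram matrix of the coordinate fields kills \<open>x\<close>, then the differential maps \<open>x\<close> to a vector
  of length zero, and the differential is injective.\<close>

lemma gram_det_nonzero:
  assumes "p \<in> chart_dom A i" shows "det (gram i (chart_map A i p)) \<noteq> 0"
proof -
  let ?D = "coord_deriv i (chart_map A i p)"
  have "x = 0" if "gram i (chart_map A i p) *v x = 0" for x
  proof -
    have "?D x \<bullet> ?D x = (\<Sum>k\<in>UNIV. x $ k * (?D x \<bullet> ?D (axis k 1)))"
      by (subst (2) linear_axis_expand[OF linear_coord_deriv[OF assms], of x])
         (simp add: inner_sum_right)
    also have "\<dots> = 0" using that gram_mult[OF assms, of x] by simp
    finally have "?D x = ?D 0" using linear_0[OF linear_coord_deriv[OF assms]] by simp
    then show "x = 0" by (rule coord_deriv_inj[OF assms])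
  qed
  then show ?thesis
    unfolding invertible_det_nz[symmetric] invertible_left_inverse matrix_left_invertible_ker by blast
qed

text \<open>Coordinates of the tangent vector whose inner products with the coordinate fields are the entries
  of \<open>b\<close>. Cramer's rule gives them as a rational function of \<open>b\<close> and the Gram matrix, from which they
  are visibly smooth.\<close>

definition cramer_solution :: "'i \<Rightarrow> real^'m \<Rightarrow> real^'m \<Rightarrow> real^'m" where
  "cramer_solution i u b =
     (\<chi> k. det (\<chi> r c. if c = k then b $ r else gram i u $ r $ c) / det (gram i u))"

lemma cramer_solution_inner:
  assumes "p \<in> chart_dom A i"
  shows "coord_deriv i (chart_map A i p) (cramer_solution i (chart_map A i p) b) \<bullet>
           coord_deriv i (chart_map A i p) x = b \<bullet> x"
proof -
  let ?D = "coord_deriv i (chart_map A i p)" and ?c = "cramer_solution i (chart_map A i p) b"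
  have "gram i (chart_map A i p) *v ?c = b"
    using cramer[OF gram_det_nonzero[OF assms]] by (simp add: cramer_solution_def)
  then have "?D ?c \<bullet> ?D (axis k 1) = b $ k" for k
    using gram_mult[OF assms] by metis
  then show ?thesis
    by (subst linear_axis_expand[OF linear_coord_deriv[OF assms], of x])
       (simp add: inner_sum_right inner_vec_def mult.commute)
qed

lemma cramer_solution_smooth:
  assumes b: "smooth_on (chart_map A i ` chart_dom A i) b"
  shows "smooth_on (chart_map A i ` chart_dom A i) (\<lambda>u. cramer_solution i u (b u))"
proof -
  have gram: "smooth_on (chart_map A i ` chart_dom A i) (\<lambda>u. gram i u $ r $ c)" for r c
    by (auto simp: gram_def intro!: smooth_on_inner open_coord smooth_on_derivative coord_map_smooth)
  have "smooth_on (chart_map A i ` chart_dom A i)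
      (\<lambda>u. (\<chi> r c. if c = k then b u $ r else gram i u $ r $ c) $ r $ c)" for k r c
    by (cases "c = k") (auto intro: gram smooth_on_vec_nth[OF open_coord b])
  then show ?thesis
    unfolding cramer_solution_def
    by (intro smooth_on_vec_lambda smooth_on_divide smooth_on_det open_coord gram)
       (auto simp: gram_det_nonzero)
qed

lemma angle_grad_eqI:
  assumes "p \<in> points A" "v \<in> tangent_space A p"
    and "\<And>w. w \<in> tangent_space A p \<Longrightarrow> mdiff A f p v \<bullet> mdiff A f p w = angle_diff A \<beta> p w"
  shows "angle_grad A (induced_metric A f) \<beta> p = v"
  unfolding angle_grad_def induced_metric_def
  by (rule the_equality) (use assms in \<open>auto intro: tangent_eqI_inner\<close>)

lemma gradient_in_chart:
  assumes W: "smooth_on (chart_map A i ` chart_dom A i) W"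
    and \<beta>: "\<And>q. q \<in> chart_dom A i \<Longrightarrow> W (chart_map A i q) \<noteq> 0 \<and> \<beta> q = carg (W (chart_map A i q))"
    and p: "p \<in> chart_dom A i" and w: "w \<in> tangent_space A p"
  defines "u \<equiv> chart_map A i p"
  shows "mdiff A f p (tvec_of A p i (cramer_solution i u
        (\<chi> k. Im (frechet_derivative W (at u) (axis k 1) / W u)))) \<bullet> mdiff A f p w = angle_diff A \<beta> p w"
proof -
  have "linear (frechet_derivative W (at u))"
    using smooth_on_has_derivative[OF W, of u] p has_derivative_linear unfolding u_def by blast
  then have lin: "linear (\<lambda>x. Im (frechet_derivative W (at u) x / W u))"
    using linear_compose[OF _ bounded_linear.linear[OF bounded_linear_compose[OF bounded_linear_Im
          bounded_linear_divide[of "W u"]]]] by (simp add: o_def)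
  show ?thesis
    using linear_axis_expand[OF lin, of "w i"] unfolding u_def
    by (simp add: mdiff_coord[OF p] w tvec_of_in_tangent_space p tvec_of_same cramer_solution_inner[OF p]
        angle_diff_coord[OF W \<beta> p w] inner_vec_def mult.commute)
qed

lemma angle_grad_coord:
  assumes W: "smooth_on (chart_map A i ` chart_dom A i) W"
    and \<beta>: "\<And>q. q \<in> chart_dom A i \<Longrightarrow> W (chart_map A i q) \<noteq> 0 \<and> \<beta> q = carg (W (chart_map A i q))"
    and p: "p \<in> chart_dom A i"
  shows "angle_grad A (induced_metric A f) \<beta> p =
      tvec_of A p i (cramer_solution i (chart_map A i p)
        (\<chi> k. Im (frechet_derivative W (at (chart_map A i p)) (axis k 1) / W (chart_map A i p))))"
  by (rule angle_grad_eqI[OF chart_dom_points[OF p] tvec_of_in_tangent_space[OF p]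
        gradient_in_chart[OF W \<beta> p]])

lemma angle_grad_tangent:
  assumes "smooth_angle_map A \<beta>" "p \<in> points A"
  shows "angle_grad A (induced_metric A f) \<beta> p \<in> tangent_space A p"
proof -
  obtain i where i: "p \<in> chart_dom A i" using assms(2) by (auto simp: points_def)
  then show ?thesis
    using assms(1) angle_grad_coord[OF _ _ i] tvec_of_in_tangent_space[OF i]
    unfolding smooth_angle_map_def by metis
qed

lemma angle_grad_inner:
  assumes "smooth_angle_map A \<beta>" "p \<in> points A" and w: "w \<in> tangent_space A p"
  shows "mdiff A f p (angle_grad A (induced_metric A f) \<beta> p) \<bullet> mdiff A f p w = angle_diff A \<beta> p w"
proof -
  obtain i where i: "p \<in> chart_dom A i" using assms(2) by (auto simp: points_def)
  obtain W where W: "smooth_on (chart_map A i ` chart_dom A i) W"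
    and \<beta>: "\<And>q. q \<in> chart_dom A i \<Longrightarrow> W (chart_map A i q) \<noteq> 0 \<and> \<beta> q = carg (W (chart_map A i q))"
    using assms(1) unfolding smooth_angle_map_def by blast
  show ?thesis
    using gradient_in_chart[OF W \<beta> i w] angle_grad_coord[OF W \<beta> i] by simp
qed

lemma angle_grad_smooth:
  assumes "smooth_angle_map A \<beta>"
  shows "smooth_vector_field A (points A) (angle_grad A (induced_metric A f) \<beta>)"
  unfolding smooth_vector_field_def
proof (intro conjI ballI allI)
  show "angle_grad A (induced_metric A f) \<beta> p \<in> tangent_space A p" if "p \<in> points A" for p
    by (rule angle_grad_tangent[OF assms that])
  fix i
  let ?S = "chart_map A i ` chart_dom A i"
  obtain W where W: "smooth_on ?S W"
    and \<beta>: "\<And>q. q \<in> chart_dom A i \<Longrightarrow> W (chart_map A i q) \<noteq> 0 \<and> \<beta> q = carg (W (chart_map A i q))"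
    using assms(1) unfolding smooth_angle_map_def by blast
  have b: "smooth_on ?S (\<lambda>u. \<chi> k. Im (frechet_derivative W (at u) (axis k 1) / W u))"
    by (intro smooth_on_vec_lambda smooth_on_bounded_linear[OF _ bounded_linear_Im] smooth_on_divide
        open_coord smooth_on_derivative W) (use \<beta> in auto)
  have "smooth_on ?S (\<lambda>u. angle_grad A (induced_metric A f) \<beta> (chart_inv A i u) i)"
    by (rule smooth_on_cong[OF open_coord _ cramer_solution_smooth[OF b]])
       (use angle_grad_coord[OF W \<beta>] in \<open>auto simp: tvec_of_same\<close>)
  moreover have "points A \<inter> chart_dom A i = chart_dom A i" by (auto simp: points_def)
  ultimately show "smooth_on (chart_map A i ` (points A \<inter> chart_dom A i))
      (\<lambda>u. angle_grad A (induced_metric A f) \<beta> (chart_inv A i u) i)" by simp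
qed

end

section \<open>The product manifold\<close>

lemma smooth_on_vec_tail: "open S \<Longrightarrow> smooth_on S vec_tail"
  by (rule smooth_on_linear[OF _ bounded_linear_vec_tail])

lemma smooth_on_vec_cons:
  fixes g :: "'a::real_normed_vector \<Rightarrow> real^'m::finite"
  assumes "open S" "smooth_on S f" "smooth_on S g"
  shows "smooth_on S (\<lambda>x. vec_cons (f x) (g x))"
  unfolding vec_cons_def
proof (rule smooth_on_vec_lambda[OF assms(1)])
  show "smooth_on S (\<lambda>x. case k of None \<Rightarrow> f x | Some j \<Rightarrow> g x $ j)" for k
    using assms by (cases k) (auto intro: smooth_on_vec_nth)
qed

lemma vec_tail_axis:
  "vec_tail (axis None 1) = (0 :: real^'m::finite)" "vec_tail (axis (Some k) 1) = (axis k 1 :: real^'m)"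
  by (auto simp: vec_tail_def vec_eq_iff axis_def)

lemma axis_option_None:
  "(axis None 1 :: real^('m::finite option)) $ None = 1" "(axis (Some k) 1 :: real^('m option)) $ None = 0"
  by (simp_all add: axis_def)

locale product_manifold = manifold A
  for A :: "('i, 'a::{t2_space, second_countable_topology}, 'm::finite) atlas" +
  fixes I :: "real set"
  assumes open_I: "open I"
begin

abbreviation "P \<equiv> prod_atlas I A"

lemma prod_dom: "chart_dom P i = I \<times> chart_dom A i"
  by (simp add: prod_atlas_def)

lemma prod_map: "chart_map P i (s, p) = vec_cons s (chart_map A i p)"
  by (simp add: prod_atlas_def)

lemma prod_points: "points P = I \<times> points A"
  by (auto simp: points_def prod_dom)

lemma prod_image: "chart_map P i ` (I \<times> V) = {w. w $ None \<in> I \<and> vec_tail w \<in> chart_map A i ` V}"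
proof (intro equalityI subsetI)
  fix w assume "w \<in> {w. w $ None \<in> I \<and> vec_tail w \<in> chart_map A i ` V}"
  then obtain p where "w $ None \<in> I" "p \<in> V" "vec_tail w = chart_map A i p" by auto
  then have "w = chart_map P i (w $ None, p)" "(w $ None, p) \<in> I \<times> V"
    by (simp_all add: prod_map flip: \<open>vec_tail w = _\<close>)
  then show "w \<in> chart_map P i ` (I \<times> V)" by blast
qed (auto simp: prod_map)

lemma prod_image_dom:
  "w \<in> chart_map P i ` chart_dom P i \<longleftrightarrow> w $ None \<in> I \<and> vec_tail w \<in> chart_map A i ` chart_dom A i"
  by (simp add: prod_dom prod_image)

lemma prod_chart_inv:
  assumes "w $ None \<in> I" "vec_tail w \<in> chart_map A i ` chart_dom A i"
  shows "chart_inv P i w = (w $ None, chart_inv A i (vec_tail w))"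
proof -
  obtain p where p: "p \<in> chart_dom A i" "vec_tail w = chart_map A i p" using assms by auto
  have "inj_on (chart_map A i) (chart_dom A i)"
    by (rule inj_on_inverseI[of _ "chart_inv A i"]) simp
  then have inj: "inj_on (chart_map P i) (chart_dom P i)"
    by (auto simp: inj_on_def prod_map prod_dom)
  have "chart_map P i (w $ None, p) = w"
    by (simp add: prod_map flip: p(2))
  then show ?thesis
    unfolding chart_inv_def[of P]
    using inv_into_f_f[OF inj, of "(w $ None, p)"] p assms by (simp add: prod_dom)
qed

lemma open_prod_image:
  assumes "open (chart_map A i ` V)"
  shows "open (chart_map P i ` (I \<times> V))"
proof -
  have "chart_map P i ` (I \<times> V) = (\<lambda>w. w $ None) -` I \<inter> vec_tail -` (chart_map A i ` V)"
    unfolding prod_image by auto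
  moreover have "open ((\<lambda>w::real^('m option). w $ None) -` I)"
    using open_I by (intro open_vimage continuous_intros)
  moreover have "open (vec_tail -` (chart_map A i ` V))"
    using assms by (intro open_vimage linear_continuous_on bounded_linear_vec_tail)
  ultimately show ?thesis by auto
qed

lemma prod_smooth_manifold: "smooth_manifold P"
  unfolding smooth_manifold_def
proof (intro conjI allI)
  fix i j
  show op: "open (chart_dom P i)" for i
    unfolding prod_dom by (intro open_Times open_I open_chart_dom)
  show opm: "open (chart_map P i ` chart_dom P i)"
    unfolding prod_dom by (intro open_prod_image open_chart_image_subset open_chart_dom) auto
  have cA: "continuous_on (chart_dom A i) (chart_map A i)"
    "continuous_on (chart_map A i ` chart_dom A i) (chart_inv A i)"
    using chart_homeomorphism[of i] by (auto simp: homeomorphism_def)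
  have c1: "continuous_on (chart_dom P i) (\<lambda>q. case_prod vec_cons (fst q, chart_map A i (snd q)))"
    unfolding prod_dom
    by (intro bounded_linear.continuous_on[OF bounded_linear_vec_cons] continuous_intros
        continuous_on_compose2[OF cA(1)]) auto
  have c2: "continuous_on (chart_map P i ` chart_dom P i) (\<lambda>w. (w $ None, chart_inv A i (vec_tail w)))"
    unfolding prod_dom prod_image
    by (intro continuous_intros continuous_on_compose2[OF cA(2)]
        bounded_linear.continuous_on[OF bounded_linear_vec_tail]) auto
  show "homeomorphism (chart_dom P i) (chart_map P i ` chart_dom P i) (chart_map P i) (chart_inv P i)"
  proof (rule homeomorphismI)
    show "continuous_on (chart_dom P i) (chart_map P i)"
      by (rule continuous_on_eq[OF c1]) (auto simp: prod_map)
    show "continuous_on (chart_map P i ` chart_dom P i) (chart_inv P i)"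
      by (rule continuous_on_eq[OF c2]) (simp add: prod_image_dom prod_chart_inv)
    show inv: "chart_inv P i (chart_map P i q) = q" if "q \<in> chart_dom P i" for q
      using that by (cases q) (auto simp: prod_map prod_dom prod_chart_inv)
    show "chart_inv P i ` chart_map P i ` chart_dom P i \<subseteq> chart_dom P i"
      using inv by auto
    show "chart_map P i (chart_inv P i w) = w" if "w \<in> chart_map P i ` chart_dom P i" for w
      using that inv by auto
  qed auto
  let ?S = "chart_map P i ` (chart_dom P i \<inter> chart_dom P j)"
  have dom: "chart_dom P i \<inter> chart_dom P j = I \<times> (chart_dom A i \<inter> chart_dom A j)"
    by (auto simp: prod_dom)
  have opS: "open ?S"
    unfolding dom using open_chart_image[OF open_chart_dom[of j], of i]
    by (intro open_prod_image) (simp add: Int_commute)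
  have "smooth_on ?S (\<lambda>w. vec_cons (w $ None) (transition A i j (vec_tail w)))"
    by (intro smooth_on_vec_cons smooth_on_vec_nth smooth_on_ident opS
        smooth_on_compose[OF opS smooth_on_vec_tail transition_smooth]) (auto simp: dom prod_image)
  then show "smooth_on ?S (transition P i j)"
    by (rule smooth_on_cong[OF opS, rotated])
       (auto simp: dom prod_image transition_def prod_chart_inv prod_map)
qed

sublocale prod: manifold P
  by unfold_locales (rule prod_smooth_manifold)

text \<open>The derivative of a transition map of the product is the one of the manifold, extended by \<open>1\<close> in
  the direction of the interval, so both have the same determinant.\<close>

lemma prod_oriented:
  assumes "oriented_atlas A" shows "oriented_atlas P"
  unfolding oriented_atlas_def
proof (intro allI ballI)
  fix i j q assume "q \<in> chart_dom P i \<inter> chart_dom P j"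
  then obtain s p where q: "q = (s, p)" "s \<in> I" "p \<in> chart_dom A i" "p \<in> chart_dom A j"
    by (cases q) (auto simp: prod_dom)
  let ?T = "transition_deriv P (s, p) i j" and ?t = "transition_deriv A p i j"
  have T: "?T w = vec_cons (w $ None) (?t (vec_tail w))" for w
    by (rule transition_deriv_prod[OF smooth_manifold open_I q(2-4)])
  have "det (matrix ?T) = 1 * det (\<chi> k l. matrix ?T $ Some k $ Some l)"
    by (subst det_block_option)
       (simp_all add: matrix_def T vec_tail_axis linear_0[OF linear_transition_deriv[OF q(3,4)]])
  also have "(\<chi> k l. matrix ?T $ Some k $ Some l) = matrix ?t"
    by (simp add: matrix_def T vec_tail_axis vec_eq_iff)
  finally show "0 < det (matrix (transition_deriv P q i j))"
    using assms q by (auto simp: oriented_atlas_def)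
qed

lemma tpair_coordinate: "x \<in> chart_dom A i \<Longrightarrow> tpair A x a v i = vec_cons a (v i)"
  by (simp add: tpair_def)

lemma tpair_tangent:
  "s \<in> I \<Longrightarrow> x \<in> points A \<Longrightarrow> v \<in> tangent_space A x \<Longrightarrow> tpair A x a v \<in> tangent_space P (s, x)"
  using tangent_space_prod[OF smooth_manifold open_I] by blast

lemma tangent_space_prodE:
  assumes "w \<in> tangent_space P (s, x)" "s \<in> I" "x \<in> points A"
  obtains a v where "v \<in> tangent_space A x" "w = tpair A x a v"
  using assms tangent_space_prod[OF smooth_manifold open_I assms(2,3)] by blast

end

section \<open>Legendrian immersions and their angle\<close>

lemma hermitian_add_left: "hermitian (x + y) z = hermitian x z + hermitian y z"
  by (simp add: hermitian_def algebra_simps sum.distrib)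

lemma hermitian_add_right: "hermitian x (y + z) = hermitian x y + hermitian x z"
  by (simp add: hermitian_def algebra_simps sum.distrib)

lemma hermitian_scale_left: "hermitian (c *s x) y = c * hermitian x y"
  by (simp add: hermitian_def algebra_simps sum_distrib_left)

lemma hermitian_scale_right: "hermitian x (c *s y) = cnj c * hermitian x y"
  by (simp add: hermitian_def algebra_simps sum_distrib_left)

lemma hermitian_commute: "hermitian y x = cnj (hermitian x y)"
  by (simp add: hermitian_def mult.commute)

lemma hermitian_self: "hermitian x x = of_real ((norm x)\<^sup>2)"
  using hermitian_commute[of x x]
  by (simp add: complex_eq_iff power2_norm_eq_inner inner_eq_Re_hermitian)

lemma Im_hermitian: "Im (hermitian x y) = inner x (\<i> *s y)"
  by (simp add: inner_eq_Re_hermitian hermitian_scale_right)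

lemma has_derivative_hermitian:
  assumes "(f has_derivative f') (at x)" "(g has_derivative g') (at x)"
  shows "((\<lambda>x. hermitian (f x) (g x)) has_derivative
    (\<lambda>v. hermitian (f x) (g' v) + hermitian (f' v) (g x))) (at x)"
  unfolding hermitian_def sum.distrib[symmetric]
  by (intro has_derivative_sum has_derivative_mult bounded_linear.has_derivative[OF bounded_linear_cnj]
      bounded_linear.has_derivative[OF bounded_linear_vec_nth] assms)

lemma sum_UNIV_option: "(\<Sum>c\<in>UNIV. h c) = h None + (\<Sum>k\<in>UNIV. h (Some (k::'m::finite)))"
  by (simp add: UNIV_option_conv sum.reindex)

lemma prod_UNIV_option: "(\<Prod>c\<in>UNIV. h c) = h None * (\<Prod>k\<in>UNIV. h (Some (k::'m::finite)))"
  by (simp add: UNIV_option_conv prod.reindex)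

text \<open>A matrix with orthonormal columns satisfies \<open>N\<^sup>* N = 1\<close>, and the determinant of the left-hand side is
  \<open>|det N|\<^sup>2\<close>.\<close>

lemma norm_det_unitary:
  fixes N :: "complex^'n::finite^'n"
  assumes "\<And>c d. hermitian (column c N) (column d N) = (if c = d then 1 else 0)"
  shows "norm (det N) = 1"
proof -
  have "transpose (\<chi> i j. cnj (N $ i $ j)) ** N = mat 1"
    unfolding vec_eq_iff
  proof (intro allI)
    fix c d
    have "(transpose (\<chi> i j. cnj (N $ i $ j)) ** N) $ c $ d = hermitian (column d N) (column c N)"
      by (simp add: matrix_matrix_mult_def transpose_def hermitian_def column_def mult.commute)
    then show "(transpose (\<chi> i j. cnj (N $ i $ j)) ** N) $ c $ d = (mat 1 :: complex^'n^'n) $ c $ d"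
      by (simp add: assms mat_def)
  qed
  then have "cnj (det N) * det N = 1"
    by (metis det_I det_cnj det_mul det_transpose)
  then have "(norm (det N))\<^sup>2 = 1"
    by (metis complex_norm_square mult.commute of_real_1 of_real_eq_iff)
  then show ?thesis using norm_ge_zero[of "det N"] unfolding power2_eq_1_iff by linarith
qed

context manifold
begin

text \<open>In an oriented atlas, positivity of a frame can be checked in a single chart.\<close>

lemma oriented_frame_tvec_of:
  assumes "oriented_atlas A" and p: "p \<in> chart_dom A i" and e: "0 < det (\<chi> r k. e k $ r)"
  shows "oriented_frame A p (\<lambda>k. tvec_of A p i (e k))"
  unfolding oriented_frame_def
proof (intro conjI allI impI)
  show "tvec_of A p i (e k) \<in> tangent_space A p" for k by (rule tvec_of_in_tangent_space[OF p])
  fix j assume j: "p \<in> chart_dom A j"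
  let ?T = "transition_deriv A p i j"
  have "(\<chi> r k. tvec_of A p i (e k) j $ r) = matrix ?T ** (\<chi> r k. e k $ r)"
  proof -
    have "?T (e k) = matrix ?T *v e k" for k
      using matrix_works[OF linear_matrix_vector_mul_eq[THEN iffD2, OF linear_transition_deriv[OF p j]]]
      by simp
    then show ?thesis
      by (simp add: vec_eq_iff tvec_of_def j matrix_matrix_mult_def matrix_vector_mult_def)
  qed
  then show "0 < det (\<chi> r k. tvec_of A p i (e k) j $ r)"
    using assms j by (simp add: det_mul oriented_atlas_def)
qed

end

context immersed_manifold
begin

text \<open>The image of the differential has an orthonormal basis; pulling it back gives an orthonormal
  frame, and reversing one vector, if necessary, makes it positively oriented. Without such a frame
  the Legendrian angle, defined by a unique choice, would not be determined.\<close>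

lemma orthonormal_coordinates:
  assumes p: "p \<in> chart_dom A i"
  obtains e :: "'m \<Rightarrow> real^'m" where "0 < det (\<chi> r k. e k $ r)"
    "\<And>k l. coord_deriv i (chart_map A i p) (e k) \<bullet> coord_deriv i (chart_map A i p) (e l) = (if k = l then 1 else 0)"
proof -
  let ?L = "coord_deriv i (chart_map A i p)"
  note lin = linear_coord_deriv[OF p]
  have inj: "inj ?L" using coord_deriv_inj[OF p] by (auto intro: injI)
  have sub: "subspace (range ?L)" by (rule linear_subspace_image[OF lin subspace_UNIV])
  obtain B where B: "B \<subseteq> range ?L" "pairwise orthogonal B" "\<And>x. x \<in> B \<Longrightarrow> norm x = 1"
    "independent B" "card B = dim (range ?L)"
    using orthonormal_basis_subspace[OF sub] by metis
  have "dim (range ?L) = CARD('m)"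
    using dim_image_eq[OF lin, of UNIV] inj by simp
  then obtain b where b: "bij_betw b (UNIV :: 'm set) B"
    using B(4,5) finite_same_card_bij[of "UNIV :: 'm set" B] independent_imp_finite by auto
  define e where "e k = inv ?L (b k)" for k
  have Le: "?L (e k) = b k" for k
    using B(1) b f_inv_into_f[of "b k" ?L UNIV] by (auto simp: e_def bij_betw_def)
  have orth: "b k \<bullet> b l = (if k = l then 1 else 0)" for k l
  proof (cases "k = l")
    case True
    then show ?thesis using B(3)[of "b k"] b by (auto simp: bij_betw_def norm_eq_1)
  next
    case False
    then have "b k \<noteq> b l" "b k \<in> B" "b l \<in> B" using b by (auto simp: bij_betw_def inj_on_def)
    then show ?thesis using B(2) False by (simp add: pairwise_def orthogonal_def)
  qed
  let ?M = "\<chi> r k. e k $ r"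
  have "x = 0" if "?M *v x = 0" for x
  proof -
    have "(\<Sum>k\<in>UNIV. x $ k *\<^sub>R e k) = 0"
      using that by (simp add: vec_eq_iff matrix_vector_mult_def mult.commute)
    then have "?L (\<Sum>k\<in>UNIV. x $ k *\<^sub>R e k) = 0" using linear_0[OF lin] by simp
    then have "(\<Sum>k\<in>UNIV. x $ k *\<^sub>R b k) = 0" using lin by (simp add: linear_sum linear_cmul Le)
    then have "(\<Sum>k\<in>UNIV. x $ k *\<^sub>R b k) \<bullet> b l = 0" for l by simp
    then have "x $ l = 0" for l by (simp add: inner_sum_left orth if_distrib cong: if_cong)
    then show "x = 0" by (simp add: vec_eq_iff)
  qed
  then have det: "det ?M \<noteq> 0"
    unfolding invertible_det_nz[symmetric] invertible_left_inverse matrix_left_invertible_ker by blast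
  (* any index: the sign of the determinant is corrected in this one vector *)
  define k0 :: 'm where "k0 = undefined"
  define d where "d k = (if k = k0 then sgn (det ?M) else 1)" for k
  define J :: "real^'m^'m" where "J = (\<chi> r k. if r = k then d k else 0)"
  have "det J = (\<Prod>k\<in>UNIV. d k)" by (subst det_diagonal) (auto simp: J_def)
  also have "\<dots> = sgn (det ?M)" by (simp add: d_def prod.delta)
  finally have J: "det J = sgn (det ?M)" .
  have "(\<chi> r k. (d k *\<^sub>R e k) $ r) = ?M ** J"
    by (simp add: vec_eq_iff matrix_matrix_mult_def J_def if_distrib mult.commute cong: if_cong)
  then have "det (\<chi> r k. (d k *\<^sub>R e k) $ r) = det ?M * sgn (det ?M)"
    by (simp only: det_mul J)
  then have pos: "0 < det (\<chi> r k. (d k *\<^sub>R e k) $ r)"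
    using det by (simp add: sgn_if split: if_splits)
  have "d k * d k = 1" for k using det by (simp add: d_def sgn_if)
  then have "?L (d k *\<^sub>R e k) \<bullet> ?L (d l *\<^sub>R e l) = (if k = l then 1 else 0)" for k l
    by (simp add: linear_cmul[OF lin] Le orth)
  then show thesis using that[of "\<lambda>k. d k *\<^sub>R e k"] pos by blast
qed

end

locale legendrian_manifold = manifold A
  for A :: "('i, 'a::{t2_space, second_countable_topology}, 'm::finite) atlas" +
  fixes \<psi> :: "'a \<Rightarrow> complex^('m option)"
  assumes legendrian: "legendrian_immersion A \<psi>" and oriented: "oriented_atlas A"

sublocale legendrian_manifold \<subseteq> immersed_manifold A \<psi>
  by unfold_locales (use legendrian in \<open>simp add: legendrian_immersion_def\<close>)

context legendrian_manifold
begin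

lemma hermitian_psi_psi: "p \<in> points A \<Longrightarrow> hermitian (\<psi> p) (\<psi> p) = 1"
  using legendrian by (simp add: legendrian_immersion_def hermitian_self)

text \<open>The real part is half of the derivative of \<open>|\<psi>|\<^sup>2 = 1\<close>, and the imaginary part is twice the
  Liouville form.\<close>

lemma hermitian_deriv_psi:
  assumes "u \<in> chart_map A i ` chart_dom A i"
  shows "hermitian (coord_deriv i u b) (coord_map i u) = 0"
proof -
  obtain p where p: "p \<in> chart_dom A i" "u = chart_map A i p" using assms by auto
  note D = coord_has_derivative[OF p(1), folded p(2)]
  have "((\<lambda>u. hermitian (coord_map i u) (coord_map i u)) has_derivative (\<lambda>v. 0)) (at u)"
    by (rule has_derivative_transform_within_open[OF has_derivative_const open_coord assms, of 1])
       (auto simp: hermitian_psi_psi chart_dom_points)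
  then have "hermitian (coord_map i u) (coord_deriv i u b) + hermitian (coord_deriv i u b) (coord_map i u) = 0"
    by (rule fun_cong[OF has_derivative_unique[OF has_derivative_hermitian[OF D D]], where x = b])
  then have Re: "Re (hermitian (coord_deriv i u b) (coord_map i u)) = 0"
    using hermitian_commute[of "coord_map i u" "coord_deriv i u b"] by (simp add: complex_eq_iff)
  have "liouville_form (\<psi> p) (mdiff A \<psi> p (tvec_of A p i b)) = 0"
    using legendrian tvec_of_in_tangent_space[OF p(1)] chart_dom_points[OF p(1)]
    by (auto simp: legendrian_immersion_def)
  then have "Im (hermitian (coord_deriv i u b) (coord_map i u)) = 0"
    using p by (simp add: liouville_form_def Im_hermitian mdiff_coord[OF p(1)]
        tvec_of_in_tangent_space tvec_of_same)
  with Re show ?thesis by (simp add: complex_eq_iff)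
qed

text \<open>Differentiating \<open>(\<partial>\<^sub>b\<psi>, \<psi>) = 0\<close> in direction \<open>c\<close> gives \<open>(\<partial>\<^sub>b\<psi>, \<partial>\<^sub>c\<psi>) = - (\<partial>\<^sub>c\<partial>\<^sub>b\<psi>, \<psi>)\<close>, which is symmetric
  in \<open>b\<close> and \<open>c\<close>; a Hermitian product that is symmetric is real. So Legendrian immersions are
  isotropic.\<close>

lemma hermitian_deriv_deriv:
  assumes u: "u \<in> chart_map A i ` chart_dom A i"
  shows "hermitian (coord_deriv i u b) (coord_deriv i u c) = of_real (coord_deriv i u b \<bullet> coord_deriv i u c)"
proof -
  obtain p where p: "p \<in> chart_dom A i" "u = chart_map A i p" using u by auto
  note D = coord_has_derivative[OF p(1), folded p(2)]
  let ?DD = "\<lambda>b. frechet_derivative (\<lambda>z. coord_deriv i z b) (at u)"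
  have DD: "((\<lambda>z. coord_deriv i z b) has_derivative ?DD b) (at u)" for b
    by (rule smooth_on_has_derivative[OF smooth_on_derivative[OF coord_map_smooth] u])
  have eq: "hermitian (coord_deriv i u b) (coord_deriv i u c) + hermitian (?DD b c) (coord_map i u) = 0" for b c
  proof -
    have "((\<lambda>z. hermitian (coord_deriv i z b) (coord_map i z)) has_derivative (\<lambda>v. 0)) (at u)"
      by (rule has_derivative_transform_within_open[OF has_derivative_const open_coord u, of 0])
         (simp only: hermitian_deriv_psi)
    then show ?thesis
      by (rule fun_cong[OF has_derivative_unique[OF has_derivative_hermitian[OF DD D]], where x = c])
  qed
  have "?DD b c = ?DD c b"
    by (rule second_derivative_symmetric[OF open_coord coord_map_smooth u])
  then have "hermitian (coord_deriv i u b) (coord_deriv i u c) = hermitian (coord_deriv i u c) (coord_deriv i u b)"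
    using eq[of b c] eq[of c b] by (simp add: add_eq_0_iff)
  then have "Im (hermitian (coord_deriv i u b) (coord_deriv i u c)) = 0"
    using hermitian_commute[of "coord_deriv i u b" "coord_deriv i u c"] by (simp add: complex_eq_iff)
  then show ?thesis by (simp add: complex_eq_iff inner_eq_Re_hermitian)
qed

lemma hermitian_mdiff_psi:
  assumes x: "x \<in> points A" and v: "v \<in> tangent_space A x"
  shows "hermitian (mdiff A \<psi> x v) (\<psi> x) = 0" "hermitian (\<psi> x) (mdiff A \<psi> x v) = 0"
proof -
  obtain i where i: "x \<in> chart_dom A i" using x by (auto simp: points_def)
  show "hermitian (mdiff A \<psi> x v) (\<psi> x) = 0"
    using hermitian_deriv_psi[OF imageI[OF i]] i by (simp add: mdiff_coord[OF i v])
  then show "hermitian (\<psi> x) (mdiff A \<psi> x v) = 0"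
    by (subst hermitian_commute) simp
qed

lemma hermitian_mdiff_mdiff:
  assumes x: "x \<in> points A" and v: "v \<in> tangent_space A x" and w: "w \<in> tangent_space A x"
  shows "hermitian (mdiff A \<psi> x v) (mdiff A \<psi> x w) = of_real (mdiff A \<psi> x v \<bullet> mdiff A \<psi> x w)"
proof -
  obtain i where i: "x \<in> chart_dom A i" using x by (auto simp: points_def)
  show ?thesis
    using hermitian_deriv_deriv[OF imageI[OF i]] by (simp add: mdiff_coord[OF i v] mdiff_coord[OF i w])
qed

text \<open>The determinant of \<open>\<psi>\<close> and the coordinate frame, which is oriented but not orthonormal; its
  argument is nevertheless the Legendrian angle.\<close>

definition frame_det :: "'i \<Rightarrow> real^'m \<Rightarrow> complex" where
  "frame_det i u = det (\<chi> r c. case c of None \<Rightarrow> coord_map i u $ r | Some k \<Rightarrow> coord_deriv i u (axis k 1) $ r)"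

lemma frame_det_smooth: "smooth_on (chart_map A i ` chart_dom A i) (frame_det i)"
  unfolding frame_det_def[abs_def]
proof (rule smooth_on_det[OF open_coord])
  fix r c
  show "smooth_on (chart_map A i ` chart_dom A i) (\<lambda>u. (\<chi> r c. case c of None \<Rightarrow> coord_map i u $ r
      | Some k \<Rightarrow> coord_deriv i u (axis k 1) $ r) $ r $ c)"
    by (cases c) (use coord_map_smooth in \<open>auto intro!: smooth_on_vec_nth[OF open_coord] smooth_on_derivative simp: o_def\<close>)
qed

text \<open>The change from the coordinate frame to another one is a real matrix, extended by \<open>1\<close> in the
  direction of \<open>\<psi>\<close>.\<close>

lemma det_frame:
  assumes p: "p \<in> chart_dom A i" and e: "\<And>k. e k \<in> tangent_space A p"
  shows "det (\<chi> r c. case c of None \<Rightarrow> \<psi> p $ r | Some k \<Rightarrow> mdiff A \<psi> p (e k) $ r) =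
    frame_det i (chart_map A i p) * of_real (det (\<chi> r k. e k i $ r))" (is "det ?N = _")
proof -
  let ?u = "chart_map A i p"
  let ?M = "\<chi> r c. case c of None \<Rightarrow> coord_map i ?u $ r | Some k \<Rightarrow> coord_deriv i ?u (axis k 1) $ r"
  define B :: "complex^('m option)^('m option)" where
    "B = (\<chi> c d. case c of None \<Rightarrow> (if d = None then 1 else 0)
       | Some k \<Rightarrow> (case d of None \<Rightarrow> 0 | Some l \<Rightarrow> of_real (e l i $ k)))"
  have N: "?N = ?M ** B"
    unfolding vec_eq_iff
  proof (intro allI)
    fix r d
    have "coord_deriv i ?u (e l i) $ r = (\<Sum>k\<in>UNIV. coord_deriv i ?u (axis k 1) $ r * of_real (e l i $ k))" for l
      by (subst linear_axis_expand[OF linear_coord_deriv[OF p]])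
         (simp add: scaleR_conv_of_real[where 'a = complex] mult.commute)
    then show "?N $ r $ d = (?M ** B) $ r $ d"
      by (cases d) (auto simp: matrix_matrix_mult_def sum_UNIV_option B_def mdiff_coord[OF p e] p)
  qed
  have blk: "(\<chi> k l. B $ Some k $ Some l) = (\<chi> k l. of_real ((\<chi> r k. e k i $ r) $ k $ l))"
    by (simp add: B_def)
  have "det B = B $ None $ None * det (\<chi> k l. B $ Some k $ Some l)"
    by (rule det_block_option) (simp add: B_def)
  also have "\<dots> = of_real (det (\<chi> r k. e k i $ r))"
    unfolding blk det_of_real by (simp add: B_def)
  finally have "det B = of_real (det (\<chi> r k. e k i $ r))" .
  then show ?thesis by (simp only: N det_mul frame_det_def)
qed

text \<open>By the reality of the Hermitian products, \<open>\<psi>\<close> and a frame that is orthonormal for the metric form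
  a unitary basis.\<close>

lemma norm_det_orthonormal_frame:
  assumes p: "p \<in> points A" and e: "\<And>k. e k \<in> tangent_space A p"
    and orth: "\<And>k l. mdiff A \<psi> p (e k) \<bullet> mdiff A \<psi> p (e l) = (if k = l then 1 else 0)"
  shows "norm (det (\<chi> r c. case c of None \<Rightarrow> \<psi> p $ r | Some k \<Rightarrow> mdiff A \<psi> p (e k) $ r)) = 1"
    (is "norm (det ?N) = 1")
proof (rule norm_det_unitary)
  fix c d
  obtain i where i: "p \<in> chart_dom A i" using p by (auto simp: points_def)
  have col: "column c ?N = (case c of None \<Rightarrow> \<psi> p | Some k \<Rightarrow> mdiff A \<psi> p (e k))" for c
    by (simp add: column_def vec_eq_iff split: option.split)
  have dp: "hermitian (mdiff A \<psi> p (e k)) (\<psi> p) = 0" for k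
    using hermitian_deriv_psi[OF imageI[OF i]] i by (simp add: mdiff_coord[OF i e])
  then have pd: "hermitian (\<psi> p) (mdiff A \<psi> p (e k)) = 0" for k
    by (subst hermitian_commute) simp
  have dd: "hermitian (mdiff A \<psi> p (e k)) (mdiff A \<psi> p (e l)) = (if k = l then 1 else 0)" for k l
    using hermitian_deriv_deriv[OF imageI[OF i]] orth[of k l] by (simp add: mdiff_coord[OF i e])
  show "hermitian (column c ?N) (column d ?N) = (if c = d then 1 else 0)"
    unfolding col by (auto simp: dp pd dd hermitian_psi_psi[OF p] split: option.split)
qed

text \<open>For every oriented orthonormal frame the determinant has norm \<open>1\<close> and is a positive multiple of
  \<^term>\<open>frame_det\<close>, hence equals its sign. The existence of one such frame also shows that
  \<^term>\<open>frame_det\<close> does not vanish.\<close>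

lemma legendrian_angle_frame_det:
  assumes p: "p \<in> chart_dom A i"
  shows frame_det_nonzero: "frame_det i (chart_map A i p) \<noteq> 0"
    and legendrian_angle_eq: "legendrian_angle A \<psi> p = carg (frame_det i (chart_map A i p))"
proof -
  let ?W = "frame_det i (chart_map A i p)"
  let ?N = "\<lambda>e. \<chi> r c. case c of None \<Rightarrow> \<psi> p $ r | Some k \<Rightarrow> mdiff A \<psi> p (e k) $ r"
  let ?O = "oriented_orthonormal_frame A (induced_metric A \<psi>) p"
  have O: "norm (det (?N e)) = 1 \<and> (\<exists>r>0. det (?N e) = ?W * of_real r)" if e: "?O e" for e
  proof -
    have t: "\<And>k. e k \<in> tangent_space A p" and d: "0 < det (\<chi> r k. e k i $ r)"
      and o: "\<And>k l. mdiff A \<psi> p (e k) \<bullet> mdiff A \<psi> p (e l) = (if k = l then 1 else 0)"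
      using e p by (auto simp: oriented_orthonormal_frame_def oriented_frame_def induced_metric_def)
    show ?thesis
      by (intro conjI exI[of _ "det (\<chi> r k. e k i $ r)"] d det_frame[OF p t]
          norm_det_orthonormal_frame[OF chart_dom_points[OF p] t o])
  qed
  obtain e0 where "0 < det (\<chi> r k. e0 k $ r)"
    "\<And>k l. coord_deriv i (chart_map A i p) (e0 k) \<bullet> coord_deriv i (chart_map A i p) (e0 l) = (if k = l then 1 else 0)"
    using orthonormal_coordinates[OF p] by blast
  then have ex: "?O (\<lambda>k. tvec_of A p i (e0 k))"
    by (simp add: oriented_orthonormal_frame_def oriented_frame_tvec_of[OF oriented p] induced_metric_def
        mdiff_coord[OF p] tvec_of_in_tangent_space tvec_of_same p)
  show W: "?W \<noteq> 0" using O[OF ex] by auto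
  have val: "det (?N e) = cis_angle (carg ?W)" if e: "?O e" for e
  proof -
    obtain r where r: "r > 0" "det (?N e) = ?W * of_real r" "norm (det (?N e)) = 1" using O[OF e] by (elim conjE exE) 
    then have "det (?N e) = sgn (?W * of_real r)" by (simp add: sgn_eq)
    also have "\<dots> = sgn ?W" using r(1) by (simp add: sgn_mult sgn_of_real)
    finally show ?thesis using W by (simp add: cis_angle_carg)
  qed
  show "legendrian_angle A \<psi> p = carg ?W"
    unfolding legendrian_angle_def
  proof (rule the_equality)
    show "\<forall>e. ?O e \<longrightarrow> cis_angle (carg ?W) = det (?N e)" by (intro allI impI val[symmetric])
    fix \<beta> assume "\<forall>e. ?O e \<longrightarrow> cis_angle \<beta> = det (?N e)"
    from this[THEN spec, THEN mp, OF ex] have "cis_angle \<beta> = cis_angle (carg ?W)"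
      unfolding val[OF ex] .
    then show "\<beta> = carg ?W" by (simp only: cis_angle_inject)
  qed
qed

lemma legendrian_angle_smooth: "smooth_angle_map A (legendrian_angle A \<psi>)"
  unfolding smooth_angle_map_def
  using frame_det_smooth frame_det_nonzero legendrian_angle_eq by blast

end

section \<open>The product of a curve and a Legendrian immersion\<close>

lemma norm_vector_smult: "norm (c *s x) = norm c * norm (x :: complex^'n::finite)"
  by (simp add: norm_vec_def norm_mult L2_set_right_distrib)

lemma bounded_bilinear_vector_smult: "bounded_bilinear ((*s) :: complex \<Rightarrow> complex^'n::finite \<Rightarrow> complex^'n)"
proof
  show "\<exists>K. \<forall>c (x::complex^'n). norm (c *s x) \<le> norm c * norm x * K"
    by (rule exI[of _ 1]) (simp add: norm_vector_smult)
qed (auto simp: vec_eq_iff algebra_simps)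

lemmas smooth_on_vector_smult = smooth_on_bilinear[OF _ bounded_bilinear_vector_smult]

lemma smooth_on_real_has_vector_derivative:
  fixes f :: "real \<Rightarrow> 'b::real_normed_vector"
  assumes "smooth_on S f" "s \<in> S"
  shows "(f has_vector_derivative vector_derivative f (at s)) (at s)"
  using smooth_on_has_derivative[OF assms] differentiableI_vector vector_derivative_works
    differentiable_def by blast

lemma smooth_on_vector_derivative:
  fixes f :: "real \<Rightarrow> 'b::real_normed_vector"
  assumes "open S" "smooth_on S f"
  shows "smooth_on S (\<lambda>s. vector_derivative f (at s))"
proof (rule smooth_on_cong[OF assms(1) _ smooth_on_derivative[OF assms(2), of 1]])
  show "frechet_derivative f (at s) 1 = vector_derivative f (at s)" if "s \<in> S" for s
    using smooth_on_real_has_vector_derivative[OF assms(2) that]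
    by (simp add: has_vector_derivative_def frechet_derivative_eqI)
qed

lemma has_derivative_smult_split:
  fixes f :: "real^'m::finite \<Rightarrow> complex^'n::finite"
  assumes c: "(c has_vector_derivative c') (at (w $ None))"
    and f: "(f has_derivative f') (at (vec_tail w))"
  shows "((\<lambda>w. c (w $ None) *s f (vec_tail w)) has_derivative
    (\<lambda>z. c (w $ None) *s f' (vec_tail z) + ((z $ None) *\<^sub>R c') *s f (vec_tail w))) (at w)"
proof (rule bounded_bilinear.FDERIV[OF bounded_bilinear_vector_smult])
  show "((\<lambda>w. c (w $ None)) has_derivative (\<lambda>z. (z $ None) *\<^sub>R c')) (at w)"
    by (rule has_derivative_compose[OF bounded_linear_imp_has_derivative[OF bounded_linear_vec_nth]
          c[unfolded has_vector_derivative_def]])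
  show "((\<lambda>w. f (vec_tail w)) has_derivative (\<lambda>z. f' (vec_tail z))) (at w)"
    by (rule has_derivative_compose[OF bounded_linear_imp_has_derivative[OF bounded_linear_vec_tail] f])
qed

text \<open>Two oriented frames are related by a real matrix with positive determinant, so the argument may be
  computed in the coordinate frame.\<close>

lemma (in manifold) lagrangian_angle_chart:
  fixes f :: "'a \<Rightarrow> complex^'m"
  assumes or: "oriented_atlas A" and p: "p \<in> chart_dom A i"
    and L: "(f \<circ> chart_inv A i has_derivative L) (at (chart_map A i p))"
    and nz: "det (\<chi> r k. L (axis k 1) $ r) \<noteq> 0"
  shows "lagrangian_angle A f p = carg (det (\<chi> r k. L (axis k 1) $ r))"
proof -
  let ?M = "\<chi> r k. L (axis k 1) $ r"
  have lin: "linear L" using L has_derivative_linear by blast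
  have val: "carg (det (\<chi> r k. mdiff A f p (e k) $ r)) = carg (det ?M)" if e: "oriented_frame A p e" for e
  proof -
    have t: "e k \<in> tangent_space A p" and d: "0 < det (\<chi> r k. e k i $ r)" for k
      using e p by (auto simp: oriented_frame_def)
    have "L (e l i) $ r = (\<Sum>k\<in>UNIV. L (axis k 1) $ r * of_real (e l i $ k))" for l r
      by (subst linear_axis_expand[OF lin])
         (simp add: scaleR_conv_of_real[where 'a = complex] mult.commute)
    then have "(\<chi> r k. mdiff A f p (e k) $ r) = ?M ** (\<chi> k l. of_real ((\<chi> r k. e k i $ r) $ k $ l))"
      by (simp add: vec_eq_iff matrix_matrix_mult_def mdiff_chart[OF p t L])
    then have "det (\<chi> r k. mdiff A f p (e k) $ r) = of_real (det (\<chi> r k. e k i $ r)) * det ?M"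
      by (simp only: det_mul det_of_real mult.commute)
    then show ?thesis using carg_mult_pos[OF d nz] by simp
  qed
  have "det (\<chi> r k. (axis k 1 :: real^'m) $ r) = 1"
  proof -
    have "(\<chi> r k. (axis k 1 :: real^'m) $ r) = mat 1" by (simp add: vec_eq_iff axis_def mat_def)
    then show ?thesis by simp
  qed
  then have ex: "oriented_frame A p (\<lambda>k. tvec_of A p i (axis k 1))"
    by (intro oriented_frame_tvec_of[OF or p]) simp
  show ?thesis
    unfolding lagrangian_angle_def
  proof (rule the_equality)
    show "\<forall>e. oriented_frame A p e \<longrightarrow> carg (det ?M) = carg (det (\<chi> r k. mdiff A f p (e k) $ r))"
      by (intro allI impI val[symmetric])
    fix \<beta> assume "\<forall>e. oriented_frame A p e \<longrightarrow> \<beta> = carg (det (\<chi> r k. mdiff A f p (e k) $ r))"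
    from this[THEN spec, THEN mp, OF ex] show "\<beta> = carg (det ?M)" unfolding val[OF ex] .
  qed
qed

text \<open>If \<open>\<alpha>\<close> runs along a ray from the origin, then \<open>\<Phi>\<close> is the cone over \<open>\<psi>\<close>; the names refer to this
  case, although \<open>\<alpha>\<close> is a general curve.\<close>

locale legendrian_cone = legendrian_manifold A \<psi> + product_manifold A I
  for A :: "('i, 'a::{t2_space, second_countable_topology}, 'm::finite) atlas"
    and \<psi> :: "'a \<Rightarrow> complex^('m option)" and I :: "real set" +
  fixes \<alpha> :: "real \<Rightarrow> complex"
  assumes smooth_curve: "smooth_on I \<alpha>"
    and curve_nonzero: "s \<in> I \<Longrightarrow> \<alpha> s \<noteq> 0"
    and arclength: "s \<in> I \<Longrightarrow> norm (vector_derivative \<alpha> (at s)) = 1"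
begin

abbreviation "\<alpha>' s \<equiv> vector_derivative \<alpha> (at s)"

abbreviation "\<Phi> \<equiv> \<lambda>(s, x). \<alpha> s *s \<psi> x"

lemma curve_deriv_nonzero: "s \<in> I \<Longrightarrow> \<alpha>' s \<noteq> 0"
  using arclength by force

lemma curve_has_derivative: "s \<in> I \<Longrightarrow> (\<alpha> has_vector_derivative \<alpha>' s) (at s)"
  by (rule smooth_on_real_has_vector_derivative[OF smooth_curve])

lemma curve_deriv_smooth: "smooth_on I \<alpha>'"
  by (rule smooth_on_vector_derivative[OF open_I smooth_curve])

lemma open_prod_coord: "open (chart_map P i ` chart_dom P i)"
  unfolding prod_dom by (rule open_prod_image[OF open_coord])

lemma smooth_on_prod_image:
  assumes "smooth_on I c" "smooth_on (chart_map A i ` chart_dom A i) h"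
  shows "smooth_on (chart_map P i ` chart_dom P i) (\<lambda>w. c (w $ None))"
    and "smooth_on (chart_map P i ` chart_dom P i) (\<lambda>w. h (vec_tail w))"
proof -
  have sub: "(\<lambda>w. w $ None) ` chart_map P i ` chart_dom P i \<subseteq> I"
    "vec_tail ` chart_map P i ` chart_dom P i \<subseteq> chart_map A i ` chart_dom A i"
    by (auto simp: prod_dom prod_map)
  show "smooth_on (chart_map P i ` chart_dom P i) (\<lambda>w. c (w $ None))"
    by (rule smooth_on_compose[OF open_prod_coord
          smooth_on_vec_nth[OF open_prod_coord smooth_on_ident[OF open_prod_coord]] assms(1) sub(1)])
  show "smooth_on (chart_map P i ` chart_dom P i) (\<lambda>w. h (vec_tail w))"
    by (rule smooth_on_compose[OF open_prod_coord smooth_on_vec_tail[OF open_prod_coord] assms(2) sub(2)])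
qed

lemma cone_coord:
  assumes "w \<in> chart_map P i ` chart_dom P i"
  shows "(\<Phi> \<circ> chart_inv P i) w = \<alpha> (w $ None) *s coord_map i (vec_tail w)"
  using assms by (simp add: prod_image_dom prod_chart_inv)

lemma cone_smooth: "smooth_map_on P (points P) \<Phi>"
  unfolding smooth_map_on_def
proof
  fix i
  have dom: "points P \<inter> chart_dom P i = chart_dom P i" by (auto simp: points_def)
  have "smooth_on (chart_map P i ` chart_dom P i) (\<lambda>w. \<alpha> (w $ None) *s coord_map i (vec_tail w))"
    by (intro smooth_on_vector_smult open_prod_coord smooth_on_prod_image[OF smooth_curve coord_map_smooth])
  then have "smooth_on (chart_map P i ` chart_dom P i) (\<Phi> \<circ> chart_inv P i)"
    by (rule smooth_on_cong[OF open_prod_coord, rotated]) (simp only: cone_coord)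
  then show "smooth_on (chart_map P i ` (points P \<inter> chart_dom P i)) (\<Phi> \<circ> chart_inv P i)"
    unfolding dom .
qed

lemma prod_dom_iff: "(s, x) \<in> chart_dom P i \<longleftrightarrow> s \<in> I \<and> x \<in> chart_dom A i"
  by (simp add: prod_dom)

lemma cone_has_derivative:
  assumes s: "s \<in> I" and x: "x \<in> chart_dom A i"
  shows "(\<Phi> \<circ> chart_inv P i has_derivative
    (\<lambda>z. \<alpha> s *s coord_deriv i (chart_map A i x) (vec_tail z) + ((z $ None) *\<^sub>R \<alpha>' s) *s \<psi> x))
    (at (chart_map P i (s, x)))"
proof (rule has_derivative_transform_within_open[OF _ open_prod_coord])
  show "((\<lambda>w. \<alpha> (w $ None) *s coord_map i (vec_tail w)) has_derivative
    (\<lambda>z. \<alpha> s *s coord_deriv i (chart_map A i x) (vec_tail z) + ((z $ None) *\<^sub>R \<alpha>' s) *s \<psi> x))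
    (at (chart_map P i (s, x)))"
    using has_derivative_smult_split[of \<alpha> "\<alpha>' s" "chart_map P i (s, x)" "coord_map i"
        "coord_deriv i (chart_map A i x)"] curve_has_derivative[OF s] coord_has_derivative[OF x] x
    by (simp add: prod_map)
  show "chart_map P i (s, x) \<in> chart_map P i ` chart_dom P i"
    using s x by (intro imageI) (simp add: prod_dom_iff)
  show "\<alpha> (w $ None) *s coord_map i (vec_tail w) = (\<Phi> \<circ> chart_inv P i) w"
    if "w \<in> chart_map P i ` chart_dom P i" for w
    by (rule cone_coord[OF that, symmetric])
qed

lemma mdiff_cone:
  assumes s: "s \<in> I" and x: "x \<in> points A" and v: "v \<in> tangent_space A x"
  shows "mdiff P \<Phi> (s, x) (tpair A x a v) = \<alpha> s *s mdiff A \<psi> x v + (a *\<^sub>R \<alpha>' s) *s \<psi> x"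
proof -
  obtain i where i: "x \<in> chart_dom A i" using x by (auto simp: points_def)
  show ?thesis
    using prod.mdiff_chart[OF _ tpair_tangent[OF s x v] cone_has_derivative[OF s i]] s i
    by (simp add: prod_dom_iff tpair_coordinate mdiff_coord[OF i v])
qed

text \<open>The mixed terms vanish by orthogonality, \<open>(\<alpha>'\<psi>, \<alpha>'\<psi>) = |\<alpha>'|\<^sup>2 = 1\<close>, and the factor \<open>\<alpha>\<close> enters the
  remaining term only through \<open>|\<alpha>|\<^sup>2\<close>; in particular the result is real. The metric is the real part
  of this equation, and the Lagrangian condition its imaginary part.\<close>

lemma hermitian_cone:
  assumes s: "s \<in> I" and x: "x \<in> points A" and v: "v \<in> tangent_space A x" and w: "w \<in> tangent_space A x"
  shows "hermitian (mdiff P \<Phi> (s, x) (tpair A x a v)) (mdiff P \<Phi> (s, x) (tpair A x b w)) =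
    of_real (a * b + (norm (\<alpha> s))\<^sup>2 * (mdiff A \<psi> x v \<bullet> mdiff A \<psi> x w))"
proof -
  have 1: "\<alpha>' s * cnj (\<alpha>' s) = 1" using arclength[OF s] complex_norm_square[of "\<alpha>' s"] by simp
  have 2: "\<alpha> s * (cnj (\<alpha> s) * z) = of_real ((norm (\<alpha> s))\<^sup>2) * z" for z
    using complex_norm_square[of "\<alpha> s"] by (simp add: mult.assoc[symmetric])
  show ?thesis
    using 1 1[unfolded mult.commute[of "\<alpha>' s"]]
    by (simp add: mdiff_cone[OF s x] v w hermitian_add_left hermitian_add_right hermitian_scale_left
        hermitian_scale_right hermitian_mdiff_psi[OF x] hermitian_mdiff_mdiff[OF x] hermitian_psi_psi[OF x] 2
        scaleR_conv_of_real mult.assoc mult.left_commute)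
qed

lemma cone_metric:
  assumes "s \<in> I" "x \<in> points A" "v \<in> tangent_space A x" "w \<in> tangent_space A x"
  shows "mdiff P \<Phi> (s, x) (tpair A x a v) \<bullet> mdiff P \<Phi> (s, x) (tpair A x b w) =
    a * b + (norm (\<alpha> s))\<^sup>2 * (mdiff A \<psi> x v \<bullet> mdiff A \<psi> x w)"
  unfolding inner_eq_Re_hermitian hermitian_cone[OF assms] by (simp add: inner_eq_Re_hermitian)

text \<open>The \<open>\<psi>\<close>-component of \<open>d\<Phi>(a \<partial>\<^sub>s, v)\<close> determines \<open>a\<close>, and then \<open>d\<psi>(v)\<close> is determined as well.\<close>

lemma cone_immersion: "immersion P \<Phi>"
  unfolding immersion_def
proof (intro conjI ballI inj_onI cone_smooth)
  fix q v w assume q: "q \<in> points P" and v: "v \<in> tangent_space P q" and w: "w \<in> tangent_space P q"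
    and eq: "mdiff P \<Phi> q v = mdiff P \<Phi> q w"
  obtain s x where sx: "q = (s, x)" "s \<in> I" "x \<in> points A" using q by (auto simp: prod_points)
  obtain a v' where v': "v' \<in> tangent_space A x" "v = tpair A x a v'"
    using tangent_space_prodE[OF v[unfolded sx(1)] sx(2,3)] .
  obtain b w' where w': "w' \<in> tangent_space A x" "w = tpair A x b w'"
    using tangent_space_prodE[OF w[unfolded sx(1)] sx(2,3)] .
  have eq': "\<alpha> s *s mdiff A \<psi> x v' + (a *\<^sub>R \<alpha>' s) *s \<psi> x = \<alpha> s *s mdiff A \<psi> x w' + (b *\<^sub>R \<alpha>' s) *s \<psi> x"
    using eq unfolding sx(1) v'(2) w'(2) mdiff_cone[OF sx(2,3) v'(1)] mdiff_cone[OF sx(2,3) w'(1)] .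
  have "a *\<^sub>R \<alpha>' s = b *\<^sub>R \<alpha>' s"
    using arg_cong[OF eq', of "\<lambda>z. hermitian z (\<psi> x)"] v' w'
    by (simp add: hermitian_add_left hermitian_scale_left hermitian_mdiff_psi[OF sx(3)] hermitian_psi_psi[OF sx(3)])
  then have ab: "a = b" using curve_deriv_nonzero[OF sx(2)] by simp
  then have "mdiff A \<psi> x v' = mdiff A \<psi> x w'" using eq' curve_nonzero[OF sx(2)] by simp
  then have "v' = w'" using immersion sx(3) v' w' unfolding immersion_def inj_on_def by blast
  then show "v = w" using ab v' w' by simp
qed

lemma cone_lagrangian: "lagrangian_immersion P \<Phi>"
  unfolding lagrangian_immersion_def
proof (intro conjI ballI cone_immersion)
  fix q v w assume q: "q \<in> points P" and v: "v \<in> tangent_space P q" and w: "w \<in> tangent_space P q"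
  obtain s x where sx: "q = (s, x)" "s \<in> I" "x \<in> points A" using q by (auto simp: prod_points)
  obtain a v' where v': "v' \<in> tangent_space A x" "v = tpair A x a v'"
    using tangent_space_prodE[OF v[unfolded sx(1)] sx(2,3)] .
  obtain b w' where w': "w' \<in> tangent_space A x" "w = tpair A x b w'"
    using tangent_space_prodE[OF w[unfolded sx(1)] sx(2,3)] .
  show "symplectic_form (mdiff P \<Phi> q v) (mdiff P \<Phi> q w) = 0"
    unfolding symplectic_form_def sx(1) v'(2) w'(2) hermitian_cone[OF sx(2,3) v'(1) w'(1)] by simp
qed

sublocale cone: immersed_manifold P \<Phi>
  by unfold_locales (rule cone_immersion)

text \<open>The factor by which the coordinate frame determinant of \<open>\<Phi>\<close> differs from the one of \<open>\<psi>\<close>; its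
  argument is the function \<open>G\<close> of the curve.\<close>

definition curve_det :: "real \<Rightarrow> complex" where
  "curve_det s = \<alpha>' s * \<alpha> s ^ CARD('m)"

lemma curve_det_nonzero: "s \<in> I \<Longrightarrow> curve_det s \<noteq> 0"
  by (simp add: curve_det_def curve_deriv_nonzero curve_nonzero)

lemma curve_det_smooth: "smooth_on I curve_det"
  unfolding curve_det_def[abs_def]
  by (intro smooth_on_mult smooth_on_power open_I curve_deriv_smooth smooth_curve)

text \<open>The columns of the determinant are \<open>\<alpha>'\<psi>\<close> and the \<open>m\<close> vectors \<open>\<alpha> \<partial>\<^sub>k\<psi>\<close>, so the factors can be
  collected in a diagonal matrix.\<close>

lemma lagrangian_angle_cone:
  assumes s: "s \<in> I" and x: "x \<in> chart_dom A i"
  shows "lagrangian_angle P \<Phi> (s, x) = carg (curve_det s * frame_det i (chart_map A i x))"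
proof -
  let ?L = "\<lambda>z. \<alpha> s *s coord_deriv i (chart_map A i x) (vec_tail z) + ((z $ None) *\<^sub>R \<alpha>' s) *s \<psi> x"
  let ?M = "\<chi> r c. case c of None \<Rightarrow> coord_map i (chart_map A i x) $ r
      | Some k \<Rightarrow> coord_deriv i (chart_map A i x) (axis k 1) $ r"
  define J :: "complex^('m option)^('m option)" where
    "J = (\<chi> c d. if c = d then (case c of None \<Rightarrow> \<alpha>' s | Some _ \<Rightarrow> \<alpha> s) else 0)"
  have "det J = (\<Prod>c\<in>UNIV. case c of None \<Rightarrow> \<alpha>' s | Some (_::'m) \<Rightarrow> \<alpha> s)"
    by (subst det_diagonal) (auto simp: J_def)
  then have J: "det J = curve_det s" by (simp add: prod_UNIV_option curve_det_def)
  have "(\<chi> r k. ?L (axis k 1) $ r) = ?M ** J"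
    unfolding vec_eq_iff
  proof (intro allI)
    fix r d
    show "(\<chi> r k. ?L (axis k 1) $ r) $ r $ d = (?M ** J) $ r $ d"
      by (cases d) (auto simp: matrix_matrix_mult_def sum_UNIV_option J_def vec_tail_axis x
          linear_0[OF linear_coord_deriv[OF x]] axis_option_None if_distrib mult.commute cong: if_cong)
  qed
  then have det: "det (\<chi> r k. ?L (axis k 1) $ r) = curve_det s * frame_det i (chart_map A i x)"
    by (simp only: det_mul J frame_det_def mult.commute)
  have "det (\<chi> r k. ?L (axis k 1) $ r) \<noteq> 0"
    unfolding det using curve_det_nonzero[OF s] frame_det_nonzero[OF x] by simp
  then show ?thesis
    using prod.lagrangian_angle_chart[OF prod_oriented[OF oriented] _ cone_has_derivative[OF s x]] s x
    unfolding det by (simp add: prod_dom_iff)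
qed

definition curve_angle :: "real \<Rightarrow> angle" where
  "curve_angle = (\<lambda>s. carg (\<alpha>' s) + (\<Sum>_<CARD('m). carg (\<alpha> s)))"

lemma curve_angle_eq: "s \<in> I \<Longrightarrow> curve_angle s = carg (curve_det s)"
  by (simp add: curve_angle_def curve_det_def carg_mult curve_deriv_nonzero curve_nonzero carg_power)

lemma lagrangian_angle_cone_eq:
  assumes s: "s \<in> I" and x: "x \<in> points A"
  shows "lagrangian_angle P \<Phi> (s, x) = curve_angle s + legendrian_angle A \<psi> x"
proof -
  obtain i where i: "x \<in> chart_dom A i" using x by (auto simp: points_def)
  show ?thesis
    by (simp only: lagrangian_angle_cone[OF s i] curve_angle_eq[OF s] legendrian_angle_eq[OF i]
        carg_mult[OF curve_det_nonzero[OF s] frame_det_nonzero[OF i]])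
qed

abbreviation cone_det :: "'i \<Rightarrow> real^('m option) \<Rightarrow> complex" where
  "cone_det i \<equiv> \<lambda>w. curve_det (w $ None) * frame_det i (vec_tail w)"

lemma cone_det_smooth: "smooth_on (chart_map P i ` chart_dom P i) (cone_det i)"
  by (intro smooth_on_mult open_prod_coord smooth_on_prod_image[OF curve_det_smooth frame_det_smooth])

lemma cone_det_angle:
  assumes "q \<in> chart_dom P i"
  shows "cone_det i (chart_map P i q) \<noteq> 0 \<and> lagrangian_angle P \<Phi> q = carg (cone_det i (chart_map P i q))"
  using assms by (cases q) (auto simp: prod_dom_iff prod_map curve_det_nonzero frame_det_nonzero lagrangian_angle_cone)

lemma lagrangian_angle_smooth: "smooth_angle_map P (lagrangian_angle P \<Phi>)"
  unfolding smooth_angle_map_def using cone_det_smooth cone_det_angle by blast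

lemma angle_deriv_curve_angle:
  assumes s: "s \<in> I"
  shows "angle_deriv curve_angle s = Im (vector_derivative curve_det (at s) / curve_det s)"
proof -
  let ?\<theta> = "SOME \<theta>. local_lift curve_angle s \<theta>"
  note lift = open_I s smooth_on_continuous_on[OF curve_det_smooth] curve_det_nonzero curve_angle_eq
  have l: "local_lift curve_angle s ?\<theta>" by (rule someI[where P = "local_lift curve_angle s", OF local_lift_exists[OF lift]])
  have "(curve_det has_derivative (\<lambda>h. h *\<^sub>R vector_derivative curve_det (at s))) (at s)"
    using smooth_on_real_has_vector_derivative[OF curve_det_smooth s] by (simp add: has_vector_derivative_def)
  from local_lift_has_derivative[OF lift _ _ this l]
  have "(?\<theta> has_derivative (\<lambda>h. Im ((h *\<^sub>R vector_derivative curve_det (at s)) / curve_det s))) (at s)"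
    by simp
  also have "(\<lambda>h. Im ((h *\<^sub>R vector_derivative curve_det (at s)) / curve_det s)) =
      (*) (Im (vector_derivative curve_det (at s) / curve_det s))"
    by (auto simp: fun_eq_iff scaleR_conv_of_real simp flip: times_divide_eq_right)
  finally show ?thesis
    unfolding angle_deriv_def by (intro DERIV_imp_deriv) (simp add: has_field_derivative_def)
qed

lemma angle_deriv_curve_angle_smooth: "smooth_on I (angle_deriv curve_angle)"
  by (rule smooth_on_cong[OF open_I angle_deriv_curve_angle[symmetric]])
     (auto intro!: smooth_on_bounded_linear[OF _ bounded_linear_Im] smooth_on_divide smooth_on_vector_derivative
        curve_det_smooth open_I simp: curve_det_nonzero)

lemma angle_diff_cone:
  assumes s: "s \<in> I" and x: "x \<in> points A" and v: "v \<in> tangent_space A x"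
  shows "angle_diff P (lagrangian_angle P \<Phi>) (s, x) (tpair A x a v) =
    a * angle_deriv curve_angle s + angle_diff A (legendrian_angle A \<psi>) x v"
proof -
  obtain i where i: "x \<in> chart_dom A i" using x by (auto simp: points_def)
  have q: "(s, x) \<in> chart_dom P i" using s i by (simp add: prod_dom_iff)
  let ?u = "chart_map A i x"
  have "frechet_derivative (cone_det i) (at (chart_map P i (s, x))) =
     (\<lambda>z. curve_det s * frechet_derivative (frame_det i) (at ?u) (vec_tail z) +
          ((z $ None) *\<^sub>R vector_derivative curve_det (at s)) * frame_det i ?u)"
  proof (rule frechet_derivative_eqI)
    have 1: "((\<lambda>w. curve_det (w $ None)) has_derivative (\<lambda>z. (z $ None) *\<^sub>R vector_derivative curve_det (at s)))
        (at (chart_map P i (s, x)))"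
      by (rule has_derivative_compose[OF bounded_linear_imp_has_derivative[OF bounded_linear_vec_nth]])
         (use smooth_on_real_has_vector_derivative[OF curve_det_smooth s] in \<open>simp add: has_vector_derivative_def prod_map\<close>)
    have 2: "((\<lambda>w. frame_det i (vec_tail w)) has_derivative (\<lambda>z. frechet_derivative (frame_det i) (at ?u) (vec_tail z)))
        (at (chart_map P i (s, x)))"
      by (rule has_derivative_compose[OF bounded_linear_imp_has_derivative[OF bounded_linear_vec_tail]])
         (use smooth_on_has_derivative[OF frame_det_smooth imageI[OF i]] in \<open>simp add: prod_map\<close>)
    show "(cone_det i has_derivative
       (\<lambda>z. curve_det s * frechet_derivative (frame_det i) (at ?u) (vec_tail z) +
          ((z $ None) *\<^sub>R vector_derivative curve_det (at s)) * frame_det i ?u)) (at (chart_map P i (s, x)))"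
      using has_derivative_mult[OF 1 2] by (simp add: prod_map)
  qed
  then have "angle_diff P (lagrangian_angle P \<Phi>) (s, x) (tpair A x a v) =
    Im ((curve_det s * frechet_derivative (frame_det i) (at ?u) (v i) +
          (a *\<^sub>R vector_derivative curve_det (at s)) * frame_det i ?u) / (curve_det s * frame_det i ?u))"
    using prod.angle_diff_coord[OF cone_det_smooth cone_det_angle q tpair_tangent[OF s x v]]
    by (simp add: prod_map tpair_coordinate[OF i])
  also have "(curve_det s * frechet_derivative (frame_det i) (at ?u) (v i) +
          (a *\<^sub>R vector_derivative curve_det (at s)) * frame_det i ?u) / (curve_det s * frame_det i ?u) =
      frechet_derivative (frame_det i) (at ?u) (v i) / frame_det i ?u +
      of_real a * (vector_derivative curve_det (at s) / curve_det s)"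
    using curve_det_nonzero[OF s] frame_det_nonzero[OF i] by (simp add: field_simps scaleR_conv_of_real)
  finally show ?thesis
    unfolding angle_deriv_curve_angle[OF s]
    using angle_diff_coord[OF frame_det_smooth _ i v, of "legendrian_angle A \<psi>"]
      frame_det_nonzero legendrian_angle_eq by (simp del: times_divide_eq_right)
qed

text \<open>The stated vector has the right inner products with all tangent vectors, by the formulas for the
  metric and for the differential of the angle; the factor \<open>1/|\<alpha>|\<^sup>2\<close> compensates the one in the
  metric.\<close>

lemma angle_grad_cone:
  assumes s: "s \<in> I" and x: "x \<in> points A"
  shows "angle_grad P (induced_metric P \<Phi>) (lagrangian_angle P \<Phi>) (s, x) =
    tpair A x (angle_deriv curve_angle s)
      (\<lambda>i. (1 / (norm (\<alpha> s))\<^sup>2) *\<^sub>R angle_grad A (induced_metric A \<psi>) (legendrian_angle A \<psi>) x i)"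
proof -
  let ?g = "angle_grad A (induced_metric A \<psi>) (legendrian_angle A \<psi>) x"
  let ?h = "\<lambda>i. (1 / (norm (\<alpha> s))\<^sup>2) *\<^sub>R ?g i"
  have g: "?g \<in> tangent_space A x" by (rule angle_grad_tangent[OF legendrian_angle_smooth x])
  have h: "?h \<in> tangent_space A x" by (rule tangent_space_scale[OF g])
  have dh: "mdiff A \<psi> x ?h = (1 / (norm (\<alpha> s))\<^sup>2) *\<^sub>R mdiff A \<psi> x ?g"
    using mdiff_lincomb[OF x g g, of "1 / (norm (\<alpha> s))\<^sup>2" 0] by simp
  show ?thesis
  proof (rule cone.angle_grad_eqI)
    show "(s, x) \<in> points P" using s x by (simp add: prod_points)
    show "tpair A x (angle_deriv curve_angle s) ?h \<in> tangent_space P (s, x)" by (rule tpair_tangent[OF s x h])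
    fix w assume "w \<in> tangent_space P (s, x)"
    then obtain b w' where w': "w' \<in> tangent_space A x" and w: "w = tpair A x b w'"
      using tangent_space_prodE[OF _ s x] by blast
    show "mdiff P \<Phi> (s, x) (tpair A x (angle_deriv curve_angle s) ?h) \<bullet> mdiff P \<Phi> (s, x) w =
        angle_diff P (lagrangian_angle P \<Phi>) (s, x) w"
      unfolding w cone_metric[OF s x h w'] dh angle_diff_cone[OF s x w']
        angle_grad_inner[OF legendrian_angle_smooth x w', symmetric]
      using curve_nonzero[OF s] by simp
  qed
qed

end

section \<open>Covariant derivatives of the gradient\<close>

lemma (in manifold) tvec_of_eqI:
  "p \<in> chart_dom A i \<Longrightarrow> v \<in> tangent_space A p \<Longrightarrow> v i = u \<Longrightarrow> tvec_of A p i u = v"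
  using tvec_of_coordinate by blast

context legendrian_cone
begin

abbreviation grad_psi :: "'a \<Rightarrow> ('i, 'm) tvec" where
  "grad_psi \<equiv> angle_grad A (induced_metric A \<psi>) (legendrian_angle A \<psi>)"

abbreviation grad_Phi :: "real \<times> 'a \<Rightarrow> ('i, 'm option) tvec" where
  "grad_Phi \<equiv> angle_grad P (induced_metric P \<Phi>) (lagrangian_angle P \<Phi>)"

lemma grad_psi_tangent: "x \<in> points A \<Longrightarrow> grad_psi x \<in> tangent_space A x"
  by (rule angle_grad_tangent[OF legendrian_angle_smooth])

lemma grad_psi_smooth: "smooth_vector_field A (points A) grad_psi"
  by (rule angle_grad_smooth[OF legendrian_angle_smooth])

lemma grad_Phi_smooth: "smooth_vector_field P (points P) grad_Phi"
  by (rule cone.angle_grad_smooth[OF lagrangian_angle_smooth])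

text \<open>The ambient image \<open>d\<Phi>(\<nabla>\<beta>\<^sub>\<Phi>)\<close> of the gradient is a combination of \<open>\<psi>\<close> and \<open>d\<psi>(\<nabla>\<beta>\<^sub>\<psi>)\<close> with
  coefficients that depend on \<open>s\<close> only.\<close>

definition radial_coeff :: "real \<Rightarrow> complex" where
  "radial_coeff s = angle_deriv curve_angle s *\<^sub>R \<alpha>' s"

text \<open>This is \<open>\<alpha> / |\<alpha>|\<^sup>2\<close>. In the form \<open>1 / cnj \<alpha>\<close> its product with \<open>cnj \<alpha>\<close> is constant, which yields its
  derivative without differentiating \<open>|\<alpha>|\<close>.\<close>

definition angular_coeff :: "real \<Rightarrow> complex" where
  "angular_coeff s = inverse (cnj (\<alpha> s))"

lemma angular_coeff_eq: "s \<in> I \<Longrightarrow> angular_coeff s = (1 / (norm (\<alpha> s))\<^sup>2) *\<^sub>R \<alpha> s"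
  using curve_nonzero[of s] complex_norm_square[of "\<alpha> s"]
  by (simp add: angular_coeff_def scaleR_conv_of_real field_simps)

lemma mdiff_grad_Phi:
  assumes s: "s \<in> I" and x: "x \<in> points A"
  shows "mdiff P \<Phi> (s, x) (grad_Phi (s, x)) =
    radial_coeff s *s \<psi> x + angular_coeff s *s mdiff A \<psi> x (grad_psi x)"
proof -
  note g = grad_psi_tangent[OF x]
  show ?thesis
    unfolding angle_grad_cone[OF s x] mdiff_cone[OF s x tangent_space_scale[OF g]] mdiff_scale[OF x g]
      radial_coeff_def angular_coeff_eq[OF s]
    by (simp add: vec_eq_iff)
qed

lemma radial_coeff_derivative:
  assumes s: "s \<in> I"
  shows "(radial_coeff has_vector_derivative
    (angle_deriv curve_angle s *\<^sub>R vector_derivative \<alpha>' (at s) + deriv (angle_deriv curve_angle) s *\<^sub>R \<alpha>' s)) (at s)"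
  unfolding radial_coeff_def[abs_def]
proof (rule has_vector_derivative_scaleR)
  show "(angle_deriv curve_angle has_real_derivative deriv (angle_deriv curve_angle) s) (at s)"
    using smooth_on_has_derivative[OF angle_deriv_curve_angle_smooth s]
    by (metis DERIV_deriv_iff_real_differentiable differentiable_def)
  show "(\<alpha>' has_vector_derivative vector_derivative \<alpha>' (at s)) (at s)"
    by (rule smooth_on_real_has_vector_derivative[OF curve_deriv_smooth s])
qed

text \<open>Half of the derivative of \<open>|\<alpha>'|\<^sup>2 = 1\<close>.\<close>

lemma curve_acceleration_orthogonal:
  assumes s: "s \<in> I"
  shows "Re (vector_derivative \<alpha>' (at s) * cnj (\<alpha>' s)) = 0"
proof -
  have D: "(\<alpha>' has_derivative (\<lambda>h. h *\<^sub>R vector_derivative \<alpha>' (at s))) (at s)"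
    using smooth_on_real_has_vector_derivative[OF curve_deriv_smooth s] by (simp add: has_vector_derivative_def)
  have "((\<lambda>t. \<alpha>' t \<bullet> \<alpha>' t) has_derivative (\<lambda>h. 0)) (at s)"
    by (rule has_derivative_transform_within_open[OF has_derivative_const open_I s, of 1])
       (simp add: arclength flip: power2_norm_eq_inner)
  from fun_cong[OF has_derivative_unique[OF has_derivative_inner[OF D D] this], where x = 1]
  show ?thesis by (simp add: inner_complex_def algebra_simps)
qed

text \<open>Differentiating \<open>angular_coeff * cnj \<alpha> = 1\<close> shows that the two real parts are opposite, so only
  the second one has to be computed.\<close>

lemma angular_coeff_derivative:
  assumes s: "s \<in> I"
  obtains c where "(angular_coeff has_vector_derivative c) (at s)"
    and "Re (c * cnj (\<alpha> s)) = - inner (\<alpha>' s) (\<alpha> s) / (norm (\<alpha> s))\<^sup>2"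
    and "Re (angular_coeff s * cnj (\<alpha>' s)) = inner (\<alpha>' s) (\<alpha> s) / (norm (\<alpha> s))\<^sup>2"
proof -
  let ?c = "vector_derivative angular_coeff (at s)"
  have "smooth_on I angular_coeff"
    unfolding angular_coeff_def[abs_def]
    by (intro smooth_on_inverse smooth_on_bounded_linear[OF _ bounded_linear_cnj] open_I smooth_curve)
       (simp add: curve_nonzero)
  then have c: "(angular_coeff has_vector_derivative ?c) (at s)"
    by (rule smooth_on_real_has_vector_derivative[OF _ s])
  have one: "angular_coeff t * cnj (\<alpha> t) = 1" if "t \<in> I" for t
    using curve_nonzero[OF that] by (simp add: angular_coeff_def)
  have "((\<lambda>t. angular_coeff t * cnj (\<alpha> t)) has_derivative (\<lambda>h. 0)) (at s)"
    by (rule has_derivative_transform_within_open[OF has_derivative_const open_I s, of 1]) (simp add: one)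
  moreover have "((\<lambda>t. angular_coeff t * cnj (\<alpha> t)) has_derivative
      (\<lambda>h. angular_coeff s * cnj (h *\<^sub>R \<alpha>' s) + (h *\<^sub>R ?c) * cnj (\<alpha> s))) (at s)"
    using has_derivative_mult[OF c[unfolded has_vector_derivative_def]
        bounded_linear.has_derivative[OF bounded_linear_cnj curve_has_derivative[OF s, unfolded has_vector_derivative_def]]] .
  ultimately have eq: "(\<lambda>h. angular_coeff s * cnj (h *\<^sub>R \<alpha>' s) + (h *\<^sub>R ?c) * cnj (\<alpha> s)) = (\<lambda>h. 0)"
    by (rule has_derivative_unique[rotated])
  have "angular_coeff s * cnj (\<alpha>' s) + ?c * cnj (\<alpha> s) = 0"
    using fun_cong[OF eq, where x = 1] by simp
  then have sum: "Re (angular_coeff s * cnj (\<alpha>' s)) + Re (?c * cnj (\<alpha> s)) = 0"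
    unfolding plus_complex.sel(1)[symmetric] by (simp only: zero_complex.sel(1))
  have "Re (angular_coeff s * cnj (\<alpha>' s)) = inner (\<alpha>' s) (\<alpha> s) / (norm (\<alpha> s))\<^sup>2"
    unfolding angular_coeff_eq[OF s] by (simp add: inner_complex_def algebra_simps add_divide_distrib)
  then show thesis using that[OF c] sum by simp
qed

lemma grad_psi_smooth_chart: "smooth_vector_field A (chart_dom A i) grad_psi"
  by (rule smooth_vector_field_mono[OF grad_psi_smooth]) (auto simp: points_def)

abbreviation push_grad_psi :: "'a \<Rightarrow> complex^('m option)" where
  "push_grad_psi q \<equiv> mdiff A \<psi> q (grad_psi q)"

lemma push_grad_psi_derivative:
  assumes i: "x \<in> chart_dom A i"
  obtains B where "(push_grad_psi \<circ> chart_inv A i has_derivative B) (at (chart_map A i x))"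
    and "\<And>v. v \<in> tangent_space A x \<Longrightarrow> mdiff A push_grad_psi x v = B (v i)"
proof -
  note B = field_has_derivative[OF open_chart_dom order_refl grad_psi_smooth_chart i]
  show thesis by (rule that[OF B mdiff_chart[OF i _ B]])
qed

text \<open>Differentiate \<open>(d\<psi>(\<nabla>\<beta>\<^sub>\<psi>), \<psi>) = 0\<close>. The \<open>\<psi>\<close>-component of the ambient derivative is the second
  fundamental form of the sphere; it produces the \<open>\<partial>\<^sub>s\<close>-component in the covariant derivative of
  \<open>\<nabla>\<beta>\<^sub>\<Phi>\<close> along the manifold.\<close>

lemma hermitian_push_grad_psi:
  assumes x: "x \<in> points A" and v: "v \<in> tangent_space A x"
  shows "hermitian (mdiff A push_grad_psi x v) (\<psi> x) =
    - of_real (push_grad_psi x \<bullet> mdiff A \<psi> x v)"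
proof -
  obtain i where i: "x \<in> chart_dom A i" using x by (auto simp: points_def)
  obtain B where B: "(push_grad_psi \<circ> chart_inv A i has_derivative B) (at (chart_map A i x))"
    and Bv: "mdiff A push_grad_psi x v = B (v i)"
    by (rule push_grad_psi_derivative[OF i]) (use v in blast)
  have "((\<lambda>u. hermitian ((push_grad_psi \<circ> chart_inv A i) u) (coord_map i u)) has_derivative (\<lambda>h. 0)) (at (chart_map A i x))"
  proof (rule has_derivative_transform_within_open[OF has_derivative_const[where c = 0] open_coord])
    fix u assume "u \<in> chart_map A i ` chart_dom A i"
    then obtain q where q: "q \<in> chart_dom A i" "u = chart_map A i q" by auto
    show "0 = hermitian ((push_grad_psi \<circ> chart_inv A i) u) (coord_map i u)"
      using hermitian_mdiff_psi(1)[OF chart_dom_points[OF q(1)] grad_psi_tangent[OF chart_dom_points[OF q(1)]]] q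
      by simp
  qed (use i in simp)
  from fun_cong[OF has_derivative_unique[OF has_derivative_hermitian[OF B coord_has_derivative[OF i]] this], where x = "v i"]
  have "hermitian (push_grad_psi x) (mdiff A \<psi> x v) + hermitian (B (v i)) (\<psi> x) = 0"
    using i by (simp add: mdiff_coord[OF i v])
  then show ?thesis
    unfolding Bv hermitian_mdiff_mdiff[OF x grad_psi_tangent[OF x] v] by (simp add: eq_neg_iff_add_eq_0 add.commute)
qed

lemma mdiff_push_grad_Phi:
  assumes s: "s \<in> I" and x: "x \<in> points A" and v: "v \<in> tangent_space A x"
    and c1: "(radial_coeff has_vector_derivative c1) (at s)"
    and c2: "(angular_coeff has_vector_derivative c2) (at s)"
  shows "mdiff P (\<lambda>q. mdiff P \<Phi> q (grad_Phi q)) (s, x) (tpair A x a v) =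
    (radial_coeff s *s mdiff A \<psi> x v + (a *\<^sub>R c1) *s \<psi> x) +
    (angular_coeff s *s mdiff A push_grad_psi x v + (a *\<^sub>R c2) *s push_grad_psi x)"
proof -
  obtain i where i: "x \<in> chart_dom A i" using x by (auto simp: points_def)
  obtain B where B: "(push_grad_psi \<circ> chart_inv A i has_derivative B) (at (chart_map A i x))"
    and Bv: "mdiff A push_grad_psi x v = B (v i)"
    by (rule push_grad_psi_derivative[OF i]) (use v in blast)
  let ?w = "chart_map P i (s, x)"
  let ?D = "\<lambda>z. (radial_coeff s *s coord_deriv i (chart_map A i x) (vec_tail z) + ((z $ None) *\<^sub>R c1) *s \<psi> x) +
      (angular_coeff s *s B (vec_tail z) + ((z $ None) *\<^sub>R c2) *s push_grad_psi x)"
  have w: "?w $ None = s" "vec_tail ?w = chart_map A i x" by (simp_all add: prod_map)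
  have q: "(s, x) \<in> chart_dom P i" using s i by (simp add: prod_dom_iff)
  have "((\<lambda>q. mdiff P \<Phi> q (grad_Phi q)) \<circ> chart_inv P i has_derivative ?D) (at ?w)"
  proof (rule has_derivative_transform_within_open[OF _ open_prod_coord imageI[OF q]])
    show "((\<lambda>w. radial_coeff (w $ None) *s coord_map i (vec_tail w) +
        angular_coeff (w $ None) *s (push_grad_psi \<circ> chart_inv A i) (vec_tail w)) has_derivative ?D) (at ?w)"
      using has_derivative_add[OF
          has_derivative_smult_split[of radial_coeff c1 ?w "coord_map i", unfolded w, OF c1 coord_has_derivative[OF i]]
          has_derivative_smult_split[of angular_coeff c2 ?w "push_grad_psi \<circ> chart_inv A i", unfolded w, OF c2 B]] i
      by simp
    fix w assume "w \<in> chart_map P i ` chart_dom P i"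
    then have "w $ None \<in> I" "vec_tail w \<in> chart_map A i ` chart_dom A i" by (auto simp: prod_image_dom)
    moreover from this(2) have "chart_inv A i (vec_tail w) \<in> points A" by (auto intro: chart_dom_points)
    ultimately show "radial_coeff (w $ None) *s coord_map i (vec_tail w) +
        angular_coeff (w $ None) *s (push_grad_psi \<circ> chart_inv A i) (vec_tail w) =
        ((\<lambda>q. mdiff P \<Phi> q (grad_Phi q)) \<circ> chart_inv P i) w"
      by (simp add: prod_chart_inv mdiff_grad_Phi)
  qed
  from prod.mdiff_chart[OF q tpair_tangent[OF s x v] this]
  show ?thesis by (simp add: tpair_coordinate[OF i] mdiff_coord[OF i v] Bv)
qed

text \<open>Both directions \<open>\<partial>\<^sub>s\<close> and \<open>X\<close> are treated at once, by computing the inner products of both sides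
  with an arbitrary tangent vector. For the left-hand side, the connection is replaced by the ambient
  derivative, and the inner product is the real part of a sum of five Hermitian products in which the
  factors depending on \<open>s\<close> can be collected; the connection of the manifold reappears in the product
  of the derivative of \<open>d\<psi>(\<nabla>\<beta>\<^sub>\<psi>)\<close> with \<open>d\<psi>(w)\<close>.\<close>

theorem connection_grad_Phi:
  assumes D: "levi_civita A (induced_metric A \<psi>) D" and D': "levi_civita P (induced_metric P \<Phi>) D'"
    and s: "s \<in> I" and x: "x \<in> points A" and v: "v \<in> tangent_space A x"
  defines "q \<equiv> inner (\<alpha>' s) (\<alpha> s)" and "n \<equiv> (norm (\<alpha> s))\<^sup>2"
  shows "D' (s, x) (tpair A x a v) grad_Phi =
    tpair A x (a * deriv (angle_deriv curve_angle) s - q / n * angle_diff A (legendrian_angle A \<psi>) x v)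
      (\<lambda>i. (1 / n) *\<^sub>R D x v grad_psi i +
           1 *\<^sub>R ((angle_deriv curve_angle s * q / n) *\<^sub>R v i + (- a * q / n\<^sup>2) *\<^sub>R grad_psi x i))"
proof -
  have P: "(s, x) \<in> points P" using s x by (simp add: prod_points)
  have n: "n \<noteq> 0" using curve_nonzero[OF s] by (simp add: n_def)
  note g = grad_psi_tangent[OF x]
  have conn: "affine_connection A D" "affine_connection P D'"
    using D D' by (auto simp: levi_civita_def)
  have Dv: "D x v grad_psi \<in> tangent_space A x"
    by (rule affine_connection_tangent[OF conn(1) open_points order_refl grad_psi_smooth x v])
  let ?r = "\<lambda>i. (angle_deriv curve_angle s * q / n) *\<^sub>R v i + (- a * q / n\<^sup>2) *\<^sub>R grad_psi x i"
  let ?R = "\<lambda>i. (1 / n) *\<^sub>R D x v grad_psi i + 1 *\<^sub>R ?r i"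
  have r: "?r \<in> tangent_space A x" by (rule tangent_space_lincomb[OF v g])
  have R: "?R \<in> tangent_space A x" by (rule tangent_space_lincomb[OF Dv r])
  obtain c2 where c2: "(angular_coeff has_vector_derivative c2) (at s)"
    and c2a: "Re (c2 * cnj (\<alpha> s)) = - q / n" and c2b: "Re (angular_coeff s * cnj (\<alpha>' s)) = q / n"
    unfolding q_def n_def by (rule angular_coeff_derivative[OF s])
  let ?c1 = "angle_deriv curve_angle s *\<^sub>R vector_derivative \<alpha>' (at s) + deriv (angle_deriv curve_angle) s *\<^sub>R \<alpha>' s"
  (* the real parts of the factors depending on s in the five products *)
  have c2c: "angular_coeff s * cnj (\<alpha> s) = 1" using curve_nonzero[OF s] by (simp add: angular_coeff_def)
  have c1a: "Re (radial_coeff s * cnj (\<alpha> s)) = angle_deriv curve_angle s * q"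
    by (simp add: radial_coeff_def q_def inner_complex_def algebra_simps)
  have c1b: "Re (?c1 * cnj (\<alpha>' s)) = deriv (angle_deriv curve_angle) s"
  proof -
    have "Re (?c1 * cnj (\<alpha>' s)) = angle_deriv curve_angle s * Re (vector_derivative \<alpha>' (at s) * cnj (\<alpha>' s)) + deriv (angle_deriv curve_angle) s * Re (\<alpha>' s * cnj (\<alpha>' s))"
      by (simp add: algebra_simps)
    also have "Re (\<alpha>' s * cnj (\<alpha>' s)) = 1" using arclength[OF s] complex_norm_square[of "\<alpha>' s"] by simp
    finally show ?thesis using curve_acceleration_orthogonal[OF s] by simp
  qed
  have Re_real_mult: "Re (of_real r * c) = r * Re c" for r c by simp
  show ?thesis
  proof (rule cone.tangent_eqI_inner[OF P])
    show "D' (s, x) (tpair A x a v) grad_Phi \<in> tangent_space P (s, x)"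
      by (rule affine_connection_tangent[OF conn(2) prod.open_points order_refl grad_Phi_smooth P tpair_tangent[OF s x v]])
    show "tpair A x (a * deriv (angle_deriv curve_angle) s - q / n * angle_diff A (legendrian_angle A \<psi>) x v) ?R \<in> tangent_space P (s, x)"
      by (rule tpair_tangent[OF s x R])
    fix z assume z: "z \<in> tangent_space P (s, x)"
    then obtain b w where w: "w \<in> tangent_space A x" and zw: "z = tpair A x b w"
      using tangent_space_prodE[OF _ s x] by blast
    let ?d = "mdiff A \<psi> x" and ?B = "mdiff A push_grad_psi x v"
    have B: "?B \<bullet> ?d w = ?d (D x v grad_psi) \<bullet> ?d w"
      by (rule levi_civita_induced[OF D open_points order_refl grad_psi_smooth x v w, symmetric])
    have "mdiff P \<Phi> (s, x) (D' (s, x) (tpair A x a v) grad_Phi) \<bullet> mdiff P \<Phi> (s, x) z =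
        mdiff P (\<lambda>q. mdiff P \<Phi> q (grad_Phi q)) (s, x) (tpair A x a v) \<bullet> mdiff P \<Phi> (s, x) z"
      by (rule cone.levi_civita_induced[OF D' prod.open_points order_refl grad_Phi_smooth P tpair_tangent[OF s x v] z])
    also have "\<dots> = Re (of_real (?d v \<bullet> ?d w) * (radial_coeff s * cnj (\<alpha> s)) +
        of_real (a * b) * (?c1 * cnj (\<alpha>' s)) +
        (angular_coeff s * cnj (\<alpha> s)) * hermitian ?B (?d w) +
        of_real (- b * (push_grad_psi x \<bullet> ?d v)) * (angular_coeff s * cnj (\<alpha>' s)) +
        of_real (a * (push_grad_psi x \<bullet> ?d w)) * (c2 * cnj (\<alpha> s)))"
      unfolding zw mdiff_cone[OF s x w] mdiff_push_grad_Phi[OF s x v radial_coeff_derivative[OF s] c2]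
        inner_eq_Re_hermitian[of "_ + _"]
      by (intro arg_cong[where f = Re])
         (simp add: hermitian_add_left hermitian_add_right hermitian_scale_left hermitian_scale_right
           hermitian_mdiff_psi[OF x] v w g hermitian_mdiff_mdiff[OF x] hermitian_psi_psi[OF x]
           hermitian_push_grad_psi[OF x v] scaleR_conv_of_real algebra_simps)
    also have "\<dots> = angle_deriv curve_angle s * q * (?d v \<bullet> ?d w) + a * b * deriv (angle_deriv curve_angle) s + ?d (D x v grad_psi) \<bullet> ?d w
        - b * (q / n) * (push_grad_psi x \<bullet> ?d v) - a * (q / n) * (push_grad_psi x \<bullet> ?d w)"
      unfolding plus_complex.sel Re_real_mult c1a c1b c2a c2b c2c mult_1_left
        inner_eq_Re_hermitian[symmetric] B by (simp add: algebra_simps)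
    also have "\<dots> = mdiff P \<Phi> (s, x) (tpair A x (a * deriv (angle_deriv curve_angle) s - q / n * angle_diff A (legendrian_angle A \<psi>) x v) ?R)
        \<bullet> mdiff P \<Phi> (s, x) z"
      unfolding zw cone_metric[OF s x R w] mdiff_lincomb[OF x Dv r] mdiff_lincomb[OF x v g]
        n_def[symmetric] angle_grad_inner[OF legendrian_angle_smooth x v, symmetric]
        inner_add_left inner_scaleR_left
      using n by (simp add: field_simps power2_eq_square)
    finally show "mdiff P \<Phi> (s, x) (D' (s, x) (tpair A x a v) grad_Phi) \<bullet> mdiff P \<Phi> (s, x) z =
        mdiff P \<Phi> (s, x) (tpair A x (a * deriv (angle_deriv curve_angle) s - q / n * angle_diff A (legendrian_angle A \<psi>) x v) ?R)
        \<bullet> mdiff P \<Phi> (s, x) z" .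
  qed
qed

end

section \<open>The Laplacian of the Lagrangian angle\<close>

lemma (in manifold) affine_connection_zero:
  assumes "affine_connection A D" "open U" "U \<subseteq> points A" "smooth_vector_field A U Y" "p \<in> U"
  shows "D p (\<lambda>_. 0) Y = (\<lambda>_. 0)"
  using affine_connection_lincomb[OF assms tangent_space_zero tangent_space_zero, of 0 0] by simp

context legendrian_cone
begin

lemma angle_diff_zero:
  "x \<in> points A \<Longrightarrow> angle_diff A (legendrian_angle A \<psi>) x (\<lambda>_. 0) = 0"
  using angle_grad_inner[OF legendrian_angle_smooth _ tangent_space_zero, of x]
    mdiff_lincomb[OF _ tangent_space_zero tangent_space_zero, of x 0 0] by simp

lemma tvec_of_prod:
  assumes s: "s \<in> I" and x: "x \<in> chart_dom A i"
  shows "tvec_of P (s, x) i u = tpair A x (u $ None) (tvec_of A x i (vec_tail u))"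
  by (rule prod.tvec_of_eqI)
     (use s x in \<open>simp_all add: prod_dom_iff tpair_tangent chart_dom_points tvec_of_in_tangent_space
        tpair_coordinate tvec_of_same\<close>)

lemma radius_derivative:
  assumes s: "s \<in> I"
  shows "((\<lambda>t. norm (\<alpha> t)) has_real_derivative inner (\<alpha>' s) (\<alpha> s) / norm (\<alpha> s)) (at s)"
proof -
  have "((\<lambda>t. norm (\<alpha> t)) has_derivative (\<lambda>h. sgn (\<alpha> s) \<bullet> (h *\<^sub>R \<alpha>' s))) (at s)"
    using has_derivative_compose[OF curve_has_derivative[OF s, unfolded has_vector_derivative_def]
        has_derivative_norm[OF curve_nonzero[OF s]]] by (simp add: inner_commute)
  also have "(\<lambda>h. sgn (\<alpha> s) \<bullet> (h *\<^sub>R \<alpha>' s)) = (*) (inner (\<alpha>' s) (\<alpha> s) / norm (\<alpha> s))"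
    by (simp add: fun_eq_iff sgn_div_norm inner_commute divide_inverse)
  finally show ?thesis unfolding has_field_derivative_def .
qed

text \<open>Brings the first summand of the Laplacian into the form in which it arises as a trace: \<open>|\<alpha>|\<close> has
  derivative \<open>\<langle>\<alpha>', \<alpha>\<rangle> / |\<alpha>|\<close>.\<close>

lemma weighted_speed_derivative:
  assumes s: "s \<in> I"
  shows "1 / norm (\<alpha> s) ^ k * deriv (\<lambda>t. norm (\<alpha> t) ^ k * angle_deriv curve_angle t) s =
    deriv (angle_deriv curve_angle) s +
    real k * (angle_deriv curve_angle s * inner (\<alpha>' s) (\<alpha> s) / (norm (\<alpha> s))\<^sup>2)"
proof -
  let ?n = "norm (\<alpha> s)" and ?q = "inner (\<alpha>' s) (\<alpha> s)"
  have n: "?n \<noteq> 0" using curve_nonzero[OF s] by simp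
  have \<gamma>: "(angle_deriv curve_angle has_real_derivative deriv (angle_deriv curve_angle) s) (at s)"
    using smooth_on_has_derivative[OF angle_deriv_curve_angle_smooth s]
    by (metis DERIV_deriv_iff_real_differentiable differentiable_def)
  have "((\<lambda>t. norm (\<alpha> t) ^ k * angle_deriv curve_angle t) has_real_derivative
      (real k * ?n ^ (k - 1) * (?q / ?n)) * angle_deriv curve_angle s +
      ?n ^ k * deriv (angle_deriv curve_angle) s) (at s)"
    by (rule derivative_eq_intros radius_derivative[OF s] \<gamma> refl)+ simp
  then have D: "deriv (\<lambda>t. norm (\<alpha> t) ^ k * angle_deriv curve_angle t) s =
      (real k * ?n ^ (k - 1) * (?q / ?n)) * angle_deriv curve_angle s +
      ?n ^ k * deriv (angle_deriv curve_angle) s"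
    by (rule DERIV_imp_deriv)
  show ?thesis
    unfolding D using n by (cases k) (simp_all add: field_simps power2_eq_square)
qed

text \<open>The diagonal entry for \<open>\<partial>\<^sub>s\<close> is \<open>G''\<close>, and each of the \<open>m\<close> entries for the coordinate fields
  \<open>\<partial>\<^sub>k\<close> is the one of the manifold divided by \<open>|\<alpha>|\<^sup>2\<close>, plus \<open>G' \<langle>\<alpha>', \<alpha>\<rangle> / |\<alpha>|\<^sup>2\<close>. The chart in
  which \<^const>\<open>divergence\<close> evaluates the trace is the same for the product and the manifold, since
  the chart domains of the product are those of the manifold times the interval.\<close>

theorem laplacian_cone:
  assumes D: "levi_civita A (induced_metric A \<psi>) D" and D': "levi_civita P (induced_metric P \<Phi>) D'"
    and s: "s \<in> I" and x: "x \<in> points A"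
  shows "angle_laplacian P (induced_metric P \<Phi>) D' (lagrangian_angle P \<Phi>) (s, x) =
     1 / norm (\<alpha> s) ^ CARD('m) * deriv (\<lambda>t. norm (\<alpha> t) ^ CARD('m) * angle_deriv curve_angle t) s +
     1 / (norm (\<alpha> s))\<^sup>2 * angle_laplacian A (induced_metric A \<psi>) D (legendrian_angle A \<psi>) x"
proof -
  let ?i = "chart_at A x"
  let ?n = "(norm (\<alpha> s))\<^sup>2" and ?q = "inner (\<alpha>' s) (\<alpha> s)" and ?\<gamma> = "angle_deriv curve_angle"
  have i: "x \<in> chart_dom A ?i" by (rule chart_at_dom[OF x])
  have chart: "chart_at P (s, x) = ?i"
    using s by (simp add: chart_at_def prod_dom_iff)
  have conn: "affine_connection A D" using D by (simp add: levi_civita_def)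
  let ?M = "matrix (\<lambda>u. D' (s, x) (tvec_of P (s, x) ?i u) grad_Phi ?i)"
  have diag: "(axis k 1 :: real^'m) $ k = 1" for k
    by (simp add: axis_def)
  have t0: "tvec_of A x ?i 0 = (\<lambda>_. 0)"
    by (rule tvec_of_eqI[OF i tangent_space_zero]) simp
  have None: "?M $ None $ None = deriv ?\<gamma> s"
    by (simp add: matrix_def tvec_of_prod[OF s i] axis_option_None vec_tail_axis t0 connection_grad_Phi[OF D D' s x tangent_space_zero]
        tpair_coordinate[OF i] angle_diff_zero[OF x])
  have Some: "?M $ Some k $ Some k =
      1 / ?n * matrix (\<lambda>u. D x (tvec_of A x ?i u) grad_psi ?i) $ k $ k + ?\<gamma> s * ?q / ?n" for k
    by (simp add: matrix_def tvec_of_prod[OF s i] axis_option_None vec_tail_axis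
        connection_grad_Phi[OF D D' s x tvec_of_in_tangent_space[OF i]]
        tpair_coordinate[OF i] tvec_of_same[OF i] diag)
  have "angle_laplacian P (induced_metric P \<Phi>) D' (lagrangian_angle P \<Phi>) (s, x) = trace ?M"
    by (simp add: angle_laplacian_def divergence_def Let_def chart)
  also have "\<dots> = deriv ?\<gamma> s + (\<Sum>k\<in>UNIV. 1 / ?n * matrix (\<lambda>u. D x (tvec_of A x ?i u) grad_psi ?i) $ k $ k + ?\<gamma> s * ?q / ?n)"
    by (simp only: trace_def sum_UNIV_option None Some)
  also have "\<dots> = deriv ?\<gamma> s + real CARD('m) * (?\<gamma> s * ?q / ?n) +
      1 / ?n * trace (matrix (\<lambda>u. D x (tvec_of A x ?i u) grad_psi ?i))"
    by (simp add: sum.distrib sum_distrib_left[symmetric] trace_def sum_divide_distrib)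
  finally show ?thesis
    unfolding weighted_speed_derivative[OF s] by (simp add: angle_laplacian_def divergence_def Let_def)
qed

end

theorem theorem1:
  fixes I :: "real set"
    and \<alpha> :: "real \<Rightarrow> complex"
    and A :: "('i, 'a::{t2_space, second_countable_topology}, 'm::finite) atlas"
    and \<psi> :: "'a \<Rightarrow> complex^('m option)"
  defines "\<alpha>' \<equiv> \<lambda>s. vector_derivative \<alpha> (at s)"
    and "g \<equiv> induced_metric A \<psi>"
    and "\<beta>\<^sub>\<psi> \<equiv> legendrian_angle A \<psi>"
    and "P \<equiv> prod_atlas I A"
    and "\<Phi> \<equiv> \<lambda>(s, x). \<alpha> s *s \<psi> x"
  defines "g' \<equiv> induced_metric P \<Phi>"
    and "\<beta>\<^sub>\<Phi> \<equiv> lagrangian_angle P \<Phi>"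
    and "G \<equiv> \<lambda>s. carg (\<alpha>' s) + (\<Sum>_<CARD('m). carg (\<alpha> s))"
  assumes "is_interval I" and "open I"
    and "smooth_on I \<alpha>"
    and "\<And>s. s \<in> I \<Longrightarrow> \<alpha> s \<noteq> 0"
    and "\<And>s. s \<in> I \<Longrightarrow> norm (\<alpha>' s) = 1"
    and "smooth_manifold A" and "oriented_atlas A"
    and "legendrian_immersion A \<psi>"
  shows "lagrangian_immersion P \<Phi> \<and>
    (\<forall>s\<in>I. \<forall>x\<in>points A.
       (\<forall>a b. \<forall>v\<in>tangent_space A x. \<forall>w\<in>tangent_space A x.
          g' (s, x) (tpair A x a v) (tpair A x b w) = a * b + (norm (\<alpha> s))\<^sup>2 * g x v w) \<and>
       \<beta>\<^sub>\<Phi> (s, x) = G s + \<beta>\<^sub>\<psi> x \<and>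
       angle_grad P g' \<beta>\<^sub>\<Phi> (s, x) =
         tpair A x (angle_deriv G s) (\<lambda>i. (1 / (norm (\<alpha> s))\<^sup>2) *\<^sub>R angle_grad A g \<beta>\<^sub>\<psi> x i)) \<and>
    (\<forall>D D'. levi_civita A g D \<longrightarrow> levi_civita P g' D' \<longrightarrow>
       (\<forall>s\<in>I. \<forall>x\<in>points A.
          D' (s, x) (tpair A x 1 (\<lambda>_. 0)) (angle_grad P g' \<beta>\<^sub>\<Phi>) =
            tpair A x (deriv (angle_deriv G) s)
              (\<lambda>i. - (inner (\<alpha>' s) (\<alpha> s) / (norm (\<alpha> s))^4) *\<^sub>R angle_grad A g \<beta>\<^sub>\<psi> x i) \<and>
          (\<forall>X. smooth_vector_field A (points A) X \<longrightarrow>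
             D' (s, x) (tpair A x 0 (X x)) (angle_grad P g' \<beta>\<^sub>\<Phi>) =
               tpair A x
                 (- (inner (\<alpha>' s) (\<alpha> s) / (norm (\<alpha> s))\<^sup>2) * angle_diff A \<beta>\<^sub>\<psi> x (X x))
                 (\<lambda>i. (1 / (norm (\<alpha> s))\<^sup>2) *\<^sub>R D x (X x) (angle_grad A g \<beta>\<^sub>\<psi>) i +
                      (angle_deriv G s * inner (\<alpha>' s) (\<alpha> s) / (norm (\<alpha> s))\<^sup>2) *\<^sub>R X x i)) \<and>
          angle_laplacian P g' D' \<beta>\<^sub>\<Phi> (s, x) =
            1 / (norm (\<alpha> s))^CARD('m)
              * deriv (\<lambda>t. (norm (\<alpha> t))^CARD('m) * angle_deriv G t) s +
            1 / (norm (\<alpha> s))\<^sup>2 * angle_laplacian A g D \<beta>\<^sub>\<psi> x))"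
proof -
  interpret legendrian_cone A \<psi> I \<alpha>
    by unfold_locales (use assms in auto)
  have G: "G = curve_angle" by (simp add: G_def \<alpha>'_def curve_angle_def)
  note defs = g'_def g_def \<beta>\<^sub>\<Phi>_def \<beta>\<^sub>\<psi>_def \<Phi>_def P_def G
  show ?thesis
    unfolding defs \<alpha>'_def
  proof (intro conjI ballI allI impI)
    show "lagrangian_immersion (prod_atlas I A) (\<lambda>(s, x). \<alpha> s *s \<psi> x)" by (rule cone_lagrangian)
  next
    fix s x assume s: "s \<in> I" and x: "x \<in> points A"
    show "induced_metric (prod_atlas I A) (\<lambda>(s, x). \<alpha> s *s \<psi> x) (s, x) (tpair A x a v) (tpair A x b w) =
        a * b + (norm (\<alpha> s))\<^sup>2 * induced_metric A \<psi> x v w"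
      if "v \<in> tangent_space A x" "w \<in> tangent_space A x" for a b v w
      unfolding induced_metric_def by (rule cone_metric[OF s x that])
    show "lagrangian_angle (prod_atlas I A) (\<lambda>(s, x). \<alpha> s *s \<psi> x) (s, x) = curve_angle s + legendrian_angle A \<psi> x"
      by (rule lagrangian_angle_cone_eq[OF s x])
    show "grad_Phi (s, x) = tpair A x (angle_deriv curve_angle s) (\<lambda>i. (1 / (norm (\<alpha> s))\<^sup>2) *\<^sub>R grad_psi x i)"
      by (rule angle_grad_cone[OF s x])
  next
    fix D D' s x
    assume D: "levi_civita A (induced_metric A \<psi>) D"
      and D': "levi_civita (prod_atlas I A) (induced_metric (prod_atlas I A) (\<lambda>(s, x). \<alpha> s *s \<psi> x)) D'"
      and s: "s \<in> I" and x: "x \<in> points A"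
    have "affine_connection A D" using D by (simp add: levi_civita_def)
    note zero = affine_connection_zero[OF this open_points order_refl grad_psi_smooth x] angle_diff_zero[OF x]
    show "D' (s, x) (tpair A x 1 (\<lambda>_. 0)) grad_Phi = tpair A x (deriv (angle_deriv curve_angle) s)
        (\<lambda>i. - (inner (vector_derivative \<alpha> (at s)) (\<alpha> s) / (norm (\<alpha> s))^4) *\<^sub>R grad_psi x i)"
      unfolding connection_grad_Phi[OF D D' s x tangent_space_zero] zero by simp
    show "D' (s, x) (tpair A x 0 (X x)) grad_Phi =
        tpair A x (- (inner (vector_derivative \<alpha> (at s)) (\<alpha> s) / (norm (\<alpha> s))\<^sup>2) *
            angle_diff A (legendrian_angle A \<psi>) x (X x))
          (\<lambda>i. (1 / (norm (\<alpha> s))\<^sup>2) *\<^sub>R D x (X x) grad_psi i +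
            (angle_deriv curve_angle s * inner (vector_derivative \<alpha> (at s)) (\<alpha> s) / (norm (\<alpha> s))\<^sup>2) *\<^sub>R X x i)"
      if X: "smooth_vector_field A (points A) X" for X
    proof -
      have "X x \<in> tangent_space A x" using X x by (simp add: smooth_vector_field_def)
      then show ?thesis unfolding connection_grad_Phi[OF D D' s x \<open>X x \<in> tangent_space A x\<close>] by simp
    qed
    show "angle_laplacian (prod_atlas I A) (induced_metric (prod_atlas I A) (\<lambda>(s, x). \<alpha> s *s \<psi> x)) D'
        (lagrangian_angle (prod_atlas I A) (\<lambda>(s, x). \<alpha> s *s \<psi> x)) (s, x) =
      1 / (norm (\<alpha> s))^CARD('m) * deriv (\<lambda>t. (norm (\<alpha> t))^CARD('m) * angle_deriv curve_angle t) s +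
      1 / (norm (\<alpha> s))\<^sup>2 * angle_laplacian A (induced_metric A \<psi>) D (legendrian_angle A \<psi>) x"
      by (rule laplacian_cone[OF D D' s x])
  qed
qed

end
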